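(* Let $\mathcal H$ be a Hilbert space. The map $\mathrm{spec}\colon\mathcal U_1(\mathcal H)\to\mathfrak S_1(\mathbb T)$ is continuous; moreover, for all $U_1,U_2\in\mathcal U_1(\mathcal H)$, $$d(\mathrm{spec}(U_1),\mathrm{spec}(U_2))\le d_1(U_1,U_2).$$
   Context: $\mathcal U_1(\mathcal H)$ is the group of unitary operators on $\mathcal H$ of the form $1+A$ with $A$ trace class. $d_1(U_0,U_1)=\inf\max_{r\in[a,b]}\|\frac{dU(r)}{dr}\|_1\,(b-a)$, the infimum over all piecewise real-analytic paths $U\colon[a,b]\to\mathcal U_1(\mathcal H)$ with $U(a)=U_0$, $U(b)=U_1$ ($\|\cdot\|_1$ the trace norm). Rigged sets: each point has a multiplicity in $\{0,1,\dots,\infty\}$; an enumeration lists each point according to its multiplicity. $\mathfrak S_1(\mathbb T)$ is the set of countable rigged subsets of the unit circle $\mathbb T$ (arc-length metric) in which $1$ has infinite multiplicity, with no other accumulation point, and with $d(S,\mathbf 1)<\infty$, where $d(S,T)=\inf\sum_j\mathrm{dist}(s_j,t_j)$ over enumerations and $\mathbf 1$ is $1$ with infinite multiplicity. $\mathrm{spec}(U)$ is the rigged set of eigenvalues of $U$ different from $1$ with their multiplicities, together with $1$ of infinite multiplicity. *)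

theory Defs
  imports "HOL-Analysis.Analysis"
begin

class complex_inner = real_normed_vector +
  fixes scaleC :: "complex \<Rightarrow> 'a \<Rightarrow> 'a" (infixr \<open>*\<^sub>C\<close> 75)
    and cinner :: "'a \<Rightarrow> 'a \<Rightarrow> complex"
  assumes scaleC_add_right: "c *\<^sub>C (x + y) = c *\<^sub>C x + c *\<^sub>C y"
    and scaleC_add_left: "(c + d) *\<^sub>C x = c *\<^sub>C x + d *\<^sub>C x"
    and scaleC_scaleC: "c *\<^sub>C (d *\<^sub>C x) = (c * d) *\<^sub>C x"
    and scaleC_one: "1 *\<^sub>C x = x"
    and scaleR_scaleC: "scaleR r x = complex_of_real r *\<^sub>C x"
    and cinner_commute: "cinner x y = cnj (cinner y x)"
    and cinner_add_right: "cinner x (y + z) = cinner x y + cinner x z"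
    and cinner_scaleC_right: "cinner x (c *\<^sub>C y) = c * cinner x y"
    and norm_cinner: "norm x = sqrt (Re (cinner x x))"

class chilbert_space = complex_inner + complete_space

definition clinear :: "('a::chilbert_space \<Rightarrow> 'a) \<Rightarrow> bool" where
  "clinear A \<longleftrightarrow> (\<forall>x y. A (x + y) = A x + A y) \<and> (\<forall>c x. A (c *\<^sub>C x) = c *\<^sub>C A x)"

definition orthonormal_fam :: "nat \<Rightarrow> (nat \<Rightarrow> 'a::chilbert_space) \<Rightarrow> bool" where
  "orthonormal_fam n e \<longleftrightarrow>
     (\<forall>i<n. \<forall>j<n. cinner (e i) (e j) = (if i = j then 1 else 0))"

text \<open>Trace norm: the supremum of \<open>\<Sum>\<bar><A e_i, f_i>\<bar>\<close> over (finite, hence all)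
pairs of orthonormal families; it is \<open>\<top>\<close> iff the operator is not trace class.\<close>

definition trace_norm :: "('a::chilbert_space \<Rightarrow> 'a) \<Rightarrow> ennreal" where
  "trace_norm A = Sup {ennreal (\<Sum>i<n. cmod (cinner (A (e i)) (f i))) | n e f.
                          orthonormal_fam n e \<and> orthonormal_fam n f}"

definition trace_class :: "('a::chilbert_space \<Rightarrow> 'a) \<Rightarrow> bool" where
  "trace_class A \<longleftrightarrow> clinear A \<and> trace_norm A < top"

definition unitary_op :: "('a::chilbert_space \<Rightarrow> 'a) \<Rightarrow> bool" where
  "unitary_op U \<longleftrightarrow> clinear U \<and> surj U \<and> (\<forall>x y. cinner (U x) (U y) = cinner x y)"

definition unitary1 :: "('a::chilbert_space \<Rightarrow> 'a) set" where
  "unitary1 = {U. unitary_op U \<and> trace_class (\<lambda>x. U x - x)}"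

definition tn_analytic_on :: "(real \<Rightarrow> 'a::chilbert_space \<Rightarrow> 'a) \<Rightarrow> real set \<Rightarrow> bool" where
  "tn_analytic_on U S \<longleftrightarrow>
     (\<forall>r0\<in>S. \<exists>\<delta>>0. \<exists>A::nat \<Rightarrow> 'a \<Rightarrow> 'a. (\<forall>n. trace_class (A n)) \<and>
        (\<forall>r\<in>S. \<bar>r - r0\<bar> < \<delta> \<longrightarrow>
           ((\<lambda>N. trace_norm (\<lambda>x. U r x - U r0 x - (\<Sum>n<N. (r - r0) ^ Suc n *\<^sub>R A n x)))
              \<longlongrightarrow> 0) sequentially))"

definition tn_deriv_within ::
    "(real \<Rightarrow> 'a::chilbert_space \<Rightarrow> 'a) \<Rightarrow> ('a \<Rightarrow> 'a) \<Rightarrow> real \<Rightarrow> real set \<Rightarrow> bool" where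
  "tn_deriv_within U D r S \<longleftrightarrow>
     ((\<lambda>s. trace_norm (\<lambda>x. (1 / (s - r)) *\<^sub>R (U s x - U r x) - D x)) \<longlongrightarrow> 0) (at r within S)"

text \<open>\<open>d\<^sub>1(U\<^sub>0,U\<^sub>1)\<close>: infimum of \<open>(b-a) \<cdot> max \<parallel>U'(r)\<parallel>\<^sub>1\<close> over piecewise real-analytic
paths \<open>[a,b] \<rightarrow> \<U>\<^sub>1(H)\<close>, given by a partition \<open>a = t 0 < \<dots> < t k = b\<close> with \<open>U\<close>
analytic on each closed piece (one-sided derivatives at the break points).\<close>

definition d1 :: "('a::chilbert_space \<Rightarrow> 'a) \<Rightarrow> ('a \<Rightarrow> 'a) \<Rightarrow> ennreal" where
  "d1 U0 U1 = Inf {ennreal (b - a) *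
        Sup {trace_norm D | r D. \<exists>j<k. r \<in> {t j..t (Suc j)} \<and> trace_class D \<and>
                                   tn_deriv_within U D r {t j..t (Suc j)}}
      | U a b k t. a < b \<and> t 0 = a \<and> t k = b \<and> (\<forall>j<k. t j < t (Suc j)) \<and>
          (\<forall>j<k. tn_analytic_on U {t j..t (Suc j)}) \<and>
          (\<forall>r\<in>{a..b}. U r \<in> unitary1) \<and> U a = U0 \<and> U b = U1}"

text \<open>A rigged subset of \<open>\<complex>\<close> is represented by its multiplicity function.\<close>

type_synonym rigged = "complex \<Rightarrow> enat"

definition arcdist :: "complex \<Rightarrow> complex \<Rightarrow> real" where
  "arcdist z w = \<bar>Arg (z * cnj w)\<bar>"

definition enumeration_of :: "rigged \<Rightarrow> (nat \<Rightarrow> complex) \<Rightarrow> bool" where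
  "enumeration_of m s \<longleftrightarrow>
     (\<forall>z. m z = (if finite {j. s j = z} then enat (card {j. s j = z}) else \<infinity>))"

definition rigged_dist :: "rigged \<Rightarrow> rigged \<Rightarrow> ennreal" where
  "rigged_dist m1 m2 = Inf {(\<Sum>j. ennreal (arcdist (s j) (t j))) | s t.
                              enumeration_of m1 s \<and> enumeration_of m2 t}"

definition one_rigged :: rigged where
  "one_rigged z = (if z = 1 then \<infinity> else 0)"

definition S1T :: "rigged set" where
  "S1T = {m. (\<forall>z. m z \<noteq> 0 \<longrightarrow> cmod z = 1) \<and> m 1 = \<infinity> \<and>
             countable {z. m z \<noteq> 0} \<and> (\<forall>z. z \<noteq> 1 \<longrightarrow> \<not> z islimpt {w. m w \<noteq> 0}) \<and>
             rigged_dist m one_rigged < top}"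

text \<open>Spectrum: eigenvalues \<open>\<noteq> 1\<close> with multiplicity (dimension of the eigenspace,
i.e. the supremum of sizes of orthonormal families of eigenvectors), and \<open>1\<close> with
infinite multiplicity.\<close>

definition spec :: "('a::chilbert_space \<Rightarrow> 'a) \<Rightarrow> rigged" where
  "spec U z = (if z = 1 then \<infinity> else
     Sup {enat n | n. \<exists>e. orthonormal_fam n e \<and> (\<forall>i<n. U (e i) = z *\<^sub>C e i)})"

end

theory Submission
  imports Defs "HOL-Library.Diagonal_Subsequence"
begin

text \<open>Let \<open>f\<^sub>i\<close> be orthonormal eigenvectors of \<open>V\<close> with eigenvalues \<open>z\<^sub>i\<close>, let \<open>U\<close> be fixed and
\<open>V\<close> close to \<open>U\<close>, and let \<open>\<zeta>\<^sub>i\<close> be the eigenvalue of \<open>U\<close> nearest to \<open>z\<^sub>i\<close>. Since \<open>U\<close> is normal,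
the Rayleigh quotient of \<open>U\<close> at \<open>f\<^sub>i\<close> differs from \<open>\<zeta>\<^sub>i\<close> only to second order, hence
\<open>|z\<^sub>i - \<zeta>\<^sub>i| \<le> |<(V - U) f\<^sub>i, f\<^sub>i>| + O(\<parallel>V - U\<parallel>\<^sup>2)\<close>, and the sum over \<open>i\<close> of the first terms is at most the
trace norm of \<open>V - U\<close>. The error is uniform only over the finitely many eigenvalues that stay away from \<open>1\<close>;
therefore the circle is replaced by its quotient collapsing a small arc around \<open>1\<close>. In that
metric the spectrum moves along a path with speed at most the trace norm of the derivative (a pointwise
statement, integrated by bisection, so no analytic perturbation theory is needed). Finally the arc
shrinks to \<open>1\<close>, where the trace condition makes the discarded part negligible.\<close>

section \<open>Inner products and orthonormal families\<close>

text \<open>Three obstacles shape the argument. No spectral theorem is invoked: eigenvectors come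
  from maximizing \<open>norm (U x - x)\<close> on an invariant orthogonal complement, where
  compactness of \<open>U - 1\<close> is extracted from the supremum defining the trace norm. Hence
  a maximal finite family of eigenvectors with eigenvalues at distance at least \<open>c\<close>
  from 1 also bounds \<open>U - 1\<close> by \<open>c\<close> on its complement, and this bound
  stands in for the rest of the spectrum. Sending an eigenvalue of \<open>V\<close> to the nearest
  one of \<open>U\<close> need not respect multiplicities. Eigenvectors of each operator are shown
  to concentrate, up to a second-order defect, on the matching eigenspaces of the other; double
  counting in both directions then makes the integer dimensions equal. Finally, the admissible size
  of the perturbation depends on the spectral gaps of the base operator and on the collapsed arc, so
  no uniform step size along the path is at hand. Each estimate is centred at one point of the
  interval and has an arbitrarily small excess in its constant; this suffices for bisection, and the
  excess is removed before the arc shrinks.\<close>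

lemma cinner_add_left: "cinner (x + y) z = cinner x z + cinner y (z::'a::complex_inner)"
  by (metis cinner_add_right cinner_commute complex_cnj_add)

lemma cinner_scaleC_left: "cinner (c *\<^sub>C x) y = cnj c * cinner x (y::'a::complex_inner)"
  by (metis cinner_commute cinner_scaleC_right complex_cnj_mult)

lemma cinner_zero_right [simp]: "cinner x (0::'a::complex_inner) = 0"
  using cinner_add_right[of x 0 0] by simp

lemma cinner_zero_left [simp]: "cinner (0::'a::complex_inner) x = 0"
  using cinner_add_left[of 0 0 x] by simp

lemma cinner_minus_right: "cinner x (- y) = - cinner x (y::'a::complex_inner)"
  using cinner_add_right[of x y "- y"] by (simp add: eq_neg_iff_add_eq_0 add.commute)

lemma cinner_minus_left: "cinner (- x) y = - cinner x (y::'a::complex_inner)"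
  using cinner_add_left[of x "- x" y] by (simp add: eq_neg_iff_add_eq_0 add.commute)

lemma cinner_diff_right: "cinner x (y - z) = cinner x y - cinner x (z::'a::complex_inner)"
  using cinner_add_right[of x y "- z"] by (simp add: cinner_minus_right)

lemma cinner_diff_left: "cinner (x - y) z = cinner x z - cinner y (z::'a::complex_inner)"
  using cinner_add_left[of x "- y" z] by (simp add: cinner_minus_left)

lemma cinner_sum_right: "cinner x (\<Sum>i\<in>I. f i) = (\<Sum>i\<in>I. cinner x (f i :: 'a::complex_inner))"
  by (induction I rule: infinite_finite_induct) (auto simp: cinner_add_right)

lemma cinner_sum_left: "cinner (\<Sum>i\<in>I. f i) x = (\<Sum>i\<in>I. cinner (f i) (x :: 'a::complex_inner))"
  by (induction I rule: infinite_finite_induct) (auto simp: cinner_add_left)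

lemma cinner_scaleR_left: "cinner (r *\<^sub>R x) y = of_real r * cinner x (y::'a::complex_inner)"
  by (simp add: scaleR_scaleC cinner_scaleC_left)

lemma scaleC_zero_left [simp]: "0 *\<^sub>C x = (0::'a::complex_inner)"
  by (metis of_real_0 scaleR_scaleC scaleR_zero_left)

lemma scaleC_zero_right [simp]: "c *\<^sub>C 0 = (0::'a::complex_inner)"
  using scaleC_add_right[of c 0 "0::'a"] by simp

lemma scaleC_minus_left: "(- c) *\<^sub>C x = - (c *\<^sub>C (x::'a::complex_inner))"
  using scaleC_add_left[of c "- c" x] by (simp add: eq_neg_iff_add_eq_0 add.commute)

lemma scaleC_minus_right: "c *\<^sub>C (- x) = - (c *\<^sub>C (x::'a::complex_inner))"
  using scaleC_add_right[of c x "- x"] by (simp add: eq_neg_iff_add_eq_0 add.commute)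

lemma scaleC_diff_left: "(c - d) *\<^sub>C x = c *\<^sub>C x - d *\<^sub>C (x::'a::complex_inner)"
  using scaleC_add_left[of c "- d" x] by (simp add: scaleC_minus_left)

lemma scaleC_diff_right: "c *\<^sub>C (x - y) = c *\<^sub>C x - c *\<^sub>C (y::'a::complex_inner)"
  using scaleC_add_right[of c x "- y"] by (simp add: scaleC_minus_right)

lemma scaleC_sum_right: "c *\<^sub>C (\<Sum>i\<in>I. f i) = (\<Sum>i\<in>I. c *\<^sub>C (f i :: 'a::complex_inner))"
  by (induction I rule: infinite_finite_induct) (auto simp: scaleC_add_right)

lemma cinner_self: "cinner x x = complex_of_real ((norm (x::'a::complex_inner))\<^sup>2)"
proof -
  have "Im (cinner x x) = 0"
    using cinner_commute[of x x] by (metis cnj.simps(2) equal_neg_zero)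
  \<comment> \<open>Positivity is not an axiom of the class. Since \<open>sqrt\<close> is negative
    on negative reals, nonnegativity of the norm already forces it.\<close>
  moreover have "Re (cinner x x) \<ge> 0"
    using norm_cinner[of x] norm_ge_zero[of x] by (metis real_sqrt_ge_0_iff)
  ultimately show ?thesis
    by (simp add: norm_cinner complex_eq_iff)
qed

lemma norm_sq_cinner: "(norm (x::'a::complex_inner))\<^sup>2 = Re (cinner x x)"
  by (simp add: cinner_self)

lemma norm_scaleC: "norm (c *\<^sub>C (x::'a::complex_inner)) = cmod c * norm x"
proof -
  have "cinner (c *\<^sub>C x) (c *\<^sub>C x) = (c * cnj c) * cinner x x"
    by (simp add: cinner_scaleC_left cinner_scaleC_right)
  then have "cinner (c *\<^sub>C x) (c *\<^sub>C x) = of_real ((cmod c * norm x)\<^sup>2)"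
    unfolding complex_norm_square[symmetric] cinner_self[of x] by (simp add: power_mult_distrib)
  then have "(norm (c *\<^sub>C x))\<^sup>2 = (cmod c * norm x)\<^sup>2"
    by (simp only: norm_sq_cinner Re_complex_of_real)
  then show ?thesis by simp
qed

lemma norm_sq_diff:
  "(norm (x - y))\<^sup>2 = (norm x)\<^sup>2 + (norm y)\<^sup>2 - 2 * Re (cinner x (y::'a::complex_inner))"
proof -
  have "Re (cinner y x) = Re (cinner x y)"
    by (subst cinner_commute) simp
  then show ?thesis
    by (simp add: norm_sq_cinner cinner_diff_left cinner_diff_right)
qed

section \<open>Finite orthonormal families: projections, Bessel's inequality, double
  counting\<close>

definition orthonormal_on :: "'i set \<Rightarrow> ('i \<Rightarrow> 'a::complex_inner) \<Rightarrow> bool" where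
  "orthonormal_on I e \<longleftrightarrow> (\<forall>i\<in>I. \<forall>j\<in>I. cinner (e i) (e j) = (if i = j then 1 else 0))"

lemma orthonormal_fam_iff: "orthonormal_fam n e \<longleftrightarrow> orthonormal_on {..<n} e"
  by (auto simp: orthonormal_fam_def orthonormal_on_def)

lemma orthonormal_on_subset: "orthonormal_on I e \<Longrightarrow> J \<subseteq> I \<Longrightarrow> orthonormal_on J e"
  unfolding orthonormal_on_def by blast

lemma orthonormal_on_reindex:
  "orthonormal_on I e \<Longrightarrow> inj_on g J \<Longrightarrow> g ` J \<subseteq> I \<Longrightarrow> orthonormal_on J (\<lambda>j. e (g j))"
  unfolding orthonormal_on_def inj_on_def by (auto simp: image_subset_iff)

lemma orthonormal_on_norm: "orthonormal_on I e \<Longrightarrow> i \<in> I \<Longrightarrow> norm (e i) = 1"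
  unfolding orthonormal_on_def by (simp add: norm_cinner)

lemma cinner_orthonormal_sum:
  assumes "orthonormal_on I e" "finite I" "i \<in> I"
  shows "cinner (e i) (\<Sum>j\<in>I. a j *\<^sub>C e j) = a i"
proof -
  have "cinner (e i) (\<Sum>j\<in>I. a j *\<^sub>C e j) = (\<Sum>j\<in>I. if i = j then a j else 0)"
    unfolding cinner_sum_right
    by (rule sum.cong) (use assms in \<open>auto simp: cinner_scaleC_right orthonormal_on_def\<close>)
  then show ?thesis using assms by simp
qed

text \<open>For finite \<open>I\<close> and orthonormal \<open>e\<close> this is the orthogonal
  projection onto the complement of their span.\<close>

definition proj_compl :: "'i set \<Rightarrow> ('i \<Rightarrow> 'a::complex_inner) \<Rightarrow> 'a \<Rightarrow> 'a" where
  "proj_compl I e x = x - (\<Sum>i\<in>I. cinner (e i) x *\<^sub>C e i)"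

lemma cinner_proj_compl:
  assumes "orthonormal_on I e" "finite I" "i \<in> I"
  shows "cinner (e i) (proj_compl I e x) = 0"
  using cinner_orthonormal_sum[OF assms] by (simp add: proj_compl_def cinner_diff_right)

lemma cinner_orthonormal_sums:
  assumes "orthonormal_on I e" "finite I"
  shows "cinner (\<Sum>j\<in>I. a j *\<^sub>C e j) (\<Sum>j\<in>I. b j *\<^sub>C e j) = (\<Sum>j\<in>I. cnj (a j) * b j)"
  unfolding cinner_sum_left
  by (rule sum.cong) (simp_all add: cinner_scaleC_left cinner_orthonormal_sum[OF assms])

lemma norm_sq_orthonormal_sum:
  assumes "orthonormal_on I e" "finite I"
  shows "(norm (\<Sum>j\<in>I. a j *\<^sub>C e j))\<^sup>2 = (\<Sum>j\<in>I. (cmod (a j))\<^sup>2)"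
proof -
  have "complex_of_real ((norm (\<Sum>j\<in>I. a j *\<^sub>C e j))\<^sup>2) = complex_of_real (\<Sum>j\<in>I. (cmod (a j))\<^sup>2)"
    unfolding cinner_self[symmetric] cinner_orthonormal_sums[OF assms] of_real_sum complex_norm_square
    by (simp add: mult.commute)
  then show ?thesis using of_real_eq_iff by blast
qed

lemma norm_sq_add_orthogonal:
  assumes "cinner x y = 0" shows "(norm (x + y))\<^sup>2 = (norm x)\<^sup>2 + (norm (y::'a::complex_inner))\<^sup>2"
  using norm_sq_diff[of x "- y"] assms by (simp add: cinner_minus_right)

lemma bessel_identity:
  assumes "orthonormal_on I e" "finite I"
  shows "(norm x)\<^sup>2 = (\<Sum>i\<in>I. (cmod (cinner (e i) x))\<^sup>2) + (norm (proj_compl I e x))\<^sup>2"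
proof -
  let ?P = "\<Sum>i\<in>I. cinner (e i) x *\<^sub>C e i"
  have "cinner ?P (proj_compl I e x) = 0"
    unfolding cinner_sum_left by (simp add: cinner_scaleC_left cinner_proj_compl[OF assms])
  then have "(norm (?P + proj_compl I e x))\<^sup>2 = (norm ?P)\<^sup>2 + (norm (proj_compl I e x))\<^sup>2"
    by (rule norm_sq_add_orthogonal)
  then show ?thesis
    using norm_sq_orthonormal_sum[OF assms, of "\<lambda>i. cinner (e i) x"] by (simp add: proj_compl_def)
qed

lemma bessel:
  assumes "orthonormal_on I e" "finite I"
  shows "(\<Sum>i\<in>I. (cmod (cinner (e i) x))\<^sup>2) \<le> (norm x)\<^sup>2"
  using bessel_identity[OF assms, of x] by simp

lemma cmod_cinner_commute: "cmod (cinner x y) = cmod (cinner y (x::'a::complex_inner))"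
  by (metis cinner_commute complex_mod_cnj)

text \<open>Bessel's inequality for the one-element family consisting of \<open>x\<close>
  normalized.\<close>

lemma cauchy_schwarz: "cmod (cinner x y) \<le> norm x * norm (y::'a::complex_inner)"
proof (cases "x = 0")
  case False
  define u where "u = complex_of_real (1 / norm x) *\<^sub>C x"
  have "norm u = 1"
    using False by (simp add: u_def norm_scaleC norm_divide)
  then have "orthonormal_on {()} (\<lambda>_. u)"
    by (simp add: orthonormal_on_def cinner_self)
  from bessel[OF this, of y] have "cmod (cinner u y) \<le> norm y"
    by (simp add: power_mono_iff)
  moreover have "cinner u y = cinner x y / norm x"
    by (simp add: u_def cinner_scaleC_left)
  ultimately show ?thesis
    using False by (simp add: norm_divide field_simps)
qed simp

lemma cinner_tendsto_right:
  assumes "(f \<longlongrightarrow> l) F"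
  shows "((\<lambda>n. cinner x (f n)) \<longlongrightarrow> cinner x (l::'a::complex_inner)) F"
proof -
  have "((\<lambda>n. norm x * norm (f n - l)) \<longlongrightarrow> norm x * 0) F"
    using assms by (intro tendsto_mult tendsto_const) (simp add: LIM_zero_iff tendsto_norm_zero_iff)
  moreover have "\<forall>\<^sub>F n in F. norm (cinner x (f n) - cinner x l) \<le> norm x * norm (f n - l)"
    unfolding cinner_diff_right[symmetric] by (simp add: cauchy_schwarz)
  ultimately have "((\<lambda>n. cinner x (f n) - cinner x l) \<longlongrightarrow> 0) F"
    using Lim_null_comparison[where g="\<lambda>n. norm x * norm (f n - l)"] by simp
  then show ?thesis by (simp add: LIM_zero_iff)
qed

text \<open>Double counting in the matrix of squared coefficients: its sums over \<open>B\<close>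
  are at least \<open>1 - \<tau>\<close> by hypothesis, its sums over \<open>A\<close> at most 1 by
  Bessel. This replaces the comparison of dimensions of two nearby subspaces.\<close>

lemma orthonormal_count:
  assumes x: "orthonormal_on A x" "finite A" and f: "orthonormal_on B f" "finite B"
    and large: "\<And>l. l \<in> A \<Longrightarrow> 1 - \<tau> \<le> (\<Sum>i\<in>B. (cmod (cinner (f i) (x l)))\<^sup>2)"
  shows "real (card A) * (1 - \<tau>) \<le> real (card B)"
proof -
  have "real (card A) * (1 - \<tau>) \<le> (\<Sum>l\<in>A. \<Sum>i\<in>B. (cmod (cinner (f i) (x l)))\<^sup>2)"
    using sum_mono[of A "\<lambda>_. 1 - \<tau>"] large by simp
  also have "\<dots> = (\<Sum>i\<in>B. \<Sum>l\<in>A. (cmod (cinner (x l) (f i)))\<^sup>2)"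
    by (subst sum.swap) (simp add: cmod_cinner_commute)
  also have "\<dots> \<le> (\<Sum>i\<in>B. 1)"
  proof (rule sum_mono)
    fix i assume "i \<in> B"
    then show "(\<Sum>l\<in>A. (cmod (cinner (x l) (f i)))\<^sup>2) \<le> 1"
      using bessel[OF x, of "f i"] orthonormal_on_norm[OF f(1)] by simp
  qed
  finally show ?thesis by simp
qed

lemma orthonormal_on_lessThan_Suc:
  assumes "orthonormal_on {..<n} e" "norm x = 1" "\<And>i. i < n \<Longrightarrow> cinner (e i) x = 0"
  shows "orthonormal_on {..<Suc n} (e(n := x))"
proof -
  have "cinner x (e i) = 0" if "i < n" for i
    using assms(3)[OF that] by (metis cinner_commute complex_cnj_zero)
  moreover have "cinner x x = 1" using assms(2) by (simp add: cinner_self)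
  ultimately show ?thesis
    using assms(1,3) by (auto simp: orthonormal_on_def less_Suc_eq)
qed

section \<open>Trace norm and compactness\<close>

lemma clinearD:
  assumes "clinear A"
  shows "A (x + y) = A x + A y" "A (c *\<^sub>C x) = c *\<^sub>C A x" "A (x - y) = A x - A y" "A 0 = 0"
proof -
  show a: "A (x + y) = A x + A y" "A (c *\<^sub>C x) = c *\<^sub>C A x" for x y c
    using assms unfolding clinear_def by auto
  show "A (x - y) = A x - A y"
    using a(1)[of "x - y" y] by (simp add: algebra_simps)
  show "A 0 = 0" using a(2)[of 0 0] by simp
qed

lemma clinear_sum: "clinear A \<Longrightarrow> A (\<Sum>i\<in>I. f i) = (\<Sum>i\<in>I. A (f i))"
  by (induction I rule: infinite_finite_induct) (auto simp: clinearD)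

lemma orthonormal_fam_normalize:
  assumes "x \<noteq> 0" shows "orthonormal_fam 1 (\<lambda>_. complex_of_real (1 / norm x) *\<^sub>C x)"
  using assms by (simp add: orthonormal_fam_def cinner_self norm_scaleC norm_divide)

lemma sum_le_trace_norm:
  "orthonormal_fam n e \<Longrightarrow> orthonormal_fam n f \<Longrightarrow>
    ennreal (\<Sum>i<n. cmod (cinner (A (e i)) (f i))) \<le> trace_norm A"
  unfolding trace_norm_def by (rule Sup_upper) blast

lemma trace_norm_least:
  assumes "\<And>n e f. orthonormal_fam n e \<Longrightarrow> orthonormal_fam n f \<Longrightarrow>
    ennreal (\<Sum>i<n. cmod (cinner (A (e i)) (f i))) \<le> K"
  shows "trace_norm A \<le> K"
  unfolding trace_norm_def by (rule Sup_least) (use assms in blast)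

lemma sum_on_le_trace_norm:
  assumes "finite I" "orthonormal_on I e" "orthonormal_on I f"
  shows "ennreal (\<Sum>i\<in>I. cmod (cinner (A (e i)) (f i))) \<le> trace_norm A"
proof -
  obtain g where g: "bij_betw g {..<card I} I"
    using assms(1) ex_bij_betw_nat_finite by (metis atLeast0LessThan)
  then have "orthonormal_fam (card I) (\<lambda>i. e (g i))" "orthonormal_fam (card I) (\<lambda>i. f (g i))"
    using orthonormal_on_reindex[OF assms(2), of g] orthonormal_on_reindex[OF assms(3), of g]
    by (simp_all add: orthonormal_fam_iff bij_betw_def)
  from sum_le_trace_norm[OF this, of A] show ?thesis
    by (simp add: sum.reindex_bij_betw[OF g, of "\<lambda>i. cmod (cinner (A (e i)) (f i))"])
qed

lemma sum_on_le_trace_norm_real: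
  assumes "finite I" "orthonormal_on I e" "orthonormal_on I f" "trace_norm A \<le> ennreal K" "0 \<le> K"
  shows "(\<Sum>i\<in>I. cmod (cinner (A (e i)) (f i))) \<le> K"
  using order_trans[OF sum_on_le_trace_norm[OF assms(1-3)] assms(4)] assms(5) by simp

lemma trace_norm_add: "trace_norm (\<lambda>x. A x + B x) \<le> trace_norm A + trace_norm B"
proof (rule trace_norm_least)
  fix n and e f :: "nat \<Rightarrow> 'a" assume o: "orthonormal_fam n e" "orthonormal_fam n f"
  have "(\<Sum>i<n. cmod (cinner (A (e i) + B (e i)) (f i)))
      \<le> (\<Sum>i<n. cmod (cinner (A (e i)) (f i))) + (\<Sum>i<n. cmod (cinner (B (e i)) (f i)))"
    unfolding sum.distrib[symmetric] cinner_add_left by (intro sum_mono norm_triangle_ineq)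
  then have "ennreal (\<Sum>i<n. cmod (cinner (A (e i) + B (e i)) (f i)))
      \<le> ennreal (\<Sum>i<n. cmod (cinner (A (e i)) (f i))) + ennreal (\<Sum>i<n. cmod (cinner (B (e i)) (f i)))"
    by (subst ennreal_plus[symmetric]) (auto intro!: sum_nonneg ennreal_leI)
  also have "\<dots> \<le> trace_norm A + trace_norm B"
    by (intro add_mono sum_le_trace_norm o)
  finally show "ennreal (\<Sum>i<n. cmod (cinner (A (e i) + B (e i)) (f i))) \<le> trace_norm A + trace_norm B" .
qed

lemma trace_norm_scaleR: "trace_norm (\<lambda>x. r *\<^sub>R A x) \<le> ennreal \<bar>r\<bar> * trace_norm A"
proof (rule trace_norm_least)
  fix n and e f :: "nat \<Rightarrow> 'a" assume o: "orthonormal_fam n e" "orthonormal_fam n f"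
  have "ennreal (\<Sum>i<n. cmod (cinner (r *\<^sub>R A (e i)) (f i)))
      = ennreal \<bar>r\<bar> * ennreal (\<Sum>i<n. cmod (cinner (A (e i)) (f i)))"
    by (subst ennreal_mult[symmetric])
      (auto intro!: sum_nonneg simp: cinner_scaleR_left norm_mult sum_distrib_left)
  also have "\<dots> \<le> ennreal \<bar>r\<bar> * trace_norm A"
    by (intro mult_left_mono sum_le_trace_norm o) simp
  finally show "ennreal (\<Sum>i<n. cmod (cinner (r *\<^sub>R A (e i)) (f i))) \<le> ennreal \<bar>r\<bar> * trace_norm A" .
qed

text \<open>Testing the supremum on the one-element families \<open>x\<close> and
  \<open>A x\<close>, both normalized, shows that the trace norm dominates the operator
  norm.\<close>

lemma norm_le_trace_norm:
  assumes "clinear A" "trace_norm A \<le> ennreal \<delta>" "0 \<le> \<delta>"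
  shows "norm (A x) \<le> \<delta> * norm x"
proof (cases "x = 0 \<or> A x = 0")
  case True
  then show ?thesis using assms by (auto simp: clinearD)
next
  case False
  let ?e = "\<lambda>_::nat. complex_of_real (1 / norm x) *\<^sub>C x"
  let ?f = "\<lambda>_::nat. complex_of_real (1 / norm (A x)) *\<^sub>C A x"
  have "ennreal (\<Sum>i<1. cmod (cinner (A (?e i)) (?f i))) \<le> trace_norm A"
    using False by (intro sum_le_trace_norm orthonormal_fam_normalize) auto
  also have "(\<Sum>i<1. cmod (cinner (A (?e i)) (?f i))) = norm (A x) / norm x"
    using False by (simp add: clinearD[OF assms(1)] cinner_scaleC_left cinner_scaleC_right
        cinner_self norm_mult norm_divide power2_eq_square)
  finally have "ennreal (norm (A x) / norm x) \<le> ennreal \<delta>"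
    using assms(2) by simp
  then have "norm (A x) / norm x \<le> \<delta>" using assms(3) by simp
  then show ?thesis using False by (simp add: field_simps)
qed

text \<open>Take families whose sum comes within \<open>\<eta>\<close> of the supremum. A further
  pair of unit vectors orthogonal to them can be appended, and its contribution must fit into the
  remaining \<open>\<eta>\<close>.\<close>

lemma trace_class_off_diagonal:
  assumes A: "trace_class A" and "0 < \<eta>"
  obtains n and e f :: "nat \<Rightarrow> 'a::chilbert_space"
    where "orthonormal_fam n e" "orthonormal_fam n f"
      "\<And>x y. (\<And>i. i < n \<Longrightarrow> cinner (e i) x = 0) \<Longrightarrow> (\<And>i. i < n \<Longrightarrow> cinner (f i) y = 0) \<Longrightarrow>
        cmod (cinner (A x) y) \<le> \<eta> * norm x * norm y"
proof -
  have lin: "clinear A" using A by (simp add: trace_class_def)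
  obtain t where t: "trace_norm A = ennreal t" "0 \<le> t"
    using A unfolding trace_class_def by (cases "trace_norm A") auto
  have "\<exists>n e f. orthonormal_fam n e \<and> orthonormal_fam n f \<and> t - \<eta> < (\<Sum>i<n. cmod (cinner (A (e i)) (f i)))"
  proof (rule ccontr)
    assume "\<not> ?thesis"
    then have *: "(\<Sum>i<n. cmod (cinner (A (e i)) (f i))) \<le> t - \<eta>"
      if "orthonormal_fam n e" "orthonormal_fam n f" for n e f
      using that by (meson linorder_not_less)
    \<comment> \<open>The empty family: without this sign, \<open>ennreal (t - \<eta>)\<close> below
      could be the truncated value 0.\<close>
    from *[of 0] have "0 \<le> t - \<eta>" by (simp add: orthonormal_fam_def)
    moreover have "trace_norm A \<le> ennreal (t - \<eta>)"
      by (rule trace_norm_least) (intro ennreal_leI *)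
    ultimately show False using t \<open>0 < \<eta>\<close> by simp
  qed
  then obtain n e f where o: "orthonormal_fam n e" "orthonormal_fam n f"
    and big: "t - \<eta> < (\<Sum>i<n. cmod (cinner (A (e i)) (f i)))" by blast
  have "cmod (cinner (A x) y) \<le> \<eta> * norm x * norm y"
    if x: "\<And>i. i < n \<Longrightarrow> cinner (e i) x = 0" and y: "\<And>i. i < n \<Longrightarrow> cinner (f i) y = 0" for x y
  proof (cases "x = 0 \<or> y = 0")
    case True then show ?thesis using clinearD(4)[OF lin] by auto
  next
    case False
    define u where "u = complex_of_real (1 / norm x) *\<^sub>C x"
    define v where "v = complex_of_real (1 / norm y) *\<^sub>C y"
    have "norm u = 1" "norm v = 1" using False by (auto simp: u_def v_def norm_scaleC norm_divide)
    then have "orthonormal_fam (Suc n) (e(n := u))" "orthonormal_fam (Suc n) (f(n := v))"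
      using o x y unfolding orthonormal_fam_iff
      by (auto simp: u_def v_def cinner_scaleC_right intro!: orthonormal_on_lessThan_Suc)
    from sum_le_trace_norm[OF this, of A]
    have "(\<Sum>i<n. cmod (cinner (A (e i)) (f i))) + cmod (cinner (A u) v) \<le> t"
      using t by simp
    with big have "cmod (cinner (A u) v) \<le> \<eta>" by simp
    moreover have "cinner (A u) v = cinner (A x) y / of_real (norm x * norm y)"
      using clinearD(2)[OF lin] by (simp add: u_def v_def cinner_scaleC_left cinner_scaleC_right)
    ultimately show ?thesis using False by (simp add: norm_divide norm_mult field_simps)
  qed
  with o that show ?thesis by blast
qed

lemma norm_proj_compl_le:
  assumes "orthonormal_on I e" "finite I"
  shows "norm (proj_compl I e x) \<le> norm x"
proof (rule power2_le_imp_le)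
  have "0 \<le> (\<Sum>i\<in>I. (cmod (cinner (e i) x))\<^sup>2)" by (simp add: sum_nonneg)
  then show "(norm (proj_compl I e x))\<^sup>2 \<le> (norm x)\<^sup>2"
    using bessel_identity[OF assms, of x] by linarith
qed simp

lemma proj_compl_diff: "proj_compl I e (x - y) = proj_compl I e x - proj_compl I e y"
  by (simp add: proj_compl_def cinner_diff_right scaleC_diff_left sum_subtractf)

text \<open>Compactness in scalar form: apart from finitely many bounded functionals of
  \<open>x\<close>, the operator has norm at most \<open>\<eta>\<close>. The part of
  \<open>x\<close> in the span of \<open>e\<close> and the part of the image in the span of
  \<open>f\<close> are measured by \<open>g\<close>; the remaining corner is controlled by
  \<open>trace_class_off_diagonal\<close>.\<close>

lemma trace_class_finite_approx:
  fixes A :: "'a::chilbert_space \<Rightarrow> 'a"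
  assumes A: "trace_class A" and "0 < \<eta>"
  obtains I :: "(nat + nat) set" and g :: "nat + nat \<Rightarrow> 'a \<Rightarrow> complex" and B
    where "finite I" "\<And>i x y. g i (x - y) = g i x - g i y"
      "\<And>i x. i \<in> I \<Longrightarrow> cmod (g i x) \<le> B i * norm x"
      "\<And>x. norm (A x) \<le> (\<Sum>i\<in>I. cmod (g i x)) + \<eta> * norm x"
proof -
  obtain n and e f :: "nat \<Rightarrow> 'a" where o: "orthonormal_on {..<n} e" "orthonormal_on {..<n} f"
    and off: "\<And>x y. (\<And>i. i < n \<Longrightarrow> cinner (e i) x = 0) \<Longrightarrow> (\<And>i. i < n \<Longrightarrow> cinner (f i) y = 0) \<Longrightarrow>
        cmod (cinner (A x) y) \<le> \<eta> * norm x * norm y"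
    using trace_class_off_diagonal[OF assms] unfolding orthonormal_fam_iff by metis
  have lin: "clinear A" using A by (simp add: trace_class_def)
  obtain t where t: "trace_norm A = ennreal t" "0 \<le> t"
    using A unfolding trace_class_def by (cases "trace_norm A") auto
  have bd: "norm (A x) \<le> t * norm x" for x
    using norm_le_trace_norm[OF lin] t by simp
  let ?P = "proj_compl {..<n} e"
  have P: "norm (?P x) \<le> norm x" for x by (rule norm_proj_compl_le) (use o in auto)
  define g where "g = (\<lambda>i x. case i of Inl i \<Rightarrow> of_real (norm (A (e i))) * cinner (e i) x
                              | Inr i \<Rightarrow> cinner (f i) (A (?P x)))"
  define B where "B = (\<lambda>i. case i of Inl i \<Rightarrow> norm (A (e i)) * norm (e i) | Inr i \<Rightarrow> norm (f i) * t)"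
  show ?thesis
  proof (rule that)
    show "finite ({..<n} <+> {..<n})" by simp
    show "g i (x - y) = g i x - g i y" for i x y
      by (cases i) (auto simp: g_def cinner_diff_right right_diff_distrib proj_compl_diff clinearD[OF lin])
    show "cmod (g i x) \<le> B i * norm x" for i x
    proof (cases i)
      case (Inl i)
      then show ?thesis
        using mult_left_mono[OF cauchy_schwarz[of "e i" x], of "norm (A (e i))"]
        by (simp add: g_def B_def norm_mult mult.assoc)
    next
      case (Inr j)
      have "norm (A (?P x)) \<le> t * norm x"
        using bd[of "?P x"] mult_left_mono[OF P[of x] t(2)] by simp
      from mult_left_mono[OF this norm_ge_zero[of "f j"]] show ?thesis
        using Inr cauchy_schwarz[of "f j" "A (?P x)"] by (simp add: g_def B_def mult.assoc)
    qed
    show "norm (A x) \<le> (\<Sum>i\<in>{..<n} <+> {..<n}. cmod (g i x)) + \<eta> * norm x" for x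
    proof -
      let ?y = "proj_compl {..<n} f (A (?P x))"
      have fy: "cinner (f i) ?y = 0" if "i < n" for i
        by (rule cinner_proj_compl) (use o that in auto)
      have ex: "cinner (e i) (?P x) = 0" if "i < n" for i
        by (rule cinner_proj_compl) (use o that in auto)
      have Ay: "A (?P x) = (\<Sum>i<n. cinner (f i) (A (?P x)) *\<^sub>C f i) + ?y"
        by (simp add: proj_compl_def)
      \<comment> \<open>As \<open>?y\<close> is the component of \<open>A (?P x)\<close> orthogonal
        to \<open>f\<close>, pairing the two gives the square of \<open>norm ?y\<close>, and one
        factor can be cancelled from the off-diagonal bound.\<close>
      have "cinner (A (?P x)) ?y = cinner ?y ?y"
        by (subst Ay) (simp add: cinner_add_left cinner_sum_left cinner_scaleC_left fy)
      then have "(norm ?y)\<^sup>2 = cmod (cinner (A (?P x)) ?y)"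
        by (simp add: cinner_self norm_power)
      also have "\<dots> \<le> \<eta> * norm (?P x) * norm ?y"
        by (rule off) (use ex fy in auto)
      also have "\<dots> \<le> \<eta> * norm x * norm ?y"
        using P[of x] \<open>0 < \<eta>\<close> by (simp add: mult_right_mono)
      finally have y: "norm ?y \<le> \<eta> * norm x"
        using \<open>0 < \<eta>\<close> by (cases "?y = 0") (simp_all add: power2_eq_square)
      have "x = (\<Sum>i<n. cinner (e i) x *\<^sub>C e i) + ?P x"
        by (simp add: proj_compl_def)
      then have "A x = (\<Sum>i<n. cinner (e i) x *\<^sub>C A (e i)) + A (?P x)"
        by (metis (no_types, lifting) clinear_sum[OF lin] clinearD(1,2)[OF lin] sum.cong)
      then have Ax: "A x = (\<Sum>i<n. cinner (e i) x *\<^sub>C A (e i))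
          + ((\<Sum>i<n. cinner (f i) (A (?P x)) *\<^sub>C f i) + ?y)"
        using Ay by simp
      have "norm (A x) \<le> (\<Sum>i<n. norm (cinner (e i) x *\<^sub>C A (e i)))
          + ((\<Sum>i<n. norm (cinner (f i) (A (?P x)) *\<^sub>C f i)) + norm ?y)"
        unfolding Ax by (rule order_trans[OF norm_triangle_ineq add_mono[OF norm_sum
              order_trans[OF norm_triangle_ineq add_mono[OF norm_sum order_refl]]]])
      also have "\<dots> = (\<Sum>i<n. cmod (g (Inl i) x)) + ((\<Sum>i<n. cmod (g (Inr i) x)) + norm ?y)"
        using orthonormal_on_norm[OF o(2)] by (simp add: g_def norm_scaleC norm_mult mult.commute)
      finally show ?thesis using y by (simp add: sum.Plus)
    qed
  qed
qed

lemma finite_convergent_subsequence: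
  fixes g :: "'i \<Rightarrow> nat \<Rightarrow> complex"
  assumes "finite I" "\<And>i n. i \<in> I \<Longrightarrow> cmod (g i n) \<le> B i"
  shows "\<exists>r. strict_mono (r :: nat \<Rightarrow> nat) \<and> (\<forall>i\<in>I. \<exists>l. (\<lambda>n. g i (r n)) \<longlonglongrightarrow> l)"
  using assms
proof (induction I rule: finite_induct)
  case empty
  then show ?case using strict_mono_id by auto
next
  case (insert j I)
  then obtain r where r: "strict_mono (r :: nat \<Rightarrow> nat)" "\<forall>i\<in>I. \<exists>l. (\<lambda>n. g i (r n)) \<longlonglongrightarrow> l"
    by (metis insertCI)
  have "bounded (range (\<lambda>n. g j (r n)))"
    using insert.prems by (auto simp: bounded_iff)
  then obtain l s where s: "strict_mono (s :: nat \<Rightarrow> nat)" "((\<lambda>n. g j (r n)) \<circ> s) \<longlonglongrightarrow> l"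
    using bounded_imp_convergent_subsequence by blast
  have "\<exists>l. (\<lambda>n. g i ((r \<circ> s) n)) \<longlonglongrightarrow> l" if "i \<in> insert j I" for i
  proof (cases "i = j")
    case True then show ?thesis using s by (auto simp: o_def)
  next
    case False
    then have "i \<in> I" using that by simp
    then obtain l where "(\<lambda>n. g i (r n)) \<longlonglongrightarrow> l" using r(2) by metis
    from LIMSEQ_subseq_LIMSEQ[OF this s(1)] show ?thesis by (auto simp: o_def)
  qed
  moreover have "strict_mono (r \<circ> s)" using r s by (simp add: strict_mono_o)
  ultimately show ?case by blast
qed

text \<open>Diagonal argument: at level \<open>k\<close> the finitely many functionals of an
  approximation converge along a subsequence, which makes the images oscillate by at most
  \<open>1 / (k + 1)\<close> from some index on.\<close>

lemma trace_class_compact: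
  fixes A :: "'a::chilbert_space \<Rightarrow> 'a"
  assumes A: "trace_class A" and x: "\<And>n. norm (x n) \<le> 1"
  obtains r l where "strict_mono (r :: nat \<Rightarrow> nat)" "(\<lambda>n. A (x (r n))) \<longlonglongrightarrow> l"
proof -
  have lin: "clinear A" using A by (simp add: trace_class_def)
  define P where "P = (\<lambda>k (s::nat \<Rightarrow> nat). \<exists>N. \<forall>i\<ge>N. \<forall>j\<ge>N. norm (A (x (s i)) - A (x (s j))) \<le> 1 / real (Suc k))"
  interpret subseqs P
  proof
    fix k and s :: "nat \<Rightarrow> nat" assume "strict_mono s"
    \<comment> \<open>Four shares: one each for \<open>h i\<close> and \<open>h j\<close>, and two
      because the difference \<open>?d\<close> has norm at most 2.\<close>
    define \<eta> where "\<eta> = 1 / (4 * real (Suc k))"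
    have "0 < \<eta>" by (simp add: \<eta>_def)
    obtain I :: "(nat + nat) set" and g B where "finite I" and g: "\<And>i x y. g i (x - y) = g i x - g i y"
      and B: "\<And>i x. i \<in> I \<Longrightarrow> cmod (g i x) \<le> B i * norm x"
      and bd: "\<And>x. norm (A x) \<le> (\<Sum>i\<in>I. cmod (g i x)) + \<eta> * norm x"
      using trace_class_finite_approx[OF A \<open>0 < \<eta>\<close>] by blast
    have g_bd: "cmod (g i (x (s n))) \<le> \<bar>B i\<bar>" if "i \<in> I" for i n
    proof -
      have "B i * norm (x (s n)) \<le> \<bar>B i\<bar> * 1"
        using x[of "s n"] by (intro mult_mono) auto
      then show ?thesis using B[OF that, of "x (s n)"] by simp
    qed
    obtain r where r: "strict_mono (r :: nat \<Rightarrow> nat)" "\<forall>i\<in>I. \<exists>l. (\<lambda>n. g i (x (s (r n)))) \<longlonglongrightarrow> l"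
      using finite_convergent_subsequence[of I "\<lambda>i n. g i (x (s n))" "\<lambda>i. \<bar>B i\<bar>", OF \<open>finite I\<close> g_bd]
      by blast
    then obtain l where l: "\<And>i. i \<in> I \<Longrightarrow> (\<lambda>n. g i (x (s (r n)))) \<longlonglongrightarrow> l i" by metis
    define h where "h = (\<lambda>n. \<Sum>i\<in>I. cmod (g i (x (s (r n))) - l i))"
    have "h \<longlonglongrightarrow> 0"
      unfolding h_def by (intro tendsto_null_sum tendsto_norm_zero) (use l in \<open>simp add: LIM_zero_iff\<close>)
    then obtain N where N: "\<And>n. n \<ge> N \<Longrightarrow> \<bar>h n\<bar> < \<eta>"
      using \<open>0 < \<eta>\<close> unfolding lim_sequentially by (auto simp: dist_real_def)
    have "norm (A (x (s (r i))) - A (x (s (r j)))) \<le> 1 / real (Suc k)" if "i \<ge> N" "j \<ge> N" for i j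
    proof -
      let ?d = "x (s (r i)) - x (s (r j))"
      have "(\<Sum>i\<in>I. cmod (g i ?d)) \<le> h i + h j"
        unfolding h_def sum.distrib[symmetric] g
        by (intro sum_mono) (metis norm_triangle_ineq4 diff_diff_eq2 diff_add_cancel add.commute add_diff_eq)
      moreover have "norm ?d \<le> 2"
        using norm_triangle_ineq4[of "x (s (r i))" "x (s (r j))"] x[of "s (r i)"] x[of "s (r j)"] by linarith
      then have "\<eta> * norm ?d \<le> \<eta> * 2" using \<open>0 < \<eta>\<close> by simp
      ultimately have "norm (A ?d) \<le> 4 * \<eta>"
        using bd[of ?d] N[OF that(1)] N[OF that(2)] by linarith
      moreover have "4 * \<eta> = 1 / real (Suc k)" by (simp add: \<eta>_def field_simps)
      ultimately show ?thesis by (simp only: clinearD(3)[OF lin])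
    qed
    then show "\<exists>r'. strict_mono r' \<and> P k (s \<circ> r')"
      unfolding P_def using r(1) by (intro exI[of _ r]) auto
  qed
  have "P k (diagseq \<circ> (+) (Suc k))" for k
  proof (rule diagseq_holds)
    fix r s :: "nat \<Rightarrow> nat" and k assume "strict_mono r" "P k s"
    then obtain N where "\<forall>i\<ge>N. \<forall>j\<ge>N. norm (A (x (s i)) - A (x (s j))) \<le> 1 / real (Suc k)"
      unfolding P_def by blast
    moreover have "i \<le> r i" for i using \<open>strict_mono r\<close> by (rule strict_mono_imp_increasing)
    ultimately show "P k (s \<circ> r)" unfolding P_def o_def by (meson order_trans)
  qed
  \<comment> \<open>\<open>P k\<close> is available for the diagonal sequence after its first
    \<open>Suc k\<close> terms are dropped; enlarging \<open>N\<close> undoes the shift.\<close>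
  then have *: "\<exists>N. \<forall>i\<ge>N. \<forall>j\<ge>N. norm (A (x (diagseq i)) - A (x (diagseq j))) \<le> 1 / real (Suc k)" for k
  proof -
    obtain N where N: "\<forall>i\<ge>N. \<forall>j\<ge>N. norm (A (x (diagseq (Suc k + i))) - A (x (diagseq (Suc k + j)))) \<le> 1 / real (Suc k)"
      using \<open>P k (diagseq \<circ> (+) (Suc k))\<close> unfolding P_def o_def by blast
    have "norm (A (x (diagseq i)) - A (x (diagseq j))) \<le> 1 / real (Suc k)"
      if "i \<ge> N + Suc k" "j \<ge> N + Suc k" for i j
      using N[rule_format, of "i - Suc k" "j - Suc k"] that by simp
    then show ?thesis by blast
  qed
  have "Cauchy (\<lambda>n. A (x (diagseq n)))"
  proof (rule CauchyI)
    fix e :: real assume "0 < e"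
    then obtain k where "1 / real (Suc k) < e" using nat_approx_posE by blast
    then show "\<exists>M. \<forall>m\<ge>M. \<forall>n\<ge>M. norm (A (x (diagseq m)) - A (x (diagseq n))) < e"
      using *[of k] by (meson order_le_less_trans)
  qed
  then obtain l where "(\<lambda>n. A (x (diagseq n))) \<longlonglongrightarrow> l"
    using Cauchy_convergent convergent_def by blast
  then show ?thesis using that subseq_diagseq by blast
qed

section \<open>Eigenvectors of unitary operators\<close>

lemma
  assumes "unitary_op U"
  shows unitary_clinear: "clinear U"
    and unitary_cinner: "cinner (U x) (U y) = cinner x y"
    and unitary_norm: "norm (U x) = norm x"
    and unitary_inv: "U (inv U x) = x"
    and unitary_adjoint: "cinner x (inv U y) = cinner (U x) y"
    and unitary_inv_norm_diff: "norm (inv U x - inv U y) = norm (x - y)"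
proof -
  show lin: "clinear U" and inner: "cinner (U x) (U y) = cinner x y" for x y
    using assms by (auto simp: unitary_op_def)
  show nrm: "norm (U x) = norm x" for x by (simp add: norm_cinner inner)
  show inv: "U (inv U x) = x" for x
    using assms by (simp add: unitary_op_def surj_f_inv_f)
  show "cinner x (inv U y) = cinner (U x) y"
    using inner[of x "inv U y"] by (simp add: inv)
  show "norm (inv U x - inv U y) = norm (x - y)"
    using nrm[of "inv U x - inv U y"] by (simp add: clinearD(3)[OF lin] inv)
qed

lemma cmod_eigenvalue:
  assumes "unitary_op U" "U x = w *\<^sub>C x" "x \<noteq> 0" shows "cmod w = 1"
  using unitary_norm[OF assms(1), of x] assms(2,3) by (simp add: norm_scaleC)

lemma cnj_mult_eigenvalue:
  assumes "unitary_op U" "U x = w *\<^sub>C x" "x \<noteq> 0" shows "cnj w * w = 1"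
  using cmod_eigenvalue[OF assms] by (metis complex_norm_square mult.commute of_real_1 one_power2)

text \<open>Because \<open>w\<close> has modulus 1, an eigenvector of \<open>U\<close> is also one
  of the adjoint, with eigenvalue \<open>cnj w\<close>. Consequently the orthogonal complement of a
  set of eigenvectors is invariant under \<open>U\<close>.\<close>

lemma cinner_eigenvector:
  assumes U: "unitary_op U" and x: "U x = w *\<^sub>C x"
  shows "cinner x (U y) = w * cinner x y"
proof (cases "x = 0")
  case False
  then have w: "w * cnj w = 1" using cnj_mult_eigenvalue[OF assms] by (simp add: mult.commute)
  have "w * cinner x y = w * cinner (U x) (U y)" by (simp add: unitary_cinner[OF U])
  also have "\<dots> = (w * cnj w) * cinner x (U y)" unfolding x by (simp add: cinner_scaleC_left)
  finally show ?thesis using w by simp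
qed simp

lemma orthogonal_eigenvectors:
  assumes U: "unitary_op U" and x: "U x = w *\<^sub>C x" and y: "U y = v *\<^sub>C y" and "w \<noteq> v"
  shows "cinner x y = 0"
  using cinner_eigenvector[OF U x, of y] \<open>w \<noteq> v\<close> unfolding y by (simp add: cinner_scaleC_right)

text \<open>Let \<open>m\<close> be the norm of \<open>A = U - 1\<close> on the invariant complement
  \<open>W\<close>. By compactness a maximizing sequence converges to a unit vector \<open>v\<close>
  with \<open>A* A v = m^2 v\<close>. For unitary \<open>U\<close> this is a quadratic equation in
  \<open>U\<close> applied to \<open>v\<close>; splitting it into linear factors produces an
  eigenvector in \<open>W\<close> whose eigenvalue has distance \<open>m > c\<close> from 1.\<close>

lemma unitary_eigenvector_orthogonal:
  fixes U :: "'a::chilbert_space \<Rightarrow> 'a"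
  assumes U: "U \<in> unitary1"
    and e: "\<And>i. i \<in> I \<Longrightarrow> U (e i) = z i *\<^sub>C e i"
    and x0: "\<And>i. i \<in> I \<Longrightarrow> cinner (e i) x0 = 0" and big: "c * norm x0 < norm (U x0 - x0)" and "0 \<le> c"
  obtains y w where "\<And>i. i \<in> I \<Longrightarrow> cinner (e i) y = 0" "norm y = 1" "U y = w *\<^sub>C y" "c < cmod (w - 1)"
proof -
  have un: "unitary_op U" and tc: "trace_class (\<lambda>x. U x - x)" using U by (auto simp: unitary1_def)
  note lin = clinearD[OF unitary_clinear[OF un]] and U_norm = unitary_norm[OF un]
  define A where "A = (\<lambda>x. U x - x)"
  \<comment> \<open>This is the adjoint of \<open>A\<close>, since the inverse of a unitary operator
    is its adjoint.\<close>
  define B where "B = (\<lambda>x. inv U x - x)"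
  define W where "W = {x. \<forall>i\<in>I. cinner (e i) x = 0}"
  have W_U: "U x \<in> W" if "x \<in> W" for x
    using that cinner_eigenvector[OF un e] by (auto simp: W_def)
  have W_A: "A x \<in> W" if "x \<in> W" for x
    using that W_U[OF that] by (auto simp: W_def A_def cinner_diff_right)
  have A_le: "norm (A x) \<le> 2 * norm x" for x
    using norm_triangle_ineq4[of "U x" x] by (simp add: A_def U_norm)
  have A_diff: "A (x - y) = A x - A y" and A_scale: "A (a *\<^sub>C x) = a *\<^sub>C A x" for x y a
    by (simp_all add: A_def lin scaleC_diff_right)
  have B_norm: "norm (B x) = norm (A x)" for x
  proof -
    have "U (B x) = - A x" by (simp add: B_def A_def lin unitary_inv[OF un])
    then show ?thesis using U_norm[of "B x"] by simp
  qed
  have BA: "cinner x (B (A x)) = of_real ((norm (A x))\<^sup>2)" for x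
    unfolding cinner_self[symmetric] B_def
    by (simp add: A_def cinner_diff_right unitary_adjoint[OF un] cinner_diff_left)
  define S where "S = {norm (A x) | x. x \<in> W \<and> norm x = 1}"
  define m where "m = Sup S"
  have S_le: "s \<le> 2" if s: "s \<in> S" for s
  proof -
    obtain x where "s = norm (A x)" "norm x = 1" using s unfolding S_def by blast
    then show ?thesis using A_le[of x] by simp
  qed
  then have bdd: "bdd_above S" by (rule bdd_aboveI)
  have "x0 \<noteq> 0" using big lin(4) by auto
  have x0S: "norm (A x0) / norm x0 \<in> S"
  proof -
    have "complex_of_real (1 / norm x0) *\<^sub>C x0 \<in> W" "norm (complex_of_real (1 / norm x0) *\<^sub>C x0) = 1"
      using x0 \<open>x0 \<noteq> 0\<close> by (auto simp: W_def cinner_scaleC_right norm_scaleC norm_divide)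
    moreover have "norm (A (complex_of_real (1 / norm x0) *\<^sub>C x0)) = norm (A x0) / norm x0"
      by (simp add: A_scale norm_scaleC norm_divide)
    ultimately show ?thesis unfolding S_def by (metis (mono_tags, lifting) mem_Collect_eq)
  qed
  then have "norm (A x0) / norm x0 \<le> m" unfolding m_def using bdd by (rule cSup_upper)
  moreover have "c < norm (A x0) / norm x0"
    using big \<open>x0 \<noteq> 0\<close> by (simp add: A_def pos_less_divide_eq)
  ultimately have "c < m" by simp
  then have "0 < m" using \<open>0 \<le> c\<close> by simp
  have m_le: "m \<le> 2" unfolding m_def
    by (rule cSup_least) (use x0S S_le in auto)
  have A_le_m: "norm (A x) \<le> m * norm x" if "x \<in> W" for x
  proof (cases "x = 0")
    case True then show ?thesis by (simp add: A_def lin)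
  next
    case False
    have "complex_of_real (1 / norm x) *\<^sub>C x \<in> W" "norm (complex_of_real (1 / norm x) *\<^sub>C x) = 1"
      using that False by (auto simp: W_def cinner_scaleC_right norm_scaleC norm_divide)
    then have "norm (A (complex_of_real (1 / norm x) *\<^sub>C x)) \<in> S" unfolding S_def by blast
    then have "norm (A (complex_of_real (1 / norm x) *\<^sub>C x)) \<le> m" unfolding m_def using bdd by (rule cSup_upper)
    then show ?thesis using False by (simp add: A_scale norm_scaleC norm_divide field_simps)
  qed
  have "\<exists>x. x \<in> W \<and> norm x = 1 \<and> m - 1 / real (Suc n) < norm (A x)" for n
  proof -
    have "m - 1 / real (Suc n) < Sup S" unfolding m_def by simp
    then obtain s where "s \<in> S" "m - 1 / real (Suc n) < s"
      using less_cSupE x0S by blast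
    then show ?thesis unfolding S_def by auto
  qed
  then obtain x where xW: "\<And>n. x n \<in> W" and x1: "\<And>n. norm (x n) = 1"
    and xA: "\<And>n. m - 1 / real (Suc n) < norm (A (x n))" by metis
  have Ax_lim: "(\<lambda>n. norm (A (x n))) \<longlonglongrightarrow> m"
  proof (rule tendsto_sandwich)
    show "\<forall>\<^sub>F n in sequentially. m - 1 / real (Suc n) \<le> norm (A (x n))"
      using xA by (simp add: less_imp_le)
    show "\<forall>\<^sub>F n in sequentially. norm (A (x n)) \<le> m"
      using A_le_m[OF xW] x1 by simp
    show "(\<lambda>n. m - 1 / real (Suc n)) \<longlonglongrightarrow> m"
      using tendsto_diff[OF tendsto_const[of m] LIMSEQ_inverse_real_of_nat] by (simp add: inverse_eq_divide)
  qed simp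
  obtain r y where r: "strict_mono (r :: nat \<Rightarrow> nat)" and y: "(\<lambda>n. A (x (r n))) \<longlonglongrightarrow> y"
    using trace_class_compact[OF tc[folded A_def], of x] x1 by auto
  \<comment> \<open>Expand the square. As \<open>A u\<close> stays in \<open>W\<close>, its first
    term is at most \<open>m^2\<close> times the square of \<open>norm (A u)\<close>, while the
    cross term is exactly minus twice that; the right-hand side tends to 0 along a maximizing
    sequence.\<close>
  have "(norm (B (A u) - of_real (m\<^sup>2) *\<^sub>C u))\<^sup>2 \<le> m\<^sup>2 * (m\<^sup>2 - (norm (A u))\<^sup>2)"
    if "u \<in> W" "norm u = 1" for u
  proof -
    have "norm (B (A u)) \<le> m * norm (A u)"
      using A_le_m[OF W_A[OF that(1)]] by (simp add: B_norm)
    from power_mono[OF this norm_ge_zero, of 2]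
    have 1: "(norm (B (A u)))\<^sup>2 \<le> m\<^sup>2 * (norm (A u))\<^sup>2"
      by (simp add: power_mult_distrib)
    have 2: "Re (cinner (B (A u)) (of_real (m\<^sup>2) *\<^sub>C u)) = m\<^sup>2 * (norm (A u))\<^sup>2"
    proof -
      have "cinner (B (A u)) u = of_real ((norm (A u))\<^sup>2)"
        using BA[of u] by (subst cinner_commute) simp
      then show ?thesis unfolding cinner_scaleC_right by (simp flip: of_real_mult of_real_power)
    qed
    have 3: "norm (of_real (m\<^sup>2) *\<^sub>C u) = m\<^sup>2" using that(2) by (simp add: norm_scaleC norm_power)
    have "(norm (B (A u) - of_real (m\<^sup>2) *\<^sub>C u))\<^sup>2
        = (norm (B (A u)))\<^sup>2 + m\<^sup>2 * m\<^sup>2 - 2 * (m\<^sup>2 * (norm (A u))\<^sup>2)"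
      unfolding norm_sq_diff 2 3 by (simp add: power2_eq_square)
    also have "\<dots> \<le> m\<^sup>2 * (m\<^sup>2 - (norm (A u))\<^sup>2)"
      using 1 by (simp add: right_diff_distrib)
    finally show ?thesis .
  qed
  note defect = this
  define d where "d = (\<lambda>n. B (A (x (r n))) - of_real (m\<^sup>2) *\<^sub>C x (r n))"
  have "(\<lambda>n. m\<^sup>2 * (m\<^sup>2 - (norm (A (x (r n))))\<^sup>2)) \<longlonglongrightarrow> m\<^sup>2 * (m\<^sup>2 - m\<^sup>2)"
    using LIMSEQ_subseq_LIMSEQ[OF Ax_lim r] unfolding o_def by (intro tendsto_intros)
  then have "(\<lambda>n. m\<^sup>2 * (m\<^sup>2 - (norm (A (x (r n))))\<^sup>2)) \<longlonglongrightarrow> 0" by simp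
  then have "(\<lambda>n. (norm (d n))\<^sup>2) \<longlonglongrightarrow> 0"
    by (rule tendsto_sandwich[of "\<lambda>_. 0", rotated 3])
      (use defect[OF xW x1] in \<open>simp_all add: d_def\<close>)
  then have "(\<lambda>n. norm (d n)) \<longlonglongrightarrow> 0"
    using tendsto_real_sqrt by force
  then have d0: "d \<longlonglongrightarrow> 0" by (simp add: tendsto_norm_zero_iff)
  have BAx: "(\<lambda>n. B (A (x (r n)))) \<longlonglongrightarrow> B y"
  proof -
    have "(\<lambda>n. inv U (A (x (r n))) - inv U y) \<longlonglongrightarrow> 0"
    proof (rule tendsto_norm_zero_cancel)
      show "(\<lambda>n. norm (inv U (A (x (r n))) - inv U y)) \<longlonglongrightarrow> 0"
        unfolding unitary_inv_norm_diff[OF un]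
        using y by (simp add: LIM_zero_iff tendsto_norm_zero_iff)
    qed
    then show ?thesis unfolding B_def using y by (intro tendsto_diff) (simp_all add: LIM_zero_iff)
  qed
  \<comment> \<open>The limit of the maximizing vectors themselves: \<open>B (A (x (r n)))\<close>
    converges and differs from \<open>m^2 x (r n)\<close> by a null sequence, and \<open>m\<close>
    is positive.\<close>
  define v where "v = (1 / m\<^sup>2) *\<^sub>R B y"
  have "(\<lambda>n. (1 / m\<^sup>2) *\<^sub>R (B (A (x (r n))) - d n)) \<longlonglongrightarrow> (1 / m\<^sup>2) *\<^sub>R (B y - 0)"
    by (intro tendsto_intros BAx d0)
  then have xv: "(\<lambda>n. x (r n)) \<longlonglongrightarrow> v"
    using \<open>0 < m\<close> by (simp add: v_def d_def flip: scaleR_scaleC of_real_power)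
  have v1: "norm v = 1" using tendsto_norm[OF xv] x1 by (simp add: LIMSEQ_const_iff)
  have vW: "v \<in> W"
  proof -
    have "cinner (e i) v = 0" if "i \<in> I" for i
      using cinner_tendsto_right[OF xv, of "e i"] xW that by (simp add: W_def LIMSEQ_const_iff)
    then show ?thesis by (simp add: W_def)
  qed
  have "(\<lambda>n. A (x (r n)) - A v) \<longlonglongrightarrow> 0"
  proof (rule Lim_null_comparison)
    show "\<forall>\<^sub>F n in sequentially. norm (A (x (r n)) - A v) \<le> 2 * norm (x (r n) - v)"
      unfolding A_diff[symmetric] using A_le by (intro always_eventually allI)
    have "(\<lambda>n. norm (x (r n) - v)) \<longlonglongrightarrow> 0"
      using xv by (simp add: LIM_zero_iff tendsto_norm_zero_iff)
    then show "(\<lambda>n. 2 * norm (x (r n) - v)) \<longlonglongrightarrow> 0" by (rule tendsto_mult_right_zero)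
  qed
  then have "(\<lambda>n. A (x (r n))) \<longlonglongrightarrow> A v" by (rule LIM_zero_cancel)
  with y have "y = A v" by (rule LIMSEQ_unique)
  moreover have "B y = m\<^sup>2 *\<^sub>R v" using \<open>0 < m\<close> by (simp add: v_def)
  ultimately have BAv: "B (A v) = m\<^sup>2 *\<^sub>R v" by simp
  have "U (B (A v)) = U v - v - U (U v) + U v"
    by (simp add: B_def A_def lin unitary_inv[OF un])
  moreover have "U (B (A v)) = m\<^sup>2 *\<^sub>R U v" unfolding BAv scaleR_scaleC lin ..
  ultimately have "U (U v) = (U v + U v - m\<^sup>2 *\<^sub>R U v) - v" by (simp add: algebra_simps)
  also have "U v + U v - m\<^sup>2 *\<^sub>R U v = (2 - m\<^sup>2) *\<^sub>R U v"
    by (simp add: scaleR_diff_left scaleR_2)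
  finally have UU: "U (U v) = of_real (2 - m\<^sup>2) *\<^sub>C U v - v" unfolding scaleR_scaleC .
  \<comment> \<open>\<open>z1\<close> and its conjugate are the roots of
    \<open>z^2 - (2 - m^2) z + 1\<close>. The bound \<open>m \<le> 2\<close> puts them on the unit
    circle, and their distance from 1 is then \<open>m\<close>.\<close>
  define q where "q = sqrt (1 - ((2 - m\<^sup>2) / 2)\<^sup>2)"
  define z1 where "z1 = Complex ((2 - m\<^sup>2) / 2) q"
  have "m\<^sup>2 \<le> 2\<^sup>2" using m_le \<open>0 < m\<close> by (intro power_mono) auto
  then have "\<bar>(2 - m\<^sup>2) / 2\<bar> \<le> 1" by (simp add: abs_le_iff)
  then have q: "q\<^sup>2 = 1 - ((2 - m\<^sup>2) / 2)\<^sup>2"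
    unfolding q_def by (simp add: abs_square_le_1)
  have sum_z1: "z1 + cnj z1 = of_real (2 - m\<^sup>2)" by (simp add: z1_def complex_eq_iff)
  have prod_z1: "z1 * cnj z1 = 1"
    using q by (simp add: z1_def complex_eq_iff power2_eq_square)
  have dist_z1: "cmod (z1 - 1) = m"
  proof -
    have "(cmod (z1 - 1))\<^sup>2 = ((2 - m\<^sup>2) / 2 - 1)\<^sup>2 + q\<^sup>2"
      by (simp add: cmod_power2 z1_def)
    also have "\<dots> = m\<^sup>2" unfolding q by (simp add: power2_eq_square field_simps)
    finally show ?thesis using \<open>0 < m\<close> by simp
  qed
  \<comment> \<open>Since \<open>(U - z1) (U - cnj z1) v = 0\<close>, either this vector is an
    eigenvector for \<open>z1\<close>, or it vanishes and \<open>v\<close> is one for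
    \<open>cnj z1\<close>.\<close>
  define w where "w = U v - cnj z1 *\<^sub>C v"
  have wW: "cinner (e i) w = 0" if "i \<in> I" for i
    using vW W_U[OF vW] that by (simp add: w_def W_def cinner_diff_right cinner_scaleC_right)
  have Uw: "U w = z1 *\<^sub>C w"
  proof -
    have "U w = (z1 + cnj z1) *\<^sub>C U v - v - cnj z1 *\<^sub>C U v"
      unfolding w_def lin UU sum_z1 ..
    also have "\<dots> = z1 *\<^sub>C U v - (z1 * cnj z1) *\<^sub>C v"
      unfolding prod_z1 by (simp add: scaleC_add_left scaleC_one)
    finally show ?thesis by (simp add: w_def scaleC_diff_right scaleC_scaleC)
  qed
  show ?thesis
  proof (cases "w = 0")
    case True
    have "cmod (cnj z1 - 1) = m" using dist_z1 by (metis complex_cnj_diff complex_cnj_one complex_mod_cnj)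
    with True show ?thesis
      using vW v1 \<open>c < m\<close> by (intro that[of v "cnj z1"]) (auto simp: w_def W_def)
  next
    case False
    then show ?thesis
      using wW Uw dist_z1 \<open>c < m\<close>
      by (intro that[of "complex_of_real (1 / norm w) *\<^sub>C w" z1])
        (auto simp: cinner_scaleC_right norm_scaleC norm_divide lin scaleC_scaleC mult.commute)
  qed
qed

section \<open>Maximal families of eigenvectors with eigenvalues away from 1\<close>

lemma finite_positive_lower_bound:
  fixes f :: "'b \<Rightarrow> real"
  assumes "finite S" "\<And>x. x \<in> S \<Longrightarrow> 0 < f x"
  obtains \<gamma> where "0 < \<gamma>" "\<And>x. x \<in> S \<Longrightarrow> \<gamma> \<le> f x"
proof -
  have "\<exists>\<gamma>>0. \<forall>x\<in>S. \<gamma> \<le> f x"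
    using assms
  proof (induction S rule: finite_induct)
    case (insert x S)
    then obtain \<gamma> where "0 < \<gamma>" "\<forall>x\<in>S. \<gamma> \<le> f x" by auto
    with insert.prems show ?case by (intro exI[of _ "min \<gamma> (f x)"]) auto
  qed (auto intro: exI[of _ 1])
  then show ?thesis using that by blast
qed

text \<open>Maximality is phrased as the absence of further eigenvectors in the orthogonal
  complement; both the multiplicity count and the norm bound on the complement are deduced from this
  form.\<close>

definition eigenfamily ::
    "('a::chilbert_space \<Rightarrow> 'a) \<Rightarrow> real \<Rightarrow> nat \<Rightarrow> (nat \<Rightarrow> 'a) \<Rightarrow> (nat \<Rightarrow> complex) \<Rightarrow> bool" where
  "eigenfamily U c n e z \<longleftrightarrow> orthonormal_on {..<n} e \<and>
     (\<forall>i<n. U (e i) = z i *\<^sub>C e i \<and> c \<le> cmod (z i - 1)) \<and>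
     (\<forall>x w. (\<forall>i<n. cinner (e i) x = 0) \<longrightarrow> U x = w *\<^sub>C x \<longrightarrow> c \<le> cmod (w - 1) \<longrightarrow> x = 0)"

lemma eigenfamilyD:
  assumes "eigenfamily U c n e z"
  shows "orthonormal_on {..<n} e"
    and "i < n \<Longrightarrow> U (e i) = z i *\<^sub>C e i"
    and "i < n \<Longrightarrow> c \<le> cmod (z i - 1)"
    and "(\<And>i. i < n \<Longrightarrow> cinner (e i) x = 0) \<Longrightarrow> U x = w *\<^sub>C x \<Longrightarrow> c \<le> cmod (w - 1) \<Longrightarrow> x = 0"
  using assms unfolding eigenfamily_def by blast+

lemma unitary1D:
  assumes "U \<in> unitary1"
  shows "unitary_op U" "trace_class (\<lambda>x. U x - x)"
  using assms by (auto simp: unitary1_def)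

lemma unitary1_trace_norm:
  assumes "U \<in> unitary1"
  obtains t where "trace_norm (\<lambda>x. U x - x) \<le> ennreal t" "0 \<le> t"
  using unitary1D(2)[OF assms] unfolding trace_class_def
  by (cases "trace_norm (\<lambda>x. U x - x)") auto

lemma sum_eigenvalues_le:
  assumes "finite I" "orthonormal_on I e" "\<And>i. i \<in> I \<Longrightarrow> U (e i) = z i *\<^sub>C e i"
    and "trace_norm (\<lambda>x. U x - x) \<le> ennreal t" "0 \<le> t"
  shows "(\<Sum>i\<in>I. cmod (z i - 1)) \<le> t"
proof -
  have "(\<Sum>i\<in>I. cmod (z i - 1)) = (\<Sum>i\<in>I. cmod (cinner (U (e i) - e i) (e i)))"
  proof (rule sum.cong)
    fix i assume i: "i \<in> I"
    have "U (e i) - e i = (z i - 1) *\<^sub>C e i"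
      using assms(3)[OF i] by (simp add: scaleC_diff_left scaleC_one)
    then show "cmod (z i - 1) = cmod (cinner (U (e i) - e i) (e i))"
      using assms(2) i complex_mod_cnj[of "z i - 1"]
      by (simp add: cinner_scaleC_left orthonormal_on_def)
  qed simp
  also have "\<dots> \<le> t"
    using sum_on_le_trace_norm_real[OF assms(1,2,2,4,5)] .
  finally show ?thesis .
qed

text \<open>Each member contributes at least \<open>c\<close> to the trace norm, so the length is at
  most \<open>t / c\<close> and a longest family exists. A leftover eigenvector, normalized, would
  lengthen it.\<close>

lemma eigenfamily_exists:
  fixes U :: "'a::chilbert_space \<Rightarrow> 'a"
  assumes U: "U \<in> unitary1" and "0 < c"
  obtains n e z where "eigenfamily U c n e z"
proof -
  obtain t where t: "trace_norm (\<lambda>x. U x - x) \<le> ennreal t" "0 \<le> t"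
    using unitary1_trace_norm[OF U] .
  define P where "P = (\<lambda>n. \<exists>(e::nat \<Rightarrow> 'a) z. orthonormal_on {..<n} e \<and>
     (\<forall>i<n. U (e i) = z i *\<^sub>C e i \<and> c \<le> cmod (z i - 1)))"
  have "n \<le> nat \<lceil>t / c\<rceil>" if "P n" for n
  proof -
    obtain e :: "nat \<Rightarrow> 'a" and z where ez: "orthonormal_on {..<n} e"
      "\<forall>i<n. U (e i) = z i *\<^sub>C e i \<and> c \<le> cmod (z i - 1)"
      using \<open>P n\<close> unfolding P_def by blast
    have "real n * c \<le> (\<Sum>i<n. cmod (z i - 1))"
      using sum_mono[of "{..<n}" "\<lambda>_. c" "\<lambda>i. cmod (z i - 1)"] ez(2) by simp
    also have "\<dots> \<le> t"
      by (rule sum_eigenvalues_le[OF _ ez(1) _ t]) (use ez(2) in auto)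
    finally have "real n \<le> t / c" using \<open>0 < c\<close> by (simp add: pos_le_divide_eq)
    then show ?thesis by linarith
  qed
  moreover have "P 0" by (simp add: P_def orthonormal_on_def)
  ultimately obtain n where "P n" and max: "\<And>k. P k \<Longrightarrow> k \<le> n"
    using Nat.ex_has_greatest_nat[of P 0 "nat \<lceil>t / c\<rceil>"] by blast
  then obtain e :: "nat \<Rightarrow> 'a" and z where ez: "orthonormal_on {..<n} e"
      "\<forall>i<n. U (e i) = z i *\<^sub>C e i \<and> c \<le> cmod (z i - 1)"
    unfolding P_def by blast
  have "x = 0" if x: "\<forall>i<n. cinner (e i) x = 0" "U x = w *\<^sub>C x" "c \<le> cmod (w - 1)" for x w
  proof (rule ccontr)
    assume "x \<noteq> 0"
    define u where "u = complex_of_real (1 / norm x) *\<^sub>C x"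
    have "norm u = 1" using \<open>x \<noteq> 0\<close> by (simp add: u_def norm_scaleC norm_divide)
    then have "orthonormal_on {..<Suc n} (e(n := u))"
      using ez(1) x(1) by (intro orthonormal_on_lessThan_Suc) (auto simp: u_def cinner_scaleC_right)
    moreover have "U u = w *\<^sub>C u"
      using x(2) clinearD(2)[OF unitary_clinear[OF unitary1D(1)[OF U]]]
      by (simp add: u_def scaleC_scaleC mult.commute)
    ultimately have "P (Suc n)"
      unfolding P_def using ez(2) x(3)
      by (intro exI[of _ "e(n := u)"] exI[of _ "z(n := w)"]) (auto simp: less_Suc_eq)
    then show False using max by fastforce
  qed
  with ez that show ?thesis unfolding eigenfamily_def by blast
qed

text \<open>A violation would yield, by \<open>unitary_eigenvector_orthogonal\<close>, another
  eigenvector in the complement with eigenvalue beyond \<open>c\<close>, against maximality.\<close>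

lemma eigenfamily_orthogonal_bound:
  assumes U: "U \<in> unitary1" and e: "eigenfamily U c n e z" and "0 \<le> c"
    and x: "\<And>i. i < n \<Longrightarrow> cinner (e i) x = 0"
  shows "norm (U x - x) \<le> c * norm x"
proof (rule ccontr)
  assume "\<not> ?thesis"
  then have "c * norm x < norm (U x - x)" by simp
  with U obtain y w where "\<And>i. i \<in> {..<n} \<Longrightarrow> cinner (e i) y = 0" "norm y = 1" "U y = w *\<^sub>C y" "c < cmod (w - 1)"
    using unitary_eigenvector_orthogonal[of U "{..<n}" e z x c] eigenfamilyD(2)[OF e] x \<open>0 \<le> c\<close>
    by (metis lessThan_iff)
  then show False using eigenfamilyD(4)[OF e, of y w] by simp
qed

section \<open>Multiplicities in the spectrum, read off from an eigenfamily\<close>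

lemma spec_ge_card:
  assumes "finite J" "orthonormal_on J e" "\<And>i. i \<in> J \<Longrightarrow> U (e i) = w *\<^sub>C e i"
  shows "enat (card J) \<le> spec U w"
proof (cases "w = 1")
  case False
  obtain g where g: "bij_betw g {..<card J} J"
    using assms(1) ex_bij_betw_nat_finite by (metis atLeast0LessThan)
  have "orthonormal_fam (card J) (\<lambda>i. e (g i)) \<and> (\<forall>i<card J. U (e (g i)) = w *\<^sub>C e (g i))"
    using orthonormal_on_reindex[OF assms(2), of g] assms(3) bij_betwE[OF g] g
    by (simp add: orthonormal_fam_iff bij_betw_def)
  then have "enat (card J) \<le> Sup {enat n | n. \<exists>e. orthonormal_fam n e \<and> (\<forall>i<n. U (e i) = w *\<^sub>C e i)}"
    by (intro Sup_upper) (rule CollectI, rule exI[of _ "card J"], blast)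
  then show ?thesis using False by (simp add: spec_def)
qed (simp add: spec_def)

lemma spec_nonzero_eigenvector:
  assumes "spec U w \<noteq> 0" "w \<noteq> 1"
  obtains x where "norm x = 1" "U x = w *\<^sub>C x"
proof -
  have "\<exists>(n::nat) e. n \<noteq> 0 \<and> orthonormal_on {..<n} e \<and> (\<forall>i<n. U (e i) = w *\<^sub>C e i)"
  proof (rule ccontr)
    assume "\<not> ?thesis"
    then have "Sup {enat n | n. \<exists>e. orthonormal_fam n e \<and> (\<forall>i<n. U (e i) = w *\<^sub>C e i)} \<le> 0"
      unfolding orthonormal_fam_iff
    proof (intro Sup_least)
      fix x assume none: "\<not> (\<exists>(n::nat) e. n \<noteq> 0 \<and> orthonormal_on {..<n} e \<and> (\<forall>i<n. U (e i) = w *\<^sub>C e i))"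
        and "x \<in> {enat n | n. \<exists>e. orthonormal_on {..<n} e \<and> (\<forall>i<n. U (e i) = w *\<^sub>C e i)}"
      then obtain n where x: "x = enat n" and e: "\<exists>e. orthonormal_on {..<n} e \<and> (\<forall>i<n. U (e i) = w *\<^sub>C e i)"
        by blast
      have "n = 0" using none e by metis
      with x show "x \<le> 0" by (simp add: zero_enat_def)
    qed
    then show False using assms by (simp add: spec_def)
  qed
  then obtain n :: nat and e where "n \<noteq> 0" "orthonormal_on {..<n} e" "\<forall>i<n. U (e i) = w *\<^sub>C e i"
    by blast
  then show ?thesis using orthonormal_on_norm[of "{..<n}" e 0] by (intro that[of "e 0"]) auto
qed

text \<open>An eigenvector for \<open>w\<close> is orthogonal to the members with other eigenvalues.
  Removing its components along the members for \<open>w\<close> leaves an eigenvector orthogonal to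
  the whole family, which is 0 by maximality. So it lies in the span of those members, and
  \<open>orthonormal_count\<close> with \<open>\<tau> = 0\<close> bounds the dimension.\<close>

lemma spec_eq_card:
  fixes U :: "'a::chilbert_space \<Rightarrow> 'a"
  assumes U: "U \<in> unitary1" and e: "eigenfamily U c n e z" and "0 < c" "c \<le> cmod (w - 1)"
  shows "spec U w = enat (card {i. i < n \<and> z i = w})"
proof (rule antisym)
  note un = unitary1D(1)[OF U]
  note lin = clinearD[OF unitary_clinear[OF un]]
  define J where "J = {i. i < n \<and> z i = w}"
  have J: "finite J" "orthonormal_on J e" "\<And>i. i \<in> J \<Longrightarrow> U (e i) = w *\<^sub>C e i"
    using orthonormal_on_subset[OF eigenfamilyD(1)[OF e], of J] eigenfamilyD(2)[OF e]
    by (auto simp: J_def)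
  then show "enat (card {i. i < n \<and> z i = w}) \<le> spec U w"
    using spec_ge_card unfolding J_def by blast
  have "m \<le> card J" if o: "orthonormal_on {..<m} x" and x: "\<forall>i<m. U (x i) = w *\<^sub>C x i" for m and x :: "nat \<Rightarrow> 'a"
  proof -
    have "1 - 0 \<le> (\<Sum>i\<in>J. (cmod (cinner (e i) (x l)))\<^sup>2)" if "l \<in> {..<m}" for l
    proof -
      have Ux: "U (x l) = w *\<^sub>C x l" using x that by simp
      let ?y = "proj_compl J e (x l)"
      have "cinner (e i) ?y = 0" if "i < n" for i
      proof (cases "i \<in> J")
        case True then show ?thesis using cinner_proj_compl[OF J(2,1)] by simp
      next
        case False
        then have "cinner (e i) (x l) = 0"
          using that by (intro orthogonal_eigenvectors[OF un eigenfamilyD(2)[OF e that] Ux]) (simp add: J_def)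
        moreover have "cinner (e i) (e j) = 0" if "j \<in> J" for j
          using that False \<open>i < n\<close> eigenfamilyD(1)[OF e] by (auto simp: orthonormal_on_def J_def)
        ultimately show ?thesis
          by (simp add: proj_compl_def cinner_diff_right cinner_sum_right cinner_scaleC_right)
      qed
      moreover have "U ?y = w *\<^sub>C ?y"
      proof -
        have "U ?y = U (x l) - (\<Sum>i\<in>J. cinner (e i) (x l) *\<^sub>C U (e i))"
          by (simp add: proj_compl_def lin clinear_sum[OF unitary_clinear[OF un]])
        also have "(\<Sum>i\<in>J. cinner (e i) (x l) *\<^sub>C U (e i)) = (\<Sum>i\<in>J. w *\<^sub>C (cinner (e i) (x l) *\<^sub>C e i))"
          by (rule sum.cong) (simp_all add: J(3) scaleC_scaleC mult.commute)
        finally show ?thesis by (simp add: Ux proj_compl_def scaleC_diff_right scaleC_sum_right)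
      qed
      ultimately have "?y = 0" using eigenfamilyD(4)[OF e, of ?y w] \<open>c \<le> cmod (w - 1)\<close> by blast
      then show ?thesis
        using bessel_identity[OF J(2,1), of "x l"] orthonormal_on_norm[OF o that] by simp
    qed
    from orthonormal_count[OF o _ J(2,1) this] show ?thesis by simp
  qed
  moreover have "w \<noteq> 1" using assms(3,4) by auto
  ultimately show "spec U w \<le> enat (card {i. i < n \<and> z i = w})"
    unfolding spec_def J_def orthonormal_fam_iff by (auto intro!: Sup_least)
qed

lemma spec_nonzero_cmod:
  assumes "U \<in> unitary1" "spec U w \<noteq> 0" shows "cmod w = 1"
proof (cases "w = 1")
  case False
  with assms(2) obtain x where "norm x = 1" "U x = w *\<^sub>C x"
    by (rule spec_nonzero_eigenvector)
  then show ?thesis using cmod_eigenvalue[OF unitary1D(1)[OF assms(1)], of x w] by fastforce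
qed simp

lemma finite_spec_away:
  assumes "U \<in> unitary1" "0 < c"
  shows "finite {w. spec U w \<noteq> 0 \<and> c \<le> cmod (w - 1)}"
proof -
  obtain n e z where e: "eigenfamily U c n e z" using eigenfamily_exists[OF assms] .
  have "{w. spec U w \<noteq> 0 \<and> c \<le> cmod (w - 1)} \<subseteq> z ` {..<n}"
  proof
    fix w assume w: "w \<in> {w. spec U w \<noteq> 0 \<and> c \<le> cmod (w - 1)}"
    then have "card {i. i < n \<and> z i = w} \<noteq> 0"
      using spec_eq_card[OF assms(1) e assms(2), of w] by (auto simp: zero_enat_def)
    then have "{i. i < n \<and> z i = w} \<noteq> {}" by (metis card.empty)
    then show "w \<in> z ` {..<n}" by auto
  qed
  then show ?thesis by (rule finite_subset) simp
qed

lemma countable_spec: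
  assumes "U \<in> unitary1" shows "countable {w. spec U w \<noteq> 0}"
proof -
  have "{w. spec U w \<noteq> 0} \<subseteq> insert 1 (\<Union>k. {w. spec U w \<noteq> 0 \<and> 1 / real (Suc k) \<le> cmod (w - 1)})"
  proof
    fix w assume w: "w \<in> {w. spec U w \<noteq> 0}"
    show "w \<in> insert 1 (\<Union>k. {w. spec U w \<noteq> 0 \<and> 1 / real (Suc k) \<le> cmod (w - 1)})"
    proof (cases "w = 1")
      case False
      then obtain k where "1 / real (Suc k) < cmod (w - 1)" using nat_approx_posE[of "cmod (w - 1)"] by auto
      then show ?thesis using w by (auto intro: less_imp_le)
    qed simp
  qed
  moreover have "countable \<dots>"
    by (intro countable_insert countable_UN countableI_type countable_finite finite_spec_away assms) simp
  ultimately show ?thesis by (rule countable_subset)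
qed

section \<open>Rigged sets\<close>

text \<open>The cost function is a parameter so that arc length and its collapsed version share the
  matching arguments below.\<close>

definition rdist :: "(complex \<Rightarrow> complex \<Rightarrow> real) \<Rightarrow> rigged \<Rightarrow> rigged \<Rightarrow> ennreal" where
  "rdist c m1 m2 = Inf {(\<Sum>j. ennreal (c (s j) (t j))) | s t. enumeration_of m1 s \<and> enumeration_of m2 t}"

lemma rigged_dist_eq_rdist: "rigged_dist = rdist arcdist"
  by (intro ext) (simp add: rigged_dist_def rdist_def)

lemma rdist_le:
  "enumeration_of m1 s \<Longrightarrow> enumeration_of m2 t \<Longrightarrow> rdist c m1 m2 \<le> (\<Sum>j. ennreal (c (s j) (t j)))"
  unfolding rdist_def by (rule Inf_lower) blast

lemma rdist_lessE:
  assumes "rdist c m1 m2 < K"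
  obtains s t where "enumeration_of m1 s" "enumeration_of m2 t" "(\<Sum>j. ennreal (c (s j) (t j))) < K"
  using assms unfolding rdist_def Inf_less_iff by blast

lemma enumeration_ofD:
  assumes "enumeration_of m s" shows "m (s j) \<noteq> 0"
proof -
  have "card {i. s i = s j} \<noteq> 0" if "finite {i. s i = s j}"
    using that by (auto simp: card_eq_0_iff)
  then show ?thesis
    using assms[unfolded enumeration_of_def, rule_format, of "s j"]
    by (cases "finite {i. s i = s j}") (auto simp: zero_enat_def)
qed

lemma enumeration_of_reindex:
  assumes "enumeration_of m s" "bij \<pi>" shows "enumeration_of m (\<lambda>j. s (\<pi> j))"
proof -
  have "bij_betw \<pi> {j. s (\<pi> j) = z} {j. s j = z}" for z
    using \<open>bij \<pi>\<close> unfolding bij_betw_def inj_on_def surj_def by (auto simp: image_iff)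
  then have "finite {j. s (\<pi> j) = z} = finite {j. s j = z}" "card {j. s (\<pi> j) = z} = card {j. s j = z}" for z
    using bij_betw_finite bij_betw_same_card by blast+
  then show ?thesis using assms(1) by (simp add: enumeration_of_def)
qed

text \<open>The fibres of \<open>s\<close> and \<open>t\<close> over each point are equinumerous,
  either finite of equal size or both countably infinite; bijections between them glue to a
  permutation of the indices.\<close>

lemma enumeration_of_unique:
  assumes s: "enumeration_of m s" and t: "enumeration_of m t"
  obtains \<pi> where "bij \<pi>" "\<And>j. t (\<pi> j) = s j"
proof -
  have "\<exists>g. bij_betw g {j. s j = z} {j. t j = z}" for z
  proof (cases "finite {j. s j = z}")
    case True
    then have "m z = enat (card {j. s j = z})" using s by (simp add: enumeration_of_def)
    then have "finite {j. t j = z}" "card {j. t j = z} = card {j. s j = z}"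
      using t by (simp_all add: enumeration_of_def split: if_splits)
    with True show ?thesis by (metis finite_same_card_bij)
  next
    case False
    then have "m z = \<infinity>" using s by (simp add: enumeration_of_def)
    then have "infinite {j. t j = z}" using t by (auto simp: enumeration_of_def split: if_splits)
    with False show ?thesis
      by (metis bij_betw_inv bij_betw_trans bij_enumerate)
  qed
  then obtain g where g: "\<And>z. bij_betw (g z) {j. s j = z} {j. t j = z}" by metis
  define \<pi> where "\<pi> = (\<lambda>j. g (s j) j)"
  have t\<pi>: "t (\<pi> j) = s j" for j using bij_betwE[OF g[of "s j"]] by (simp add: \<pi>_def)
  have "inj \<pi>"
  proof (rule injI)
    fix i j assume ij: "\<pi> i = \<pi> j"
    then have "s i = s j" using t\<pi> by metis
    then show "i = j" using ij bij_betw_imp_inj_on[OF g[of "s i"]] by (auto simp: \<pi>_def inj_on_def)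
  qed
  moreover have "\<exists>j. \<pi> j = k" for k
  proof -
    have "k \<in> g (t k) ` {j. s j = t k}" using bij_betw_imp_surj_on[OF g[of "t k"]] by simp
    then obtain x where "k = g (t k) x" "s x = t k" by blast
    then have "\<pi> x = k" by (simp add: \<pi>_def)
    then show ?thesis ..
  qed
  ultimately have "bij \<pi>" by (metis bij_betw_def surjI)
  then show ?thesis using that t\<pi> by blast
qed

lemma suminf_ennreal_reindex:
  fixes f :: "nat \<Rightarrow> ennreal"
  assumes "bij \<pi>" shows "(\<Sum>j. f (\<pi> j)) = (\<Sum>j. f j)"
  using nn_integral_bij_count_space[OF assms, of f] by (simp add: nn_integral_count_space_nat)

lemma suminf_enumeration_cong:
  fixes f :: "complex \<Rightarrow> ennreal"
  assumes "enumeration_of m s" "enumeration_of m t"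
  shows "(\<Sum>j. f (s j)) = (\<Sum>j. f (t j))"
proof -
  obtain \<pi> where "bij \<pi>" "\<And>j. t (\<pi> j) = s j" by (rule enumeration_of_unique[OF assms]) blast
  then show ?thesis using suminf_ennreal_reindex[of \<pi> "\<lambda>j. f (t j)"] by simp
qed

lemma rdist_commute_le:
  assumes "\<And>z w. m1 z \<noteq> 0 \<Longrightarrow> m2 w \<noteq> 0 \<Longrightarrow> c z w = c w z"
  shows "rdist c m1 m2 \<le> rdist c m2 m1"
  unfolding rdist_def[of c m2 m1]
proof (rule Inf_greatest)
  fix x assume "x \<in> {(\<Sum>j. ennreal (c (s j) (t j))) | s t. enumeration_of m2 s \<and> enumeration_of m1 t}"
  then obtain s t where st: "enumeration_of m2 s" "enumeration_of m1 t" and x: "x = (\<Sum>j. ennreal (c (s j) (t j)))"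
    by blast
  have "c (s j) (t j) = c (t j) (s j)" for j
    using assms[OF enumeration_ofD[OF st(2)] enumeration_ofD[OF st(1)]] by simp
  then show "rdist c m1 m2 \<le> x" using rdist_le[OF st(2,1), of c] x by simp
qed

lemma less_add_ennreal:
  assumes "x < top" "0 < e" shows "(x::ennreal) < x + ennreal e"
  using assms by (cases x) (auto simp: ennreal_less_iff simp flip: ennreal_plus)

text \<open>Two nearly optimal matchings meet in different enumerations of \<open>m2\<close>. A
  permutation aligns them, and it is applied to the second matching as a whole, whose cost is
  unchanged by reordering. The cost needs the triangle inequality on the supports alone, where all
  entries of an enumeration lie.\<close>

lemma rdist_triangle:
  assumes tri: "\<And>z w u. m1 z \<noteq> 0 \<Longrightarrow> m2 w \<noteq> 0 \<Longrightarrow> m3 u \<noteq> 0 \<Longrightarrow> c z u \<le> c z w + c w u"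
    and nonneg: "\<And>z w. 0 \<le> c z w"
  shows "rdist c m1 m3 \<le> rdist c m1 m2 + rdist c m2 m3"
proof (rule ennreal_le_epsilon)
  fix e :: real assume fin: "rdist c m1 m2 + rdist c m2 m3 < top" and "0 < e"
  then have "rdist c m1 m2 < rdist c m1 m2 + ennreal (e / 2)" "rdist c m2 m3 < rdist c m2 m3 + ennreal (e / 2)"
    by (auto intro!: less_add_ennreal)
  note less = this
  obtain s t where e1: "enumeration_of m1 s" and e2: "enumeration_of m2 t"
    and l1: "(\<Sum>j. ennreal (c (s j) (t j))) < rdist c m1 m2 + ennreal (e / 2)"
    using less(1) by (rule rdist_lessE)
  obtain t' u where e3: "enumeration_of m2 t'" and e4: "enumeration_of m3 u"
    and l2: "(\<Sum>j. ennreal (c (t' j) (u j))) < rdist c m2 m3 + ennreal (e / 2)"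
    using less(2) by (rule rdist_lessE)
  obtain \<pi> where \<pi>: "bij \<pi>" "\<And>j. t' (\<pi> j) = t j" by (rule enumeration_of_unique[OF e2 e3]) blast
  have e5: "enumeration_of m3 (\<lambda>j. u (\<pi> j))" by (rule enumeration_of_reindex[OF e4 \<pi>(1)])
  have "rdist c m1 m3 \<le> (\<Sum>j. ennreal (c (s j) (u (\<pi> j))))" by (rule rdist_le[OF e1 e5])
  also have "\<dots> \<le> (\<Sum>j. ennreal (c (s j) (t j)) + ennreal (c (t j) (u (\<pi> j))))"
    using tri[OF enumeration_ofD[OF e1] enumeration_ofD[OF e2] enumeration_ofD[OF e5]] nonneg
    by (intro suminf_le summableI) (simp add: ennreal_leI flip: ennreal_plus)
  also have "\<dots> = (\<Sum>j. ennreal (c (s j) (t j))) + (\<Sum>j. ennreal (c (t j) (u (\<pi> j))))"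
    by (rule suminf_add[symmetric]) auto
  also have "(\<Sum>j. ennreal (c (t j) (u (\<pi> j)))) = (\<Sum>j. ennreal (c (t' j) (u j)))"
    using suminf_ennreal_reindex[OF \<pi>(1), of "\<lambda>j. ennreal (c (t' j) (u j))"] \<pi>(2) by simp
  also have "(\<Sum>j. ennreal (c (s j) (t j))) + (\<Sum>j. ennreal (c (t' j) (u j)))
      \<le> (rdist c m1 m2 + ennreal (e / 2)) + (rdist c m2 m3 + ennreal (e / 2))"
    using l1 l2 by (intro add_mono less_imp_le)
  also have "\<dots> = rdist c m1 m2 + rdist c m2 m3 + (ennreal (e / 2) + ennreal (e / 2))"
    by (simp add: ac_simps)
  also have "ennreal (e / 2) + ennreal (e / 2) = ennreal e"
    using \<open>0 < e\<close> by (simp flip: ennreal_plus)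
  finally show "rdist c m1 m3 \<le> rdist c m1 m2 + rdist c m2 m3 + ennreal e" .
qed

text \<open>Replace each point by as many labelled copies as its multiplicity. The resulting set is
  countable, and infinite because of the copies of 1, hence in bijection with the natural
  numbers.\<close>

lemma enumeration_of_exists:
  assumes "m 1 = \<infinity>" "countable {z. m z \<noteq> 0}"
  obtains s where "enumeration_of m s"
proof -
  define K where "K = (\<lambda>z. {k. enat k < m z})"
  define X where "X = Sigma {z. m z \<noteq> 0} K"
  have "countable X" unfolding X_def by (intro countable_SIGMA assms countableI_type)
  have "Pair 1 ` UNIV \<subseteq> X" using assms(1) by (auto simp: X_def K_def)
  moreover have "infinite (Pair (1::complex) ` (UNIV :: nat set))"
    by (simp add: finite_image_iff inj_on_def)
  ultimately have "infinite X" using finite_subset by blast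
  with \<open>countable X\<close> obtain f where b: "bij_betw f (UNIV :: nat set) X"
    using bij_betw_from_nat_into by blast
  then have X: "X = range f" by (simp add: bij_betw_def)
  define s where "s = (\<lambda>j. fst (f j))"
  have "m z = (if finite {j. s j = z} then enat (card {j. s j = z}) else \<infinity>)" for z
  proof -
    have "f ` {j. s j = z} = {x \<in> X. fst x = z}"
      unfolding s_def X by auto
    moreover have "{x \<in> X. fst x = z} = Pair z ` K z" by (auto simp: X_def K_def)
    ultimately have "bij_betw f {j. s j = z} (Pair z ` K z)"
      using bij_betw_subset[OF b subset_UNIV] by metis
    moreover have "bij_betw (Pair z) (K z) (Pair z ` K z)" by (simp add: bij_betw_def inj_on_def)
    ultimately have eq: "finite {j. s j = z} = finite (K z)" "card {j. s j = z} = card (K z)"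
      using bij_betw_finite bij_betw_same_card by metis+
    show ?thesis
    proof (cases "m z")
      case (enat n)
      then have "K z = {..<n}" by (auto simp: K_def)
      then show ?thesis using eq enat by simp
    next
      case infinity
      then have "K z = UNIV" by (auto simp: K_def)
      then show ?thesis using eq infinity by simp
    qed
  qed
  then have "enumeration_of m s" unfolding enumeration_of_def by blast
  then show ?thesis by (rule that)
qed

text \<open>After the far points are listed, the multiplicities near 1 still contain 1 infinitely
  often, so they have an enumeration of their own to put behind the list.\<close>

lemma enumeration_of_extends_list:
  assumes m: "m 1 = \<infinity>" "countable {z. m z \<noteq> 0}" and "0 < c"
    and z: "\<And>i. i < n \<Longrightarrow> c \<le> cmod (z i - 1)"
    and count: "\<And>w. c \<le> cmod (w - 1) \<Longrightarrow> m w = enat (card {i. i < n \<and> z i = w})"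
  obtains s where "enumeration_of m s" "\<And>i. i < n \<Longrightarrow> s i = z i" "\<And>j. n \<le> j \<Longrightarrow> cmod (s j - 1) < c"
proof -
  define m' where "m' = (\<lambda>w. if cmod (w - 1) < c then m w else 0)"
  have "countable {z. m' z \<noteq> 0}"
    by (rule countable_subset[OF _ m(2)]) (auto simp: m'_def)
  moreover have "m' 1 = \<infinity>" using m \<open>0 < c\<close> by (simp add: m'_def)
  ultimately obtain s' where s': "enumeration_of m' s'" using enumeration_of_exists by blast
  have near: "cmod (s' j - 1) < c" for j
    using enumeration_ofD[OF s', of j] by (auto simp: m'_def split: if_splits)
  define s where "s = (\<lambda>j. if j < n then z j else s' (j - n))"
  have "m w = (if finite {j. s j = w} then enat (card {j. s j = w}) else \<infinity>)" for w
  proof (cases "c \<le> cmod (w - 1)")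
    case True
    then have "s' j \<noteq> w" for j using near[of j] by auto
    then have "{j. s j = w} = {i. i < n \<and> z i = w}" by (auto simp: s_def)
    then show ?thesis using count[OF True] by simp
  next
    case False
    have "{j. s j = w} = (+) n ` {j. s' j = w}"
    proof (intro set_eqI iffI)
      fix j assume "j \<in> {j. s j = w}"
      then have "\<not> j < n" "s' (j - n) = w" using z False by (auto simp: s_def split: if_splits)
      then show "j \<in> (+) n ` {j. s' j = w}" by (intro image_eqI[of _ _ "j - n"]) auto
    qed (auto simp: s_def)
    moreover have "m w = (if finite {j. s' j = w} then enat (card {j. s' j = w}) else \<infinity>)"
      using s'[unfolded enumeration_of_def, rule_format, of w] False by (simp add: m'_def)
    ultimately show ?thesis by (simp add: finite_image_iff card_image)
  qed
  then have "enumeration_of m s" by (simp add: enumeration_of_def)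
  then show ?thesis
    by (rule that) (auto simp: s_def near)
qed

text \<open>Put the far points first in both enumerations; all later pairs lie within
  \<open>r\<close> of 1 and cost nothing, so the matching costs a finite sum.\<close>

lemma rdist_le_list:
  fixes z w :: "nat \<Rightarrow> complex"
  assumes c: "\<And>z w. m1 z \<noteq> 0 \<Longrightarrow> m2 w \<noteq> 0 \<Longrightarrow> cmod (z - 1) < r \<Longrightarrow> cmod (w - 1) < r \<Longrightarrow> c z w = 0" and "0 < r"
    and m1: "m1 1 = \<infinity>" "countable {z. m1 z \<noteq> 0}" and m2: "m2 1 = \<infinity>" "countable {z. m2 z \<noteq> 0}"
    and z: "\<And>i. i < n \<Longrightarrow> r \<le> cmod (z i - 1)" "\<And>w. r \<le> cmod (w - 1) \<Longrightarrow> m1 w = enat (card {i. i < n \<and> z i = w})"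
    and w: "\<And>i. i < n \<Longrightarrow> r \<le> cmod (w i - 1)" "\<And>v. r \<le> cmod (v - 1) \<Longrightarrow> m2 v = enat (card {i. i < n \<and> w i = v})"
    and nonneg: "\<And>z w. 0 \<le> c z w"
  shows "rdist c m1 m2 \<le> ennreal (\<Sum>i<n. c (z i) (w i))"
proof -
  obtain s where s: "enumeration_of m1 s" "\<And>i. i < n \<Longrightarrow> s i = z i" "\<And>j. n \<le> j \<Longrightarrow> cmod (s j - 1) < r"
    using enumeration_of_extends_list[OF m1 \<open>0 < r\<close> z] by blast
  obtain t where t: "enumeration_of m2 t" "\<And>i. i < n \<Longrightarrow> t i = w i" "\<And>j. n \<le> j \<Longrightarrow> cmod (t j - 1) < r"
    using enumeration_of_extends_list[OF m2 \<open>0 < r\<close> w] by blast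
  have "rdist c m1 m2 \<le> (\<Sum>j. ennreal (c (s j) (t j)))" by (rule rdist_le[OF s(1) t(1)])
  also have "\<dots> = (\<Sum>j<n. ennreal (c (s j) (t j)))"
    by (rule suminf_finite) (auto simp: c s(3) t(3) enumeration_ofD[OF s(1)] enumeration_ofD[OF t(1)])
  also have "\<dots> = (\<Sum>j<n. ennreal (c (z j) (w j)))"
    by (rule sum.cong) (auto simp: s(2) t(2))
  also have "\<dots> = ennreal (\<Sum>j<n. c (z j) (w j))"
    by (rule sum_ennreal) (rule nonneg)
  finally show ?thesis .
qed

section \<open>Arc length and chord on the unit circle\<close>

lemma abs_Arg_cis_le: "\<bar>Arg (cis \<theta>)\<bar> \<le> \<bar>\<theta>\<bar>"
proof (cases "- pi < \<theta> \<and> \<theta> \<le> pi")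
  case True then show ?thesis using cis_Arg_unique[of "cis \<theta>" \<theta>] by (simp add: sgn_div_norm)
next
  case False then show ?thesis using Arg_bounded[of "cis \<theta>"] by linarith
qed

lemma cis_Arg_unit: "cmod z = 1 \<Longrightarrow> cis (Arg z) = z"
  using cis_Arg[of z] by (cases "z = 0") (simp_all add: sgn_div_norm)

lemma arcdist_nonneg: "0 \<le> arcdist z w" by (simp add: arcdist_def)

lemma arcdist_commute:
  assumes "cmod z = 1" "cmod w = 1" shows "arcdist z w = arcdist w z"
proof -
  have *: "arcdist w z \<le> arcdist z w" if "cmod z = 1" "cmod w = 1" for z w
  proof -
    have "w * cnj z = cnj (cis (Arg (z * cnj w)))" using that by (simp add: cis_Arg_unit norm_mult)
    then show ?thesis using abs_Arg_cis_le[of "- Arg (z * cnj w)"] by (simp add: arcdist_def cis_cnj)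
  qed
  show ?thesis using *[OF assms] *[OF assms(2,1)] by simp
qed

lemma arcdist_triangle:
  assumes "cmod z = 1" "cmod w = 1" "cmod u = 1"
  shows "arcdist z u \<le> arcdist z w + arcdist w u"
proof -
  have "cnj w * w = 1" using assms(2) by (metis complex_norm_square mult.commute of_real_1 one_power2)
  moreover have "(z * cnj w) * (w * cnj u) = z * cnj u * (cnj w * w)" by (simp only: mult_ac)
  ultimately have "z * cnj u = (z * cnj w) * (w * cnj u)" by simp
  also have "\<dots> = cis (Arg (z * cnj w) + Arg (w * cnj u))"
    using assms by (simp add: cis_Arg_unit norm_mult flip: cis_mult)
  finally show ?thesis
    using abs_Arg_cis_le[of "Arg (z * cnj w) + Arg (w * cnj u)"] abs_triangle_ineq[of "Arg (z * cnj w)" "Arg (w * cnj u)"]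
    by (simp add: arcdist_def)
qed

text \<open>The chord is \<open>2 sin (\<theta> / 2)\<close>, so Taylor's formula gives
  \<open>\<theta> - \<theta>^3 / 24\<close> as a lower bound for it. The crude estimate serves near
  the collapsed arc and for summability; the second one has leading constant 1, which is what keeps
  the final inequality free of a constant.\<close>

lemma arcdist_le_chord:
  assumes "cmod z = 1" "cmod w = 1"
  shows "arcdist z w \<le> 3 * cmod (z - w)" (is ?A)
    and "arcdist z w \<le> cmod (z - w) + 2 * cmod (z - w) ^ 3" (is ?B)
proof -
  define \<theta> where "\<theta> = arcdist z w"
  have \<theta>: "0 \<le> \<theta>" "\<theta> \<le> pi" using Arg_bounded[of "z * cnj w"] by (auto simp: \<theta>_def arcdist_def)
  have "cnj w * w = 1" using assms(2) by (metis complex_norm_square mult.commute of_real_1 one_power2)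
  then have "z - w = (z * cnj w - 1) * w" by (simp add: left_diff_distrib mult.assoc)
  then have "cmod (z - w) = cmod (z * cnj w - 1)" using assms(2) by (simp add: norm_mult)
  also have "z * cnj w = exp (\<i> * of_real (Arg (z * cnj w)))"
    using assms cis_Arg_unit[of "z * cnj w"] by (simp add: norm_mult cis_conv_exp)
  finally have "cmod (z - w) = 2 * \<bar>sin (Arg (z * cnj w) / 2)\<bar>" by (simp only: dist_exp_i_1)
  then have chord: "cmod (z - w) = 2 * \<bar>sin (\<theta> / 2)\<bar>"
    by (auto simp: \<theta>_def arcdist_def abs_if)
  have "\<bar>sin (\<theta> / 2) - (\<Sum>m<3. sin_coeff m * (\<theta> / 2) ^ m)\<bar> \<le> inverse (fact 3) * \<bar>\<theta> / 2\<bar> ^ 3"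
    by (rule Maclaurin_sin_bound)
  then have "\<bar>sin (\<theta> / 2) - \<theta> / 2\<bar> \<le> \<theta> ^ 3 / 48"
    using \<theta> by (simp add: numeral_3_eq_3 sin_coeff_def fact_numeral power_divide) 
  from abs_le_D2[OF this] have lower: "\<theta> - \<theta> ^ 3 / 24 \<le> cmod (z - w)"
    unfolding chord using abs_ge_self[of "sin (\<theta> / 2)"] by linarith
  \<comment> \<open>With \<open>\<theta>^3 \<le> 16 \<theta>\<close> the cubic error is at most two
    thirds of \<open>\<theta>\<close>, whence the factor 3. Feeding this back into the error gives
    \<open>27 / 24\<close>, rounded up to 2.\<close>
  have "\<theta> \<le> 4" using \<theta> pi_less_4 by linarith
  then have "\<theta> * \<theta> \<le> 4 * 4" using \<theta> by (intro mult_mono) auto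
  then have "\<theta> ^ 3 \<le> 16 * \<theta>" using \<theta> mult_right_mono[of "\<theta> * \<theta>" 16 \<theta>] by (simp add: power3_eq_cube)
  then have three: "\<theta> \<le> 3 * cmod (z - w)" using lower by linarith
  then have "\<theta> ^ 3 \<le> (3 * cmod (z - w)) ^ 3" using \<theta> by (intro power_mono) auto
  then have "\<theta> ^ 3 \<le> 27 * cmod (z - w) ^ 3" by (simp add: power_mult_distrib)
  moreover have "0 \<le> cmod (z - w) ^ 3" by simp
  ultimately have "\<theta> \<le> cmod (z - w) + 2 * cmod (z - w) ^ 3" using lower by linarith
  with three show ?A ?B by (simp_all add: \<theta>_def)
qed

text \<open>The metric obtained from the circle by collapsing the closed arc of radius \<open>\<eta>\<close> about \<open>1\<close>
to a point; only finitely many eigenvalues are visible to it.\<close>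

definition arc_excess :: "real \<Rightarrow> complex \<Rightarrow> real" where
  "arc_excess \<eta> z = max (arcdist z 1 - \<eta>) 0"

definition collapsed_dist :: "real \<Rightarrow> complex \<Rightarrow> complex \<Rightarrow> real" where
  "collapsed_dist \<eta> z w = min (arcdist z w) (arc_excess \<eta> z + arc_excess \<eta> w)"

lemma collapsed_dist_nonneg: "0 \<le> collapsed_dist \<eta> z w"
  by (simp add: collapsed_dist_def arc_excess_def arcdist_nonneg)

lemma collapsed_dist_commute:
  "cmod z = 1 \<Longrightarrow> cmod w = 1 \<Longrightarrow> collapsed_dist \<eta> z w = collapsed_dist \<eta> w z"
  by (simp add: collapsed_dist_def arcdist_commute add.commute)

lemma arc_excess_lipschitz:
  "cmod z = 1 \<Longrightarrow> cmod w = 1 \<Longrightarrow> arc_excess \<eta> z \<le> arcdist z w + arc_excess \<eta> w"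
  using arcdist_triangle[of z w 1] arcdist_nonneg[of z w] by (simp add: arc_excess_def)

text \<open>Two direct legs use the triangle inequality for arc length. With one leg through the
  collapsed arc, the Lipschitz property moves the excess at \<open>w\<close> to the outer end of the
  direct leg. With two such legs the excesses at \<open>w\<close> are dropped.\<close>

lemma collapsed_dist_triangle:
  assumes "cmod z = 1" "cmod w = 1" "cmod u = 1"
  shows "collapsed_dist \<eta> z u \<le> collapsed_dist \<eta> z w + collapsed_dist \<eta> w u"
proof -
  have "0 \<le> arc_excess \<eta> w" by (simp add: arc_excess_def)
  then show ?thesis
    using arcdist_triangle[OF assms] arc_excess_lipschitz[OF assms(1,2), of \<eta>]
      arc_excess_lipschitz[OF assms(3,2), of \<eta>] arcdist_commute[OF assms(2,3)]
    unfolding collapsed_dist_def by linarith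
qed

section \<open>From the collapsed metric back to arc length\<close>

lemma suminf_interleave_le:
  fixes f :: "nat \<Rightarrow> ennreal"
  shows "(\<Sum>j. f j) \<le> (\<Sum>j. f (2 * j) + f (2 * j + 1))"
proof (rule suminf_le_const)
  fix n
  have "sum f {..<2 * n} = (\<Sum>j<n. f (2 * j) + f (2 * j + 1))" for n
    by (induction n) (simp_all add: add.assoc)
  moreover have "sum f {..<n} \<le> sum f {..<2 * n}" by (rule sum_mono2) auto
  moreover have "(\<Sum>j<n. f (2 * j) + f (2 * j + 1)) \<le> (\<Sum>j. f (2 * j) + f (2 * j + 1))"
    by (rule sum_le_suminf) auto
  ultimately show "sum f {..<n} \<le> (\<Sum>j. f (2 * j) + f (2 * j + 1))" by (metis order_trans)
qed auto

text \<open>Padding adds occurrences of 1 only, whose multiplicity is infinite already.\<close>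

lemma enumeration_of_pad_ones:
  assumes s: "enumeration_of m s" and "m 1 = \<infinity>"
    and pad: "\<And>j. s' (2 * j) = s j \<and> s' (2 * j + 1) = 1 \<or> s' (2 * j) = 1 \<and> s' (2 * j + 1) = s j"
  shows "enumeration_of m s'"
proof -
  define g where "g = (\<lambda>j. if s' (2 * j) = s j then 2 * j else 2 * j + 1)"
  have div: "g j div 2 = j" for j by (simp add: g_def)
  then have "inj g" by (metis injI)
  have sg: "s' (g j) = s j" for j using pad[of j] by (auto simp: g_def)
  have "m z = (if finite {j. s' j = z} then enat (card {j. s' j = z}) else \<infinity>)" for z
  proof (cases "z = 1")
    case True
    have "infinite {j. s j = 1}" using s \<open>m 1 = \<infinity>\<close> by (auto simp: enumeration_of_def split: if_splits)
    then have "infinite (g ` {j. s j = 1})" using \<open>inj g\<close> by (simp add: finite_image_iff inj_on_subset)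
    moreover have "g ` {j. s j = 1} \<subseteq> {j. s' j = 1}" using sg by auto
    ultimately have "infinite {j. s' j = 1}" using finite_subset by blast
    then show ?thesis using True \<open>m 1 = \<infinity>\<close> by simp
  next
    case False
    have "{j. s' j = z} = g ` {j. s j = z}"
    proof (intro set_eqI iffI)
      fix k assume "k \<in> {j. s' j = z}"
      then have k: "s' k = z" by simp
      have "k = 2 * (k div 2) \<or> k = 2 * (k div 2) + 1" by presburger
      then have "k = g (k div 2) \<and> s (k div 2) = z"
        using k pad[of "k div 2"] False unfolding g_def by (metis (full_types))
      then show "k \<in> g ` {j. s j = z}" by blast
    qed (auto simp: sg)
    moreover have "inj_on g {j. s j = z}" using \<open>inj g\<close> by (rule inj_on_subset) simp
    ultimately show ?thesis
      using s by (simp add: enumeration_of_def finite_image_iff card_image)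
  qed
  then show ?thesis by (simp add: enumeration_of_def)
qed

lemma arcdist_1: "cmod z = 1 \<Longrightarrow> arcdist 1 z = arcdist z 1"
  by (simp add: arcdist_commute)

text \<open>The distance of a point to 1 is its excess plus \<open>min (arcdist z 1) \<eta>\<close>.
  Rerouting a pair through 1 therefore costs at most these truncated distances beyond the collapsed
  cost, and their sum does not depend on the enumeration.\<close>

lemma rigged_dist_le_collapsed:
  assumes m1: "m1 1 = \<infinity>" "\<And>z. m1 z \<noteq> 0 \<Longrightarrow> cmod z = 1" and m2: "m2 1 = \<infinity>" "\<And>z. m2 z \<noteq> 0 \<Longrightarrow> cmod z = 1"
    and s: "enumeration_of m1 s" and t: "enumeration_of m2 t" and "0 < \<eta>"
  shows "rigged_dist m1 m2 \<le> rdist (collapsed_dist \<eta>) m1 m2 +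
    ((\<Sum>j. ennreal (min (arcdist (s j) 1) \<eta>)) + (\<Sum>j. ennreal (min (arcdist (t j) 1) \<eta>)))"
proof -
  let ?e = "\<lambda>z. ennreal (min (arcdist z 1) \<eta>)"
  have "rigged_dist m1 m2 \<le> K + ((\<Sum>j. ?e (s j)) + (\<Sum>j. ?e (t j)))"
    if K: "rdist (collapsed_dist \<eta>) m1 m2 < K" for K
  proof -
    obtain u v where u: "enumeration_of m1 u" and v: "enumeration_of m2 v"
      and uv: "(\<Sum>j. ennreal (collapsed_dist \<eta> (u j) (v j))) < K"
      using K by (rule rdist_lessE)
    have unit: "cmod (u j) = 1" "cmod (v j) = 1" for j
      using m1(2) m2(2) enumeration_ofD[OF u] enumeration_ofD[OF v] by auto
    define D where "D = (\<lambda>j. arcdist (u j) (v j) \<le> arc_excess \<eta> (u j) + arc_excess \<eta> (v j))"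
    \<comment> \<open>A pair matched through the collapsed arc is split into the pairs \<open>(u j, 1)\<close> and \<open>(1, v j)\<close>.\<close>
    define u' where "u' = (\<lambda>k. if even k then u (k div 2) else 1)"
    define v' where "v' = (\<lambda>k. if even k = D (k div 2) then v (k div 2) else 1)"
    have u': "enumeration_of m1 u'"
      by (rule enumeration_of_pad_ones[OF u m1(1)]) (simp add: u'_def)
    have v': "enumeration_of m2 v'"
      by (rule enumeration_of_pad_ones[OF v m2(1)]) (simp add: v'_def)
    have pair: "arcdist (u' (2 * j)) (v' (2 * j)) + arcdist (u' (2 * j + 1)) (v' (2 * j + 1))
        \<le> collapsed_dist \<eta> (u j) (v j) + (min (arcdist (u j) 1) \<eta> + min (arcdist (v j) 1) \<eta>)" for j
    proof (cases "D j")
      case True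
      moreover have "arcdist 1 1 = 0" by (simp add: arcdist_def)
      moreover have "0 \<le> min (arcdist (u j) 1) \<eta> + min (arcdist (v j) 1) \<eta>"
        using \<open>0 < \<eta>\<close> by (simp add: arcdist_nonneg)
      ultimately show ?thesis
        by (simp add: u'_def v'_def D_def collapsed_dist_def)
    next
      case False
      then have "collapsed_dist \<eta> (u j) (v j) = arc_excess \<eta> (u j) + arc_excess \<eta> (v j)"
        by (simp add: D_def collapsed_dist_def)
      with False show ?thesis
        using unit by (simp add: u'_def v'_def arcdist_1 arc_excess_def)
    qed
    have "rigged_dist m1 m2 \<le> (\<Sum>j. ennreal (arcdist (u' j) (v' j)))"
      unfolding rigged_dist_eq_rdist by (rule rdist_le[OF u' v'])
    also have "\<dots> \<le> (\<Sum>j. ennreal (arcdist (u' (2 * j)) (v' (2 * j))) + ennreal (arcdist (u' (2 * j + 1)) (v' (2 * j + 1))))"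
      by (rule suminf_interleave_le)
    also have "\<dots> \<le> (\<Sum>j. ennreal (collapsed_dist \<eta> (u j) (v j)) + (?e (u j) + ?e (v j)))"
      using pair \<open>0 < \<eta>\<close>
      by (intro suminf_le summableI) (simp add: ennreal_leI arcdist_nonneg collapsed_dist_nonneg flip: ennreal_plus)
    also have "\<dots> = (\<Sum>j. ennreal (collapsed_dist \<eta> (u j) (v j))) + ((\<Sum>j. ?e (u j)) + (\<Sum>j. ?e (v j)))"
      by (simp flip: suminf_add)
    also have "(\<Sum>j. ?e (u j)) = (\<Sum>j. ?e (s j))" by (rule suminf_enumeration_cong[OF u s])
    also have "(\<Sum>j. ?e (v j)) = (\<Sum>j. ?e (t j))" by (rule suminf_enumeration_cong[OF v t])
    finally show ?thesis using uv by (meson add_right_mono less_imp_le order_trans)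
  qed
  note bound = this
  show ?thesis
  proof (rule ennreal_le_epsilon)
    fix \<epsilon> :: real
    let ?R = "rdist (collapsed_dist \<eta>) m1 m2" and ?E = "(\<Sum>j. ?e (s j)) + (\<Sum>j. ?e (t j))"
    assume "?R + ?E < top" "0 < \<epsilon>"
    then have "?R < ?R + ennreal \<epsilon>"
      by (intro less_add_ennreal) auto
    from bound[OF this] show "rigged_dist m1 m2 \<le> ?R + ?E + ennreal \<epsilon>" by (simp add: ac_simps)
  qed
qed

text \<open>Dominated convergence by hand: a tail of \<open>q\<close> costs less than half of
  \<open>\<epsilon>\<close>, and the finitely many other terms are at most \<open>\<eta>\<close>
  each.\<close>

lemma suminf_min_small:
  fixes q :: "nat \<Rightarrow> real"
  assumes "\<And>j. 0 \<le> q j" "summable q" "0 < \<epsilon>"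
  obtains \<eta>\<^sub>0 where "0 < \<eta>\<^sub>0" "\<And>\<eta>. 0 < \<eta> \<Longrightarrow> \<eta> \<le> \<eta>\<^sub>0 \<Longrightarrow> (\<Sum>j. ennreal (min (q j) \<eta>)) \<le> ennreal \<epsilon>"
proof -
  obtain N where "\<forall>n\<ge>N. norm (\<Sum>i. q (i + n)) < \<epsilon> / 2"
    using suminf_exist_split[of "\<epsilon> / 2" q] assms by auto
  then have N: "(\<Sum>i. q (i + N)) < \<epsilon> / 2" by (metis abs_ge_self order_le_less_trans order_refl real_norm_def)
  \<comment> \<open>\<open>Suc N\<close> rather than \<open>N\<close>, since the initial segment may
    be empty.\<close>
  define \<eta>\<^sub>0 where "\<eta>\<^sub>0 = \<epsilon> / (2 * real (Suc N))"
  have "0 < \<eta>\<^sub>0" using \<open>0 < \<epsilon>\<close> by (simp add: \<eta>\<^sub>0_def)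
  moreover have "(\<Sum>j. ennreal (min (q j) \<eta>)) \<le> ennreal \<epsilon>" if \<eta>: "0 < \<eta>" "\<eta> \<le> \<eta>\<^sub>0" for \<eta>
  proof -
    have sm: "summable (\<lambda>j. min (q j) \<eta>)"
      by (rule summable_comparison_test'[OF assms(2), of 0]) (use assms(1) \<eta> in auto)
    have "(\<Sum>j. min (q j) \<eta>) = (\<Sum>j. min (q (j + N)) \<eta>) + (\<Sum>j<N. min (q j) \<eta>)"
      by (rule suminf_split_initial_segment[OF sm])
    also have "(\<Sum>j. min (q (j + N)) \<eta>) \<le> (\<Sum>j. q (j + N))"
      using sm assms(2) by (intro suminf_le) (auto simp: summable_iff_shift[of "\<lambda>j. min (q j) \<eta>"] summable_iff_shift[of q])
    also have "(\<Sum>j<N. min (q j) \<eta>) \<le> (\<Sum>j<N. \<eta>\<^sub>0)" using \<eta> by (intro sum_mono) auto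
    also have "(\<Sum>j<N. \<eta>\<^sub>0) \<le> \<epsilon> / 2" using \<open>0 < \<epsilon>\<close> by (simp add: \<eta>\<^sub>0_def field_simps)
    finally have "(\<Sum>j. min (q j) \<eta>) \<le> \<epsilon>" using N by linarith
    moreover have "(\<Sum>j. ennreal (min (q j) \<eta>)) = ennreal (\<Sum>j. min (q j) \<eta>)"
      by (rule suminf_ennreal2[OF _ sm]) (use assms(1) \<eta> in auto)
    ultimately show ?thesis by (simp add: ennreal_leI)
  qed
  ultimately show ?thesis using that by blast
qed

text \<open>A bound uniform in \<open>\<eta>\<close> survives the limit, because summability makes
  both truncated sums tend to 0.\<close>

lemma rigged_dist_le_if_collapsed:
  assumes m1: "m1 1 = \<infinity>" "\<And>z. m1 z \<noteq> 0 \<Longrightarrow> cmod z = 1" and m2: "m2 1 = \<infinity>" "\<And>z. m2 z \<noteq> 0 \<Longrightarrow> cmod z = 1"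
    and s: "enumeration_of m1 s" "summable (\<lambda>j. arcdist (s j) 1)"
    and t: "enumeration_of m2 t" "summable (\<lambda>j. arcdist (t j) 1)"
    and K: "\<And>\<eta>. 0 < \<eta> \<Longrightarrow> rdist (collapsed_dist \<eta>) m1 m2 \<le> K"
  shows "rigged_dist m1 m2 \<le> K"
proof (rule ennreal_le_epsilon)
  fix \<epsilon> :: real assume "0 < \<epsilon>"
  then have "0 < \<epsilon> / 2" by simp
  obtain a where a: "0 < a" "\<And>\<eta>. 0 < \<eta> \<Longrightarrow> \<eta> \<le> a \<Longrightarrow> (\<Sum>j. ennreal (min (arcdist (s j) 1) \<eta>)) \<le> ennreal (\<epsilon> / 2)"
    using suminf_min_small[OF arcdist_nonneg s(2) \<open>0 < \<epsilon> / 2\<close>] by blast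
  obtain b where b: "0 < b" "\<And>\<eta>. 0 < \<eta> \<Longrightarrow> \<eta> \<le> b \<Longrightarrow> (\<Sum>j. ennreal (min (arcdist (t j) 1) \<eta>)) \<le> ennreal (\<epsilon> / 2)"
    using suminf_min_small[OF arcdist_nonneg t(2) \<open>0 < \<epsilon> / 2\<close>] by blast
  have ab: "0 < min a b" using a(1) b(1) by simp
  have "rigged_dist m1 m2 \<le> rdist (collapsed_dist (min a b)) m1 m2 +
    ((\<Sum>j. ennreal (min (arcdist (s j) 1) (min a b))) + (\<Sum>j. ennreal (min (arcdist (t j) 1) (min a b))))"
    by (rule rigged_dist_le_collapsed[OF m1 m2 s(1) t(1) ab])
  also have "\<dots> \<le> K + (ennreal (\<epsilon> / 2) + ennreal (\<epsilon> / 2))"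
    by (intro add_mono K a(2) b(2) ab) auto
  also have "ennreal (\<epsilon> / 2) + ennreal (\<epsilon> / 2) = ennreal \<epsilon>"
    using \<open>0 < \<epsilon>\<close> by (simp flip: ennreal_plus)
  finally show "rigged_dist m1 m2 \<le> K + ennreal \<epsilon>" .
qed

section \<open>Perturbation of the spectrum\<close>

text \<open>An approximate eigenvector for \<open>w\<close> concentrates on the members indexed by
  \<open>J\<close>. Decompose the residual \<open>U x - w x\<close> along \<open>f\<close> and its
  complement: outside \<open>J\<close> each coefficient of \<open>x\<close> is multiplied by at
  least \<open>\<gamma>\<close>, and on the complement \<open>U\<close> is so close to the identity
  that \<open>U - w\<close> is bounded below by \<open>\<gamma>\<close> as well. Bessel's identity
  adds the squares.\<close>

lemma residual_lower_bound:
  fixes n :: nat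
  assumes U: "unitary_op U" and f: "orthonormal_on {..<n} f" "\<And>i. i < n \<Longrightarrow> U (f i) = z i *\<^sub>C f i"
    and rest: "\<And>y. (\<And>i. i < n \<Longrightarrow> cinner (f i) y = 0) \<Longrightarrow> norm (U y - y) \<le> c * norm y"
    and J: "J \<subseteq> {..<n}" "\<And>i. i < n \<Longrightarrow> i \<notin> J \<Longrightarrow> \<gamma> \<le> cmod (z i - w)"
    and \<gamma>: "0 \<le> \<gamma>" "\<gamma> \<le> cmod (w - 1) - c"
  shows "\<gamma>\<^sup>2 * ((norm x)\<^sup>2 - (\<Sum>i\<in>J. (cmod (cinner (f i) x))\<^sup>2)) \<le> (norm (U x - w *\<^sub>C x))\<^sup>2"
proof -
  note lin = clinearD[OF unitary_clinear[OF U]]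
  define a where "a = (\<lambda>i. cinner (f i) x)"
  define y where "y = proj_compl {..<n} f x"
  define v where "v = U x - w *\<^sub>C x"
  have coeff: "cinner (f i) v = (z i - w) * a i" if "i < n" for i
    using cinner_eigenvector[OF U f(2)[OF that]]
    by (simp add: v_def a_def cinner_diff_right cinner_scaleC_right left_diff_distrib)
  have "U y = U x - (\<Sum>i<n. a i *\<^sub>C U (f i))"
    by (simp add: y_def a_def proj_compl_def lin clinear_sum[OF unitary_clinear[OF U]])
  also have "(\<Sum>i<n. a i *\<^sub>C U (f i)) = (\<Sum>i<n. (a i * z i) *\<^sub>C f i)"
    by (rule sum.cong) (simp_all add: f(2) scaleC_scaleC)
  finally have Uy: "U y = U x - (\<Sum>i<n. (a i * z i) *\<^sub>C f i)" .
  have "w *\<^sub>C y = w *\<^sub>C x - (\<Sum>i<n. (a i * w) *\<^sub>C f i)"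
    by (simp add: y_def a_def proj_compl_def scaleC_diff_right scaleC_sum_right scaleC_scaleC mult.commute)
  then have "U y - w *\<^sub>C y = v - ((\<Sum>i<n. (a i * z i) *\<^sub>C f i) - (\<Sum>i<n. (a i * w) *\<^sub>C f i))"
    unfolding Uy by (simp add: v_def)
  also have "(\<Sum>i<n. (a i * z i) *\<^sub>C f i) - (\<Sum>i<n. (a i * w) *\<^sub>C f i) = (\<Sum>i<n. cinner (f i) v *\<^sub>C f i)"
    unfolding sum_subtractf[symmetric]
    by (rule sum.cong) (simp_all add: coeff algebra_simps flip: scaleC_diff_left)
  finally have pv: "U y - w *\<^sub>C y = proj_compl {..<n} f v" by (simp add: proj_compl_def)
  have "cmod (w - 1) * norm y \<le> norm (U y - w *\<^sub>C y) + norm (U y - y)"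
  proof -
    have "(w - 1) *\<^sub>C y = (U y - y) - (U y - w *\<^sub>C y)" by (simp add: scaleC_diff_left scaleC_one)
    then show ?thesis using norm_triangle_ineq4[of "U y - y" "U y - w *\<^sub>C y"] by (simp flip: norm_scaleC)
  qed
  moreover have "norm (U y - y) \<le> c * norm y"
    by (rule rest) (simp add: y_def cinner_proj_compl[OF f(1)])
  moreover have "\<gamma> * norm y \<le> (cmod (w - 1) - c) * norm y" using \<gamma> by (intro mult_right_mono) auto
  ultimately have "\<gamma> * norm y \<le> norm (U y - w *\<^sub>C y)" by (simp add: left_diff_distrib)
  then have y: "\<gamma>\<^sup>2 * (norm y)\<^sup>2 \<le> (norm (U y - w *\<^sub>C y))\<^sup>2"
    using \<gamma> power_mono[of "\<gamma> * norm y" _ 2] by (simp add: power_mult_distrib)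
  have "\<gamma>\<^sup>2 * (\<Sum>i\<in>{..<n} - J. (cmod (a i))\<^sup>2) \<le> (\<Sum>i\<in>{..<n} - J. (cmod (cinner (f i) v))\<^sup>2)"
    unfolding sum_distrib_left
  proof (rule sum_mono)
    fix i assume i: "i \<in> {..<n} - J"
    then have "\<gamma>\<^sup>2 \<le> (cmod (z i - w))\<^sup>2" using J(2) \<gamma>(1) by (intro power_mono) auto
    from mult_right_mono[OF this, of "(cmod (a i))\<^sup>2"]
    show "\<gamma>\<^sup>2 * (cmod (a i))\<^sup>2 \<le> (cmod (cinner (f i) v))\<^sup>2"
      using i by (simp add: coeff norm_mult power_mult_distrib)
  qed
  also have "\<dots> \<le> (\<Sum>i<n. (cmod (cinner (f i) v))\<^sup>2)" by (rule sum_mono2) auto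
  finally have "\<gamma>\<^sup>2 * (\<Sum>i\<in>{..<n} - J. (cmod (a i))\<^sup>2) + \<gamma>\<^sup>2 * (norm y)\<^sup>2 \<le> (norm v)\<^sup>2"
    using y unfolding pv using bessel_identity[OF f(1), of v] by simp
  moreover have "(\<Sum>i<n. (cmod (a i))\<^sup>2) = (\<Sum>i\<in>{..<n} - J. (cmod (a i))\<^sup>2) + (\<Sum>i\<in>J. (cmod (a i))\<^sup>2)"
    using J(1) by (intro sum.subset_diff) auto
  then have "(norm x)\<^sup>2 - (\<Sum>i\<in>J. (cmod (a i))\<^sup>2) = (\<Sum>i\<in>{..<n} - J. (cmod (a i))\<^sup>2) + (norm y)\<^sup>2"
    using bessel_identity[OF f(1), of x] by (simp add: a_def y_def)
  ultimately show ?thesis by (simp add: v_def a_def distrib_left)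
qed

text \<open>The component of \<open>x\<close> in the span of the eigenvectors is annihilated by
  \<open>U - w\<close> and, by normality, is orthogonal to the range of \<open>U - w\<close>. Both
  slots of the inner product thus see only the remainder \<open>g\<close>, which makes the error
  quadratic in \<open>g\<close>.\<close>

lemma rayleigh_quotient_error:
  assumes U: "unitary_op U" and J: "finite J" "orthonormal_on J e" "\<And>i. i \<in> J \<Longrightarrow> U (e i) = w *\<^sub>C e i"
    and w: "cmod w = 1"
  shows "cmod (cinner x (U x - w *\<^sub>C x)) \<le> 2 * ((norm x)\<^sup>2 - (\<Sum>i\<in>J. (cmod (cinner (e i) x))\<^sup>2))"
proof -
  note lin = clinearD[OF unitary_clinear[OF U]]
  define g where "g = proj_compl J e x"
  define p where "p = (\<Sum>i\<in>J. cinner (e i) x *\<^sub>C e i)"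
  have x: "x = p + g" by (simp add: g_def p_def proj_compl_def)
  have "U p = (\<Sum>i\<in>J. w *\<^sub>C (cinner (e i) x *\<^sub>C e i))"
    unfolding p_def clinear_sum[OF unitary_clinear[OF U]]
    by (rule sum.cong) (simp_all add: lin J(3) scaleC_scaleC mult.commute)
  then have "U p = w *\<^sub>C p" by (simp add: p_def scaleC_sum_right)
  then have Ux: "U x - w *\<^sub>C x = U g - w *\<^sub>C g"
    unfolding x lin by (simp add: scaleC_add_right)
  have "cinner (e i) (U g - w *\<^sub>C g) = 0" if "i \<in> J" for i
    using cinner_eigenvector[OF U J(3)[OF that], of g]
    by (simp add: cinner_diff_right cinner_scaleC_right)
  then have "cinner p (U g - w *\<^sub>C g) = 0"
    by (simp add: p_def cinner_sum_left cinner_scaleC_left)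
  then have "cinner x (U x - w *\<^sub>C x) = cinner g (U g - w *\<^sub>C g)"
    unfolding Ux by (subst x) (simp add: cinner_add_left)
  also have "cmod \<dots> \<le> norm g * norm (U g - w *\<^sub>C g)" by (rule cauchy_schwarz)
  also have "\<dots> \<le> norm g * (norm g + norm g)"
    using norm_triangle_ineq4[of "U g" "w *\<^sub>C g"] w
    by (intro mult_left_mono) (auto simp: unitary_norm[OF U] norm_scaleC)
  also have "\<dots> = 2 * (norm g)\<^sup>2" by (simp add: power2_eq_square)
  also have "(norm g)\<^sup>2 = (norm x)\<^sup>2 - (\<Sum>i\<in>J. (cmod (cinner (e i) x))\<^sup>2)"
    using bessel_identity[OF J(2,1), of x] by (simp add: g_def)
  finally show ?thesis .
qed

text \<open>Integers with \<open>a \<ge> b + 1\<close> cannot satisfy the first inequality once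
  \<open>\<tau>\<close> is below \<open>1 / (n + 1)\<close>. The disjunction lets the count known to
  be at most \<open>n\<close> stand on either side.\<close>

lemma card_le_from_count:
  assumes "real a * (1 - \<tau>) \<le> real b" "\<tau> * real (Suc n) < 1" "0 \<le> \<tau>" "b \<le> n \<or> a \<le> n"
  shows "a \<le> b"
proof (rule ccontr)
  assume "\<not> a \<le> b"
  then have ab: "real b + 1 \<le> real a" by simp
  have "\<tau> \<le> 1"
    using assms(2,3) mult_left_mono[of 1 "real (Suc n)" \<tau>] by simp
  show False
  proof (cases "a \<le> n")
    case True
    then have "\<tau> * real a \<le> \<tau> * real (Suc n)" using assms(3) by (intro mult_left_mono) auto
    then show False using assms(1,2) ab by (simp add: right_diff_distrib mult.commute)
  next
    case False
    then have "b \<le> n" using assms(4) by simp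
    have "(real b + 1) * (1 - \<tau>) \<le> real a * (1 - \<tau>)" using ab \<open>\<tau> \<le> 1\<close> by (intro mult_right_mono) auto
    moreover have "\<tau> * (real b + 1) \<le> \<tau> * real (Suc n)" using \<open>b \<le> n\<close> assms(3) by (intro mult_left_mono) auto
    ultimately show False using assms(1,2) by (simp add: algebra_simps)
  qed
qed

text \<open>Only finitely many eigenvalues have distance at least \<open>r / 2\<close> from 1, so
  some radius \<open>c\<close> between \<open>r / 2\<close> and \<open>r\<close> avoids all these
  distances. The empty margin around \<open>c\<close> prevents a small perturbation from moving an
  eigenvalue across the threshold.\<close>

lemma spectral_gap_family:
  fixes U :: "'a::chilbert_space \<Rightarrow> 'a"
  assumes U: "U \<in> unitary1" and "0 < r"
  obtains c \<gamma> n e \<zeta> where "0 < \<gamma>" "\<gamma> < c" "c < r" "eigenfamily U (c - \<gamma>) n e \<zeta>"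
    "\<And>l. l < n \<Longrightarrow> c + \<gamma> \<le> cmod (\<zeta> l - 1)"
proof -
  obtain n0 and e0 :: "nat \<Rightarrow> 'a" and z0 where e0: "eigenfamily U (r / 2) n0 e0 z0"
    using eigenfamily_exists[OF U, of "r / 2"] \<open>0 < r\<close> by auto
  have "infinite ({r / 2<..<r} - (\<lambda>i. cmod (z0 i - 1)) ` {..<n0})"
    using \<open>0 < r\<close> by (intro Diff_infinite_finite) (auto simp: infinite_Ioo)
  then obtain c where c: "r / 2 < c" "c < r" "\<And>i. i < n0 \<Longrightarrow> cmod (z0 i - 1) \<noteq> c"
    by (metis (no_types, lifting) DiffE finite.emptyI greaterThanLessThan_iff image_eqI lessThan_iff subsetI
        finite_subset)
  obtain \<gamma>1 where \<gamma>1: "0 < \<gamma>1" "\<And>i. i \<in> {..<n0} \<Longrightarrow> \<gamma>1 \<le> \<bar>cmod (z0 i - 1) - c\<bar>"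
    using finite_positive_lower_bound[of "{..<n0}" "\<lambda>i. \<bar>cmod (z0 i - 1) - c\<bar>"] c(3) by auto
  define \<gamma> where "\<gamma> = min (\<gamma>1 / 2) ((c - r / 2) / 2)"
  have \<gamma>: "0 < \<gamma>" "\<gamma> < \<gamma>1" "\<gamma> < c - r / 2" using \<gamma>1 c(1) by (auto simp: \<gamma>_def min_def)
  then have "0 < c - \<gamma>" using \<open>0 < r\<close> by linarith
  obtain n and e :: "nat \<Rightarrow> 'a" and \<zeta> where e: "eigenfamily U (c - \<gamma>) n e \<zeta>"
    using eigenfamily_exists[OF U \<open>0 < c - \<gamma>\<close>] by blast
  have "c + \<gamma> \<le> cmod (\<zeta> l - 1)" if l: "l < n" for l
  proof -
    have far: "c - \<gamma> \<le> cmod (\<zeta> l - 1)" by (rule eigenfamilyD(3)[OF e l])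
    then have far': "r / 2 \<le> cmod (\<zeta> l - 1)" using \<gamma>(3) by linarith
    \<comment> \<open>Both families compute the multiplicity of \<open>\<zeta> l\<close> in the
      spectrum, so it occurs among the values \<open>z0\<close> that \<open>c\<close> was chosen to
      avoid.\<close>
    have "finite {i. i < n \<and> \<zeta> i = \<zeta> l}" by simp
    then have "card {i. i < n \<and> \<zeta> i = \<zeta> l} \<noteq> 0" using l by (auto simp: card_eq_0_iff)
    then have "card {i. i < n0 \<and> z0 i = \<zeta> l} \<noteq> 0"
      using spec_eq_card[OF U e \<open>0 < c - \<gamma>\<close> far] spec_eq_card[OF U e0 _ far'] \<open>0 < r\<close> by simp
    then have "{i. i < n0 \<and> z0 i = \<zeta> l} \<noteq> {}" by (metis card.empty)
    then obtain i where "i < n0" "z0 i = \<zeta> l" by blast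
    then have "\<gamma>1 \<le> \<bar>cmod (\<zeta> l - 1) - c\<bar>" using \<gamma>1(2)[of i] by simp
    then show ?thesis using far \<gamma> by (auto simp: abs_if split: if_splits)
  qed
  with \<gamma> c(2) e \<open>0 < c - \<gamma>\<close> show ?thesis by (intro that[of \<gamma> c n e \<zeta>]) auto
qed

text \<open>The three demands on the perturbation: every visible eigenvalue finds a partner within
  \<open>\<gamma>\<close>; the defect \<open>\<delta>\<^sup>2 / \<gamma>\<^sup>2\<close> is small
  enough for counting; and the arc-to-chord correction together with \<open>n\<close> quadratic
  errors stays below \<open>1 + \<epsilon>\<close>.\<close>

lemma eventually_small_constants:
  fixes n :: nat and \<gamma> :: real
  assumes "0 < \<gamma>" "0 < \<epsilon>"
  obtains \<delta>\<^sub>0 where "0 < \<delta>\<^sub>0"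
    "\<And>\<delta>. 0 \<le> \<delta> \<Longrightarrow> \<delta> < \<delta>\<^sub>0 \<Longrightarrow> \<delta> < \<gamma> \<and> \<delta>\<^sup>2 / \<gamma>\<^sup>2 * real (Suc n) < 1 \<and>
      (1 + 2 * (\<delta> + 2 * (\<delta>\<^sup>2 / \<gamma>\<^sup>2))\<^sup>2) * (1 + real n * (2 * (\<delta> / \<gamma>\<^sup>2))) < 1 + \<epsilon>"
proof -
  have id: "((\<lambda>\<delta>::real. \<delta>) \<longlongrightarrow> 0) (nhds 0)" by (rule filterlim_ident)
  have l2: "((\<lambda>\<delta>::real. \<delta>\<^sup>2 / \<gamma>\<^sup>2 * real (Suc n)) \<longlongrightarrow> 0\<^sup>2 / \<gamma>\<^sup>2 * real (Suc n)) (nhds 0)"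
    using assms by (intro tendsto_intros id) auto
  have l3: "((\<lambda>\<delta>::real. (1 + 2 * (\<delta> + 2 * (\<delta>\<^sup>2 / \<gamma>\<^sup>2))\<^sup>2) * (1 + real n * (2 * (\<delta> / \<gamma>\<^sup>2))))
      \<longlongrightarrow> (1 + 2 * (0 + 2 * (0\<^sup>2 / \<gamma>\<^sup>2))\<^sup>2) * (1 + real n * (2 * (0 / \<gamma>\<^sup>2)))) (nhds 0)"
    using assms by (intro tendsto_intros id) auto
  have "\<forall>\<^sub>F \<delta> in nhds 0. \<delta> < \<gamma> \<and> \<delta>\<^sup>2 / \<gamma>\<^sup>2 * real (Suc n) < 1 \<and>
      (1 + 2 * (\<delta> + 2 * (\<delta>\<^sup>2 / \<gamma>\<^sup>2))\<^sup>2) * (1 + real n * (2 * (\<delta> / \<gamma>\<^sup>2))) < 1 + \<epsilon>"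
    using assms
    by (intro eventually_conj order_tendstoD(2)[OF id] order_tendstoD(2)[OF l2] order_tendstoD(2)[OF l3]) auto
  then obtain d where d: "0 < d" and H: "\<And>\<delta>. dist \<delta> 0 < d \<Longrightarrow> \<delta> < \<gamma> \<and> \<delta>\<^sup>2 / \<gamma>\<^sup>2 * real (Suc n) < 1 \<and>
      (1 + 2 * (\<delta> + 2 * (\<delta>\<^sup>2 / \<gamma>\<^sup>2))\<^sup>2) * (1 + real n * (2 * (\<delta> / \<gamma>\<^sup>2))) < 1 + \<epsilon>"
    unfolding eventually_nhds_metric by blast
  show ?thesis
    by (rule that[OF d], rule H) simp
qed

text \<open>The constant \<open>1 + \<epsilon>\<close> is attainable because \<open>\<gamma>\<close>
  and \<open>n\<close>, hence also \<open>\<delta>\<^sub>0\<close>, are fixed by \<open>U\<close>,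
  \<open>\<eta>\<close> and \<open>\<epsilon>\<close> before \<open>V\<close> is given. Eigenvalues
  of \<open>V\<close> at distance at least \<open>c\<close> from 1 are paired with those of
  \<open>U\<close>, and all others lie in the collapsed arc.\<close>

lemma spec_local_estimate:
  fixes U :: "'a::chilbert_space \<Rightarrow> 'a"
  assumes U: "U \<in> unitary1" and "0 < \<eta>" "0 < \<epsilon>"
  obtains \<delta>\<^sub>0 where "0 < \<delta>\<^sub>0"
    "\<And>V \<delta>. V \<in> unitary1 \<Longrightarrow> 0 \<le> \<delta> \<Longrightarrow> \<delta> < \<delta>\<^sub>0 \<Longrightarrow> trace_norm (\<lambda>x. V x - U x) \<le> ennreal \<delta> \<Longrightarrow>
      rdist (collapsed_dist \<eta>) (spec U) (spec V) \<le> ennreal ((1 + \<epsilon>) * \<delta>)"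
proof -
  note unU = unitary1D(1)[OF U]
  note linU = clinearD[OF unitary_clinear[OF unU]]
  \<comment> \<open>Arc length is at most three times the chord, so points at chordal distance less
    than \<open>c < \<eta> / 3\<close> from 1 have excess 0.\<close>
  have "0 < \<eta> / 3" using \<open>0 < \<eta>\<close> by simp
  obtain c \<gamma>1 n and e :: "nat \<Rightarrow> 'a" and \<zeta> where \<gamma>1: "0 < \<gamma>1" "\<gamma>1 < c" and c: "c < \<eta> / 3"
    and e: "eigenfamily U (c - \<gamma>1) n e \<zeta>" and gap: "\<And>l. l < n \<Longrightarrow> c + \<gamma>1 \<le> cmod (\<zeta> l - 1)"
    by (rule spectral_gap_family[OF U \<open>0 < \<eta> / 3\<close>]) (rule that; assumption | simp)
  define Z where "Z = \<zeta> ` {..<n}"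
  obtain \<gamma>2 where \<gamma>2: "0 < \<gamma>2" "\<And>p. p \<in> {p \<in> Z \<times> Z. fst p \<noteq> snd p} \<Longrightarrow> \<gamma>2 \<le> cmod (fst p - snd p)"
    using finite_positive_lower_bound[of "{p \<in> Z \<times> Z. fst p \<noteq> snd p}" "\<lambda>p. cmod (fst p - snd p)"]
    by (auto simp: Z_def)
  \<comment> \<open>Half the least separation in \<open>Z\<close>: a point within
    \<open>\<gamma>\<close> of one value in \<open>Z\<close> is at least \<open>\<gamma>\<close>
    away from every other.\<close>
  define \<gamma> where "\<gamma> = min \<gamma>1 (\<gamma>2 / 2)"
  have \<gamma>: "0 < \<gamma>" "\<gamma> \<le> \<gamma>1" "2 * \<gamma> \<le> \<gamma>2" using \<gamma>1 \<gamma>2(1) by (auto simp: \<gamma>_def)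
  have sep: "2 * \<gamma> \<le> cmod (v - v')" if "v \<in> Z" "v' \<in> Z" "v \<noteq> v'" for v v'
    using \<gamma>2(2)[of "(v, v')"] \<gamma>(3) that by auto
  have Z1: "cmod v = 1" if "v \<in> Z" for v
    using that cmod_eigenvalue[OF unU eigenfamilyD(2)[OF e]] orthonormal_on_norm[OF eigenfamilyD(1)[OF e]]
    by (force simp: Z_def)
  have restU: "norm (U y - y) \<le> (c - \<gamma>1) * norm y" if "\<And>i. i < n \<Longrightarrow> cinner (e i) y = 0" for y
    by (rule eigenfamily_orthogonal_bound[OF U e]) (use \<gamma>1 that in auto)
  obtain \<delta>\<^sub>0 where "0 < \<delta>\<^sub>0" and \<delta>\<^sub>0: "\<And>\<delta>. 0 \<le> \<delta> \<Longrightarrow> \<delta> < \<delta>\<^sub>0 \<Longrightarrow> \<delta> < \<gamma> \<and> \<delta>\<^sup>2 / \<gamma>\<^sup>2 * real (Suc n) < 1 \<and>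
      (1 + 2 * (\<delta> + 2 * (\<delta>\<^sup>2 / \<gamma>\<^sup>2))\<^sup>2) * (1 + real n * (2 * (\<delta> / \<gamma>\<^sup>2))) < 1 + \<epsilon>"
    using eventually_small_constants[OF \<gamma>(1) \<open>0 < \<epsilon>\<close>, of n] by blast
  have "rdist (collapsed_dist \<eta>) (spec U) (spec V) \<le> ennreal ((1 + \<epsilon>) * \<delta>)"
    if V: "V \<in> unitary1" and \<delta>: "0 \<le> \<delta>" "\<delta> < \<delta>\<^sub>0" and near: "trace_norm (\<lambda>x. V x - U x) \<le> ennreal \<delta>"
    for V :: "'a \<Rightarrow> 'a" and \<delta>
  proof -
    note unV = unitary1D(1)[OF V]
    note linV = clinearD[OF unitary_clinear[OF unV]]
    define \<tau> where "\<tau> = \<delta>\<^sup>2 / \<gamma>\<^sup>2"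
    have small: "\<delta> < \<gamma>" "\<tau> * real (Suc n) < 1"
      "(1 + 2 * (\<delta> + 2 * \<tau>)\<^sup>2) * (1 + real n * (2 * (\<delta> / \<gamma>\<^sup>2))) < 1 + \<epsilon>"
      using \<delta>\<^sub>0[OF \<delta>] by (simp_all add: \<tau>_def)
    have \<tau>: "0 \<le> \<tau>" by (simp add: \<tau>_def)
    have "clinear (\<lambda>x. V x - U x)"
      unfolding clinear_def by (simp add: linU linV scaleC_diff_right)
    then have D: "norm (V x - U x) \<le> \<delta> * norm x" for x
      using norm_le_trace_norm[OF _ near \<delta>(1)] by blast
    have "0 < c" using \<gamma>1 by simp
    obtain k and f :: "nat \<Rightarrow> 'a" and z where f: "eigenfamily V c k f z"
      using eigenfamily_exists[OF V \<open>0 < c\<close>] by blast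
    have restV: "norm (V y - y) \<le> c * norm y" if "\<And>i. i < k \<Longrightarrow> cinner (f i) y = 0" for y
      by (rule eigenfamily_orthogonal_bound[OF V f]) (use \<open>0 < c\<close> that in auto)
    have f1: "norm (f i) = 1" if "i < k" for i
      using orthonormal_on_norm[OF eigenfamilyD(1)[OF f]] that by simp
    have e1: "norm (e l) = 1" if "l < n" for l
      using orthonormal_on_norm[OF eigenfamilyD(1)[OF e]] that by simp
    have approx_U: "norm (U (f i) - z i *\<^sub>C f i) \<le> \<delta>" if "i < k" for i
      using D[of "f i"] f1[OF that] eigenfamilyD(2)[OF f that] by (simp add: norm_minus_commute)
    have approx_V: "norm (V (e l) - \<zeta> l *\<^sub>C e l) \<le> \<delta>" if "l < n" for l
      using D[of "e l"] e1[OF that] eigenfamilyD(2)[OF e that] by simp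
    \<comment> \<open>This is why \<open>U\<close> is cut at \<open>c - \<gamma>1\<close> and
      \<open>V\<close> at \<open>c\<close>: visible eigenvalues of \<open>V\<close> clear the
      threshold of \<open>U\<close> by \<open>\<gamma>1\<close>, while those of \<open>U\<close>
      start at \<open>c + \<gamma>1\<close> and clear the threshold of \<open>V\<close> by the same
      margin.\<close>
    have z_gap: "\<gamma> \<le> cmod (z i - 1) - (c - \<gamma>1)" if "i < k" for i
      using eigenfamilyD(3)[OF f that] \<gamma>(2) by linarith
    \<comment> \<open>Otherwise the residual bound with empty \<open>J\<close> applies to
      \<open>f i\<close> and gives \<open>\<gamma> \<le> \<delta>\<close>.\<close>
    have "\<exists>v\<in>Z. cmod (v - z i) < \<gamma>" if i: "i < k" for i
    proof (rule ccontr)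
      assume "\<not> ?thesis"
      then have "\<gamma> \<le> cmod (\<zeta> l - z i)" if "l < n" for l
        using that by (simp add: Z_def linorder_not_less)
      then have "\<gamma>\<^sup>2 * ((norm (f i))\<^sup>2 - (\<Sum>l\<in>{}. (cmod (cinner (e l) (f i)))\<^sup>2)) \<le> (norm (U (f i) - z i *\<^sub>C f i))\<^sup>2"
        using \<gamma>(1) z_gap[OF i]
        by (intro residual_lower_bound[OF unU eigenfamilyD(1,2)[OF e] restU]) auto
      also have "\<dots> \<le> \<delta>\<^sup>2" using approx_U[OF i] by (intro power_mono) auto
      finally have "\<gamma>\<^sup>2 \<le> \<delta>\<^sup>2" using f1[OF i] by simp
      then show False using small(1) \<gamma>(1) \<delta>(1) by (simp add: power_mono_iff)
    qed
    then obtain w where wZ: "\<And>i. i < k \<Longrightarrow> w i \<in> Z" and wz: "\<And>i. i < k \<Longrightarrow> cmod (w i - z i) < \<gamma>"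
      by metis
    have far: "\<gamma> \<le> cmod (v - z i)" if "i < k" "v \<in> Z" "v \<noteq> w i" for v i
      using sep[OF that(2) wZ[OF that(1)] that(3)] wz[OF that(1)]
        norm_triangle_ineq4[of "v - z i" "w i - z i"] by simp
    define A where "A = (\<lambda>v. {i. i < k \<and> w i = v})"
    define B where "B = (\<lambda>v. {l. l < n \<and> \<zeta> l = v})"
    have A_orth: "orthonormal_on (A v) f" "finite (A v)" and B_orth: "orthonormal_on (B v) e" "finite (B v)" for v
      using orthonormal_on_subset[OF eigenfamilyD(1)[OF f], of "A v"] orthonormal_on_subset[OF eigenfamilyD(1)[OF e], of "B v"]
      by (auto simp: A_def B_def)
    \<comment> \<open>Concentration in both directions: \<open>f i\<close> is nearly in the
      eigenspace of \<open>U\<close> for \<open>w i\<close>, and in \<open>conc_V\<close> an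
      eigenvector of \<open>U\<close> is nearly in the span of the cluster of \<open>V\<close>
      assigned to its eigenvalue.\<close>
    have conc_U: "1 - \<tau> \<le> (\<Sum>l\<in>B (w i). (cmod (cinner (e l) (f i)))\<^sup>2)" if i: "i < k" for i
    proof -
      have "\<gamma>\<^sup>2 * ((norm (f i))\<^sup>2 - (\<Sum>l\<in>B (w i). (cmod (cinner (e l) (f i)))\<^sup>2)) \<le> (norm (U (f i) - z i *\<^sub>C f i))\<^sup>2"
        using \<gamma>(1) z_gap[OF i] far[OF i]
        by (intro residual_lower_bound[OF unU eigenfamilyD(1,2)[OF e] restU]) (auto simp: B_def Z_def)
      also have "\<dots> \<le> \<delta>\<^sup>2" using approx_U[OF i] by (intro power_mono) auto
      finally show ?thesis using \<gamma>(1) f1[OF i] by (simp add: \<tau>_def field_simps)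
    qed
    have conc_V: "1 - \<tau> \<le> (\<Sum>i\<in>A v. (cmod (cinner (f i) (e l)))\<^sup>2)" if l: "l \<in> B v" for l v
    proof -
      have l': "l < n" "\<zeta> l = v" using l by (auto simp: B_def)
      then have "v \<in> Z" by (auto simp: Z_def)
      have "\<gamma>\<^sup>2 * ((norm (e l))\<^sup>2 - (\<Sum>i\<in>A v. (cmod (cinner (f i) (e l)))\<^sup>2)) \<le> (norm (V (e l) - v *\<^sub>C e l))\<^sup>2"
        using \<gamma>(1,2) far[OF _ \<open>v \<in> Z\<close>] gap[OF l'(1)] l'(2)
        by (intro residual_lower_bound[OF unV eigenfamilyD(1,2)[OF f] restV])
          (auto simp: A_def norm_minus_commute)
      also have "\<dots> \<le> \<delta>\<^sup>2" using approx_V[OF l'(1)] l'(2) by (intro power_mono) auto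
      finally show ?thesis using \<gamma>(1) e1[OF l'(1)] by (simp add: \<tau>_def field_simps)
    qed
    \<comment> \<open>The number of error terms must be bounded by a quantity that does not depend
      on \<open>V\<close>.\<close>
    have "k \<le> n"
    proof (rule card_le_from_count[OF _ small(2) \<tau>])
      have "1 - \<tau> \<le> (\<Sum>l<n. (cmod (cinner (e l) (f i)))\<^sup>2)" if "i \<in> {..<k}" for i
        using conc_U[of i] that sum_mono2[of "{..<n}" "B (w i)" "\<lambda>l. (cmod (cinner (e l) (f i)))\<^sup>2"]
        by (force simp: B_def)
      from orthonormal_count[OF eigenfamilyD(1)[OF f] _ eigenfamilyD(1)[OF e] _ this]
      show "real k * (1 - \<tau>) \<le> real n" by simp
    qed simp
    \<comment> \<open>Equal cluster sizes say that the list \<open>w\<close> repeats each visible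
      eigenvalue of \<open>U\<close> exactly with its multiplicity.\<close>
    have card_eq: "card (A v) = card (B v)" for v
    proof -
      have Bn: "card (B v) \<le> n" using card_mono[of "{..<n}" "B v"] by (auto simp: B_def)
      have "1 - \<tau> \<le> (\<Sum>l\<in>B v. (cmod (cinner (e l) (f i)))\<^sup>2)" if "i \<in> A v" for i
        using conc_U[of i] that by (auto simp: A_def)
      from orthonormal_count[OF A_orth B_orth this] have 1: "real (card (A v)) * (1 - \<tau>) \<le> real (card (B v))" .
      from orthonormal_count[OF B_orth A_orth conc_V] have 2: "real (card (B v)) * (1 - \<tau>) \<le> real (card (A v))" .
      show ?thesis
        using card_le_from_count[OF 1 small(2) \<tau>] card_le_from_count[OF 2 small(2) \<tau>] Bn by auto
    qed
    define q where "q = (\<lambda>i. cmod (cinner (V (f i) - U (f i)) (f i)))"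
    have q_sum: "(\<Sum>i<k. q i) \<le> \<delta>"
      unfolding q_def
      by (rule sum_on_le_trace_norm_real[OF _ eigenfamilyD(1)[OF f] eigenfamilyD(1)[OF f] near \<delta>(1)]) simp
    have q_le: "q i \<le> \<delta>" if "i < k" for i
      using cauchy_schwarz[of "V (f i) - U (f i)" "f i"] D[of "f i"] f1[OF that] by (simp add: q_def)
    have close: "cmod (w i - z i) \<le> q i + 2 * \<tau>" if i: "i < k" for i
    proof -
      have ff: "cinner (f i) (f i) = 1" using f1[OF i] by (simp add: cinner_self)
      have "cmod (cinner (f i) (U (f i) - w i *\<^sub>C f i))
          \<le> 2 * ((norm (f i))\<^sup>2 - (\<Sum>l\<in>B (w i). (cmod (cinner (e l) (f i)))\<^sup>2))"
        by (rule rayleigh_quotient_error[OF unU B_orth(2,1)])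
          (use eigenfamilyD(2)[OF e] Z1[OF wZ[OF i]] in \<open>auto simp: B_def\<close>)
      also have "\<dots> \<le> 2 * \<tau>" using conc_U[OF i] f1[OF i] by simp
      finally have R: "cmod (cinner (f i) (U (f i) - w i *\<^sub>C f i)) \<le> 2 * \<tau>" .
      have "z i - w i = cinner (f i) (V (f i) - U (f i)) + cinner (f i) (U (f i) - w i *\<^sub>C f i)"
        using eigenfamilyD(2)[OF f i] by (simp add: cinner_diff_right cinner_scaleC_right ff)
      then have "cmod (z i - w i) \<le> q i + cmod (cinner (f i) (U (f i) - w i *\<^sub>C f i))"
        unfolding q_def cmod_cinner_commute[of "V (f i) - U (f i)"] by (metis norm_triangle_ineq)
      with R show ?thesis by (simp add: norm_minus_commute)
    qed
    have z1: "cmod (z i) = 1" if "i < k" for i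
      using cmod_eigenvalue[OF unV eigenfamilyD(2)[OF f that]] f1[OF that] by fastforce
    let ?m = "\<delta> + 2 * \<tau>"
    \<comment> \<open>The cubic term in the arc length is absorbed into a factor that is uniform in
      \<open>i\<close>, because every chord is at most \<open>?m\<close>.\<close>
    have cost: "collapsed_dist \<eta> (w i) (z i) \<le> (1 + 2 * ?m\<^sup>2) * (q i + 2 * \<tau>)" if i: "i < k" for i
    proof -
      let ?d = "cmod (w i - z i)"
      have d: "?d \<le> ?m" using close[OF i] q_le[OF i] by linarith
      have "collapsed_dist \<eta> (w i) (z i) \<le> ?d + 2 * ?d ^ 3"
        using arcdist_le_chord(2)[OF Z1[OF wZ[OF i]] z1[OF i]] by (simp add: collapsed_dist_def)
      also have "\<dots> = (1 + 2 * ?d\<^sup>2) * ?d" by (simp add: power2_eq_square power3_eq_cube algebra_simps)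
      also have "\<dots> \<le> (1 + 2 * ?m\<^sup>2) * (q i + 2 * \<tau>)"
        using power_mono[OF d, of 2] close[OF i] by (intro mult_mono) auto
      finally show ?thesis .
    qed
    have "rdist (collapsed_dist \<eta>) (spec U) (spec V) \<le> ennreal (\<Sum>i<k. collapsed_dist \<eta> (w i) (z i))"
    proof (rule rdist_le_list[where r = c])
      show "collapsed_dist \<eta> x y = 0" if "spec U x \<noteq> 0" "spec V y \<noteq> 0" "cmod (x - 1) < c" "cmod (y - 1) < c" for x y
      proof -
        have "arcdist x 1 \<le> \<eta>" "arcdist y 1 \<le> \<eta>"
          using arcdist_le_chord(1)[of x 1] arcdist_le_chord(1)[of y 1] that(3,4) c
            spec_nonzero_cmod[OF U that(1)] spec_nonzero_cmod[OF V that(2)] by auto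
        then show ?thesis by (simp add: collapsed_dist_def arc_excess_def arcdist_nonneg)
      qed
      show "c \<le> cmod (w i - 1)" if "i < k" for i
        using wZ[OF that] gap \<gamma>1 by (force simp: Z_def)
      show "spec U v = enat (card {i. i < k \<and> w i = v})" if "c \<le> cmod (v - 1)" for v
        using spec_eq_card[OF U e, of v] card_eq[of v] that \<gamma>1 by (simp add: A_def B_def)
      show "spec V v = enat (card {i. i < k \<and> z i = v})" if "c \<le> cmod (v - 1)" for v
        using spec_eq_card[OF V f \<open>0 < c\<close> that] .
    qed (use \<open>0 < c\<close> countable_spec[OF U] countable_spec[OF V] eigenfamilyD(3)[OF f] collapsed_dist_nonneg in
        \<open>auto simp: spec_def\<close>)
    also have "(\<Sum>i<k. collapsed_dist \<eta> (w i) (z i)) \<le> (1 + \<epsilon>) * \<delta>"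
    proof -
      have "(\<Sum>i<k. collapsed_dist \<eta> (w i) (z i)) \<le> (\<Sum>i<k. (1 + 2 * ?m\<^sup>2) * (q i + 2 * \<tau>))"
        by (rule sum_mono) (use cost in auto)
      also have "\<dots> = (1 + 2 * ?m\<^sup>2) * ((\<Sum>i<k. q i) + real k * (2 * \<tau>))"
        by (simp add: sum.distrib flip: sum_distrib_left)
      also have "\<dots> \<le> (1 + 2 * ?m\<^sup>2) * (\<delta> + real n * (2 * \<tau>))"
        using q_sum \<open>k \<le> n\<close> \<tau> by (intro mult_left_mono add_mono mult_right_mono) auto
      \<comment> \<open>As \<open>\<tau>\<close> is \<open>\<delta>\<close> times
        \<open>\<delta> / \<gamma>\<^sup>2\<close>, one factor \<open>\<delta>\<close> can be taken
        out of the whole sum; what remains is the third smallness condition.\<close>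
      also have "\<dots> = ((1 + 2 * ?m\<^sup>2) * (1 + real n * (2 * (\<delta> / \<gamma>\<^sup>2)))) * \<delta>"
      proof -
        have "\<delta> + real n * (2 * \<tau>) = (1 + real n * (2 * (\<delta> / \<gamma>\<^sup>2))) * \<delta>"
          by (simp add: \<tau>_def power2_eq_square distrib_right)
        then show ?thesis by (simp only: mult.assoc)
      qed
      also have "\<dots> \<le> (1 + \<epsilon>) * \<delta>" using small(3) \<delta>(1) by (intro mult_right_mono) auto
      finally show ?thesis .
    qed
    finally show ?thesis by (simp add: ennreal_leI)
  qed
  then show ?thesis using that \<open>0 < \<delta>\<^sub>0\<close> by blast
qed

section \<open>Derivatives in trace norm\<close>

lemma trace_norm_zero: "trace_norm (\<lambda>x. 0) = 0"
proof -
  have "trace_norm (\<lambda>x::'a. 0 :: 'a) \<le> 0" by (rule trace_norm_least) simp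
  then show ?thesis by simp
qed

lemma trace_norm_scaleR_eq:
  assumes "r \<noteq> 0" shows "trace_norm (\<lambda>x. r *\<^sub>R A x) = ennreal \<bar>r\<bar> * trace_norm A"
proof (rule antisym[OF trace_norm_scaleR])
  have "trace_norm A = trace_norm (\<lambda>x. (1 / r) *\<^sub>R (r *\<^sub>R A x))" using assms by simp
  also have "\<dots> \<le> ennreal \<bar>1 / r\<bar> * trace_norm (\<lambda>x. r *\<^sub>R A x)" by (rule trace_norm_scaleR)
  finally have "ennreal \<bar>r\<bar> * trace_norm A \<le> ennreal \<bar>r\<bar> * (ennreal \<bar>1 / r\<bar> * trace_norm (\<lambda>x. r *\<^sub>R A x))"
    by (intro mult_left_mono) auto
  also have "\<dots> = ennreal (\<bar>r\<bar> * \<bar>1 / r\<bar>) * trace_norm (\<lambda>x. r *\<^sub>R A x)"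
    unfolding mult.assoc[symmetric] by (subst ennreal_mult[symmetric]) simp_all
  finally show "ennreal \<bar>r\<bar> * trace_norm A \<le> trace_norm (\<lambda>x. r *\<^sub>R A x)"
    using assms by (simp add: abs_mult[symmetric])
qed

lemma trace_norm_diff: "trace_norm (\<lambda>x. A x - B x) \<le> trace_norm A + trace_norm B"
proof -
  have "trace_norm (\<lambda>x. A x + (- 1) *\<^sub>R B x) \<le> trace_norm A + trace_norm (\<lambda>x. (- 1) *\<^sub>R B x)"
    by (rule trace_norm_add)
  also have "trace_norm (\<lambda>x. (- 1) *\<^sub>R B x) = trace_norm B" by (subst trace_norm_scaleR_eq) simp_all
  finally show ?thesis by simp
qed

lemma trace_norm_sum:
  "trace_norm (\<lambda>x. \<Sum>n\<in>I. F n x) \<le> (\<Sum>n\<in>I. trace_norm (F n))"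
proof (induction I rule: infinite_finite_induct)
  case (insert j I)
  have "trace_norm (\<lambda>x. F j x + (\<Sum>n\<in>I. F n x)) \<le> trace_norm (F j) + trace_norm (\<lambda>x. \<Sum>n\<in>I. F n x)"
    by (rule trace_norm_add)
  also have "\<dots> \<le> trace_norm (F j) + (\<Sum>n\<in>I. trace_norm (F n))" by (intro add_left_mono insert.IH)
  finally show ?case using insert.hyps by simp
qed (simp_all add: trace_norm_zero)

text \<open>Abel's argument: each term is the difference of two consecutive remainders, and these
  tend to 0, so the terms are bounded from some index on. The finitely many earlier ones are added
  into \<open>B\<close>.\<close>

lemma trace_norm_series_coeff_bound:
  fixes A :: "nat \<Rightarrow> 'a::chilbert_space \<Rightarrow> 'a"
  assumes A: "\<And>n. trace_class (A n)" and h: "h \<noteq> 0"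
    and lim: "(\<lambda>N. trace_norm (\<lambda>x. G x - (\<Sum>n<N. h ^ Suc n *\<^sub>R A n x))) \<longlonglongrightarrow> 0"
  obtains B where "0 \<le> B" "\<And>n. trace_norm (A n) \<le> ennreal (B / \<bar>h\<bar> ^ Suc n)"
proof -
  define R where "R = (\<lambda>N x. G x - (\<Sum>n<N. h ^ Suc n *\<^sub>R A n x))"
  define a where "a = (\<lambda>n. enn2real (trace_norm (A n)))"
  have a: "trace_norm (A n) = ennreal (a n)" "0 \<le> a n" for n
    using A[of n] by (auto simp: a_def trace_class_def)
  have "\<forall>\<^sub>F N in sequentially. trace_norm (R N) < 1"
    using order_tendstoD(2)[OF lim, of 1] by (simp add: R_def)
  then obtain N0 where N0: "\<And>N. N \<ge> N0 \<Longrightarrow> trace_norm (R N) < 1"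
    unfolding eventually_sequentially by blast
  have big: "\<bar>h\<bar> ^ Suc N * a N \<le> 2" if "N \<ge> N0" for N
  proof -
    have "ennreal (\<bar>h\<bar> ^ Suc N * a N) = trace_norm (\<lambda>x. h ^ Suc N *\<^sub>R A N x)"
      using h a[of N] by (subst trace_norm_scaleR_eq) (simp_all add: power_abs ennreal_mult abs_mult)
    also have "(\<lambda>x. h ^ Suc N *\<^sub>R A N x) = (\<lambda>x. R N x - R (Suc N) x)" by (auto simp: R_def)
    also have "trace_norm \<dots> \<le> trace_norm (R N) + trace_norm (R (Suc N))" by (rule trace_norm_diff)
    also have "\<dots> \<le> 1 + 1" using N0[of N] N0[of "Suc N"] that by (intro add_mono less_imp_le) auto
    also have "\<dots> = ennreal 2" by simp
    finally show ?thesis by (subst (asm) ennreal_le_iff) auto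
  qed
  define B where "B = 2 + (\<Sum>n<N0. \<bar>h\<bar> ^ Suc n * a n)"
  have nn: "0 \<le> \<bar>h\<bar> ^ Suc n * a n" for n using a by simp
  have "\<bar>h\<bar> ^ Suc n * a n \<le> B" for n
  proof (cases "n < N0")
    case True
    then have "\<bar>h\<bar> ^ Suc n * a n \<le> (\<Sum>n<N0. \<bar>h\<bar> ^ Suc n * a n)"
      by (intro member_le_sum nn) auto
    then show ?thesis by (simp add: B_def)
  next
    case False
    moreover have "0 \<le> (\<Sum>n<N0. \<bar>h\<bar> ^ Suc n * a n)" by (intro sum_nonneg nn)
    ultimately show ?thesis using big[of n] unfolding B_def by linarith
  qed
  then have "a n \<le> B / \<bar>h\<bar> ^ Suc n" for n
    using h by (simp add: pos_le_divide_eq mult.commute)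
  moreover have "0 \<le> B" unfolding B_def by (intro add_nonneg_nonneg sum_nonneg nn) auto
  ultimately show ?thesis using that a by (simp add: ennreal_leI)
qed

lemma geometric_tail_le:
  fixes q :: real
  assumes "0 \<le> q" "q \<le> 1 / 2"
  shows "(\<Sum>n\<in>{1..<N}. q ^ Suc n) \<le> 2 * q\<^sup>2"
proof -
  \<comment> \<open>Subtracting twice the next term makes the bound inductive.\<close>
  have *: "(\<Sum>n\<in>{1..<Suc N}. q ^ Suc n) \<le> 2 * q\<^sup>2 - 2 * q ^ (N + 2)" for N
  proof (induction N)
    case (Suc N)
    have "2 * q ^ (Suc N + 2) \<le> q ^ (N + 2)"
      using mult_right_mono[OF assms(2), of "q ^ (N + 2)"] assms(1) by simp
    moreover have "(\<Sum>n\<in>{1..<Suc (Suc N)}. q ^ Suc n) = (\<Sum>n\<in>{1..<Suc N}. q ^ Suc n) + q ^ (N + 2)"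
      by simp
    ultimately show ?case using Suc.IH by linarith
  qed (simp add: power2_eq_square)
  have "0 \<le> q ^ (N + 2)" for N using assms(1) by simp
  then have "(\<Sum>n\<in>{1..<Suc N}. q ^ Suc n) \<le> 2 * q\<^sup>2" for N
    using *[of N] by (smt (verit))
  from this[of "N - 1"] show ?thesis by (cases N) simp_all
qed

text \<open>Convergence at one point at distance \<open>h0\<close> bounds the coefficients
  geometrically. Within half that distance the terms from the quadratic one on are dominated by a
  geometric series with ratio at most one half.\<close>

lemma tn_analytic_expansion:
  fixes U :: "real \<Rightarrow> 'a::chilbert_space \<Rightarrow> 'a"
  assumes an: "tn_analytic_on U {u..v}" and "u < v" and r: "r \<in> {u..v}"
  obtains D C \<delta> where "trace_class D" "0 \<le> C" "0 < \<delta>"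
    "\<And>s. s \<in> {u..v} \<Longrightarrow> \<bar>s - r\<bar> < \<delta> \<Longrightarrow>
      trace_norm (\<lambda>x. U s x - U r x - (s - r) *\<^sub>R D x) \<le> ennreal (C * (s - r)\<^sup>2)"
proof -
  obtain \<delta> and A :: "nat \<Rightarrow> 'a \<Rightarrow> 'a" where "0 < \<delta>" and A: "\<And>n. trace_class (A n)"
    and lim: "\<And>s. s \<in> {u..v} \<Longrightarrow> \<bar>s - r\<bar> < \<delta> \<Longrightarrow>
      (\<lambda>N. trace_norm (\<lambda>x. U s x - U r x - (\<Sum>n<N. (s - r) ^ Suc n *\<^sub>R A n x))) \<longlonglongrightarrow> 0"
    using an r unfolding tn_analytic_on_def by blast
  \<comment> \<open>The base point may be an endpoint, so the comparison point is taken on a side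
    where the interval has room.\<close>
  define s0 where "s0 = (if r < v then min v (r + \<delta> / 2) else max u (r - \<delta> / 2))"
  have s0: "s0 \<in> {u..v}" "\<bar>s0 - r\<bar> < \<delta>" "s0 - r \<noteq> 0"
    using \<open>u < v\<close> r \<open>0 < \<delta>\<close> by (auto simp: s0_def min_def max_def)
  obtain B where B: "0 \<le> B" "\<And>n. trace_norm (A n) \<le> ennreal (B / \<bar>s0 - r\<bar> ^ Suc n)"
    using trace_norm_series_coeff_bound[OF A s0(3) lim[OF s0(1,2)]] by blast
  define h0 where "h0 = \<bar>s0 - r\<bar>"
  have h0: "0 < h0" "h0 < \<delta>" using s0 by (simp_all add: h0_def)
  have "trace_norm (\<lambda>x. U s x - U r x - (s - r) *\<^sub>R A 0 x) \<le> ennreal (2 * B / h0\<^sup>2 * (s - r)\<^sup>2)"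
    if s: "s \<in> {u..v}" "\<bar>s - r\<bar> < h0 / 2" for s
  proof -
    define R where "R = (\<lambda>N x. U s x - U r x - (\<Sum>n<N. (s - r) ^ Suc n *\<^sub>R A n x))"
    define q where "q = \<bar>s - r\<bar> / h0"
    have q: "0 \<le> q" "q \<le> 1 / 2" using s(2) h0 by (simp_all add: q_def field_simps)
    have R: "(\<lambda>N. trace_norm (R N)) \<longlonglongrightarrow> 0"
      unfolding R_def by (rule lim) (use s h0 in auto)
    have term_le: "trace_norm (\<lambda>x. (s - r) ^ Suc n *\<^sub>R A n x) \<le> ennreal (B * q ^ Suc n)" for n
    proof -
      have "trace_norm (\<lambda>x. (s - r) ^ Suc n *\<^sub>R A n x) \<le> ennreal \<bar>(s - r) ^ Suc n\<bar> * trace_norm (A n)"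
        by (rule trace_norm_scaleR)
      also have "\<dots> \<le> ennreal \<bar>(s - r) ^ Suc n\<bar> * ennreal (B / h0 ^ Suc n)"
        using B(2) by (intro mult_left_mono) (simp_all add: h0_def)
      also have "\<dots> = ennreal (\<bar>(s - r) ^ Suc n\<bar> * (B / h0 ^ Suc n))"
        using B(1) h0 by (intro ennreal_mult[symmetric]) auto
      also have "\<bar>(s - r) ^ Suc n\<bar> * (B / h0 ^ Suc n) = B * q ^ Suc n"
        by (simp add: q_def power_divide power_abs del: power_Suc)
      finally show ?thesis .
    qed
    have bound: "trace_norm (\<lambda>x. U s x - U r x - (s - r) *\<^sub>R A 0 x) \<le> trace_norm (R N) + ennreal (2 * B * q\<^sup>2)"
      if "N \<ge> 1" for N
    proof -
      have split: "(\<Sum>n<N. (s - r) ^ Suc n *\<^sub>R A n x) = (s - r) *\<^sub>R A 0 x + (\<Sum>n\<in>{1..<N}. (s - r) ^ Suc n *\<^sub>R A n x)" for x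
        using that sum.atLeast_Suc_lessThan[of 0 N "\<lambda>n. (s - r) ^ Suc n *\<^sub>R A n x"]
        by (simp add: atLeast0LessThan)
      have "(\<lambda>x. U s x - U r x - (s - r) *\<^sub>R A 0 x) = (\<lambda>x. R N x + (\<Sum>n\<in>{1..<N}. (s - r) ^ Suc n *\<^sub>R A n x))"
        unfolding R_def split by (auto simp: algebra_simps)
      then have "trace_norm (\<lambda>x. U s x - U r x - (s - r) *\<^sub>R A 0 x)
          \<le> trace_norm (R N) + trace_norm (\<lambda>x. \<Sum>n\<in>{1..<N}. (s - r) ^ Suc n *\<^sub>R A n x)"
        by (simp only: trace_norm_add)
      also have "trace_norm (\<lambda>x. \<Sum>n\<in>{1..<N}. (s - r) ^ Suc n *\<^sub>R A n x)
          \<le> (\<Sum>n\<in>{1..<N}. trace_norm (\<lambda>x. (s - r) ^ Suc n *\<^sub>R A n x))"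
        by (rule trace_norm_sum)
      also have "\<dots> \<le> (\<Sum>n\<in>{1..<N}. ennreal (B * q ^ Suc n))" by (rule sum_mono) (rule term_le)
      also have "\<dots> = ennreal (B * (\<Sum>n\<in>{1..<N}. q ^ Suc n))"
        using B(1) q by (subst sum_ennreal) (auto simp: sum_distrib_left)
      also have "\<dots> \<le> ennreal (B * (2 * q\<^sup>2))"
        using B(1) by (intro ennreal_leI mult_left_mono geometric_tail_le q)
      also have "B * (2 * q\<^sup>2) = 2 * B * q\<^sup>2" by simp
      finally show ?thesis by (simp add: add_left_mono)
    qed
    have "(\<lambda>N. trace_norm (R N) + ennreal (2 * B * q\<^sup>2)) \<longlonglongrightarrow> 0 + ennreal (2 * B * q\<^sup>2)"
      by (intro tendsto_add R tendsto_const)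
    then have "trace_norm (\<lambda>x. U s x - U r x - (s - r) *\<^sub>R A 0 x) \<le> 0 + ennreal (2 * B * q\<^sup>2)"
      by (rule LIMSEQ_le_const) (use bound in auto)
    then show ?thesis by (simp add: q_def power_divide)
  qed
  with A[of 0] B(1) h0 show ?thesis by (intro that[of "A 0" "2 * B / h0\<^sup>2" "h0 / 2"]) auto
qed

text \<open>The linear coefficient of the expansion is itself a trace-norm derivative, so the
  hypothesis bounds it by \<open>M\<close>; close to \<open>r\<close> the quadratic remainder fits
  into the slack \<open>K - M\<close>.\<close>

lemma tn_analytic_derivative:
  fixes U :: "real \<Rightarrow> 'a::chilbert_space \<Rightarrow> 'a"
  assumes an: "tn_analytic_on U {u..v}" and "u < v" and r: "r \<in> {u..v}"
    and M: "\<And>D. trace_class D \<Longrightarrow> tn_deriv_within U D r {u..v} \<Longrightarrow> trace_norm D \<le> ennreal M"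
    and "0 \<le> M" "M < K"
  obtains \<delta> where "0 < \<delta>"
    "\<And>s. s \<in> {u..v} \<Longrightarrow> \<bar>s - r\<bar> < \<delta> \<Longrightarrow> trace_norm (\<lambda>x. U s x - U r x) \<le> ennreal (K * \<bar>s - r\<bar>)"
proof -
  obtain D C \<delta> where D: "trace_class D" and C: "0 \<le> C" "0 < \<delta>"
    and exp: "\<And>s. s \<in> {u..v} \<Longrightarrow> \<bar>s - r\<bar> < \<delta> \<Longrightarrow>
      trace_norm (\<lambda>x. U s x - U r x - (s - r) *\<^sub>R D x) \<le> ennreal (C * (s - r)\<^sup>2)"
    using tn_analytic_expansion[OF an \<open>u < v\<close> r] by blast
  have quot: "trace_norm (\<lambda>x. (1 / (s - r)) *\<^sub>R (U s x - U r x) - D x) \<le> ennreal (C * \<bar>s - r\<bar>)"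
    if "s \<in> {u..v}" "\<bar>s - r\<bar> < \<delta>" "s \<noteq> r" for s
  proof -
    have "(\<lambda>x. (1 / (s - r)) *\<^sub>R (U s x - U r x) - D x) = (\<lambda>x. (1 / (s - r)) *\<^sub>R (U s x - U r x - (s - r) *\<^sub>R D x))"
      using that(3) by (simp add: scaleR_diff_right)
    then have "trace_norm (\<lambda>x. (1 / (s - r)) *\<^sub>R (U s x - U r x) - D x)
        \<le> ennreal \<bar>1 / (s - r)\<bar> * trace_norm (\<lambda>x. U s x - U r x - (s - r) *\<^sub>R D x)"
      by (simp only: trace_norm_scaleR)
    also have "\<dots> \<le> ennreal \<bar>1 / (s - r)\<bar> * ennreal (C * (s - r)\<^sup>2)"
      by (intro mult_left_mono exp that) simp
    also have "\<dots> = ennreal (\<bar>1 / (s - r)\<bar> * (C * (s - r)\<^sup>2))"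
      using C by (intro ennreal_mult[symmetric]) auto
    also have "\<bar>1 / (s - r)\<bar> * (C * (s - r)\<^sup>2) = C * \<bar>s - r\<bar>"
    proof -
      have "(s - r)\<^sup>2 = \<bar>s - r\<bar>\<^sup>2" "\<bar>1 / (s - r)\<bar> = 1 / \<bar>s - r\<bar>" "0 < \<bar>s - r\<bar>"
        using that(3) by simp_all
      then show ?thesis by (simp only: power2_eq_square) (simp add: field_simps)
    qed
    finally show ?thesis .
  qed
  have "tn_deriv_within U D r {u..v}"
    unfolding tn_deriv_within_def
  proof (rule tendsto_sandwich[of "\<lambda>_. 0"])
    have "((\<lambda>s. C * \<bar>s - r\<bar>) \<longlongrightarrow> C * \<bar>r - r\<bar>) (at r within {u..v})"
      by (intro tendsto_intros)
    then show "((\<lambda>s. ennreal (C * \<bar>s - r\<bar>)) \<longlongrightarrow> 0) (at r within {u..v})"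
      using tendsto_ennrealI by fastforce
    show "\<forall>\<^sub>F s in at r within {u..v}. trace_norm (\<lambda>x. (1 / (s - r)) *\<^sub>R (U s x - U r x) - D x) \<le> ennreal (C * \<bar>s - r\<bar>)"
      unfolding eventually_at using quot C(2) by (intro exI[of _ \<delta>]) (auto simp: dist_real_def)
  qed auto
  from M[OF D this] have DM: "trace_norm D \<le> ennreal M" .
  \<comment> \<open>\<open>C + 1\<close> guards against \<open>C = 0\<close> in the
    denominator.\<close>
  define \<delta>' where "\<delta>' = min \<delta> ((K - M) / (C + 1))"
  have "0 < \<delta>'" using C \<open>M < K\<close> by (simp add: \<delta>'_def)
  moreover have "trace_norm (\<lambda>x. U s x - U r x) \<le> ennreal (K * \<bar>s - r\<bar>)"
    if s: "s \<in> {u..v}" "\<bar>s - r\<bar> < \<delta>'" for s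
  proof -
    have "trace_norm (\<lambda>x. U s x - U r x)
        \<le> trace_norm (\<lambda>x. U s x - U r x - (s - r) *\<^sub>R D x) + trace_norm (\<lambda>x. (s - r) *\<^sub>R D x)"
      using trace_norm_add[of "\<lambda>x. U s x - U r x - (s - r) *\<^sub>R D x" "\<lambda>x. (s - r) *\<^sub>R D x"] by simp
    also have "\<dots> \<le> ennreal (C * (s - r)\<^sup>2) + ennreal \<bar>s - r\<bar> * ennreal M"
      using s by (intro add_mono exp order_trans[OF trace_norm_scaleR] mult_left_mono DM) (auto simp: \<delta>'_def)
    also have "\<dots> = ennreal (C * (s - r)\<^sup>2 + \<bar>s - r\<bar> * M)"
      using C \<open>0 \<le> M\<close> by (simp add: ennreal_mult ennreal_plus)
    also have "C * (s - r)\<^sup>2 + \<bar>s - r\<bar> * M = (C * \<bar>s - r\<bar> + M) * \<bar>s - r\<bar>"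
    proof -
      have "(s - r)\<^sup>2 = \<bar>s - r\<bar> * \<bar>s - r\<bar>" by (simp add: power2_eq_square)
      then show ?thesis by (simp only: distrib_right mult.assoc mult.commute[of M])
    qed
    also have "\<dots> \<le> K * \<bar>s - r\<bar>"
    proof (intro mult_right_mono)
      have "\<bar>s - r\<bar> \<le> (K - M) / (C + 1)" using s(2) by (simp add: \<delta>'_def)
      then have "(C + 1) * \<bar>s - r\<bar> \<le> K - M" using C by (simp add: pos_le_divide_eq mult.commute)
      then show "C * \<bar>s - r\<bar> + M \<le> K" by (simp add: distrib_right)
    qed simp
    finally show ?thesis by (simp add: ennreal_leI)
  qed
  ultimately show ?thesis using that by blast
qed

text \<open>The finitely many entries different from 1 stay above some \<open>c\<close>. Grouped by
  value, they occur at most as often as in an eigenfamily at level \<open>c\<close>, whose sum the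
  trace norm controls.\<close>

lemma sum_spec_enumeration_le:
  fixes U :: "'a::chilbert_space \<Rightarrow> 'a"
  assumes U: "U \<in> unitary1" and t: "trace_norm (\<lambda>x. U x - x) \<le> ennreal t" "0 \<le> t"
    and s: "enumeration_of (spec U) s"
  shows "(\<Sum>j<N. cmod (s j - 1)) \<le> t"
proof -
  define J where "J = {j. j < N \<and> s j \<noteq> 1}"
  have "finite J" by (simp add: J_def)
  obtain c where c: "0 < c" "\<And>j. j \<in> J \<Longrightarrow> c \<le> cmod (s j - 1)"
    using finite_positive_lower_bound[of J "\<lambda>j. cmod (s j - 1)"] by (auto simp: J_def)
  obtain n and e :: "nat \<Rightarrow> 'a" and z where e: "eigenfamily U c n e z"
    using eigenfamily_exists[OF U c(1)] by blast
  have count: "card {j \<in> J. s j = w} \<le> card {i \<in> {..<n}. z i = w}" if "w \<in> s ` J" for w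
  proof -
    have "c \<le> cmod (w - 1)" using c(2) that by auto
    then have spec: "spec U w = enat (card {i. i < n \<and> z i = w})" by (rule spec_eq_card[OF U e c(1)])
    then have "finite {j. s j = w}" "card {j. s j = w} = card {i. i < n \<and> z i = w}"
      using s[unfolded enumeration_of_def, rule_format, of w] by (auto split: if_splits)
    moreover have "card {j \<in> J. s j = w} \<le> card {j. s j = w}"
      by (rule card_mono) (use calculation in auto)
    ultimately show ?thesis by simp
  qed
  have "(\<Sum>j<N. cmod (s j - 1)) = (\<Sum>j\<in>J. cmod (s j - 1))"
    by (rule sum.mono_neutral_right) (auto simp: J_def)
  also have "\<dots> = (\<Sum>w\<in>s ` J. \<Sum>j\<in>{j \<in> J. s j = w}. cmod (s j - 1))"
    by (rule sum.image_gen[OF \<open>finite J\<close>])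
  also have "\<dots> = (\<Sum>w\<in>s ` J. real (card {j \<in> J. s j = w}) * cmod (w - 1))"
    by (rule sum.cong) simp_all
  also have "\<dots> \<le> (\<Sum>w\<in>s ` J. real (card {i \<in> {..<n}. z i = w}) * cmod (w - 1))"
    using count by (intro sum_mono mult_right_mono) auto
  also have "\<dots> \<le> (\<Sum>w\<in>z ` {..<n}. real (card {i \<in> {..<n}. z i = w}) * cmod (w - 1))"
  proof (rule sum_mono2)
    show "s ` J \<subseteq> z ` {..<n}"
    proof
      fix w assume w: "w \<in> s ` J"
      then have "0 < card {j \<in> J. s j = w}" using \<open>finite J\<close> by (auto simp: card_gt_0_iff)
      then have "0 < card {i \<in> {..<n}. z i = w}" using count[OF w] by linarith
      then show "w \<in> z ` {..<n}" by (auto simp: card_gt_0_iff)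
    qed
  qed auto
  also have "\<dots> = (\<Sum>w\<in>z ` {..<n}. \<Sum>i\<in>{i \<in> {..<n}. z i = w}. cmod (z i - 1))"
    by (rule sum.cong) simp_all
  also have "\<dots> = (\<Sum>i<n. cmod (z i - 1))"
    by (rule sum.image_gen[symmetric]) simp
  also have "\<dots> \<le> t"
    by (rule sum_eigenvalues_le[OF _ eigenfamilyD(1,2)[OF e] t]) auto
  finally show ?thesis .
qed

lemma spec_enumeration_summable:
  assumes U: "U \<in> unitary1" and s: "enumeration_of (spec U) s"
  shows "summable (\<lambda>j. arcdist (s j) 1)"
proof -
  obtain t where t: "trace_norm (\<lambda>x. U x - x) \<le> ennreal t" "0 \<le> t"
    using unitary1_trace_norm[OF U] .
  have "arcdist (s j) 1 \<le> 3 * cmod (s j - 1)" for j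
    by (rule arcdist_le_chord) (use spec_nonzero_cmod[OF U enumeration_ofD[OF s]] in auto)
  then have *: "(\<Sum>j<N. arcdist (s j) 1) \<le> 3 * t" for N
    using sum_mono[of "{..<N}" "\<lambda>j. arcdist (s j) 1" "\<lambda>j. 3 * cmod (s j - 1)"]
      sum_spec_enumeration_le[OF U t s, of N] by (simp flip: sum_distrib_left)
  show ?thesis
  proof (rule bounded_imp_summable)
    show "(\<Sum>j\<le>N. arcdist (s j) 1) \<le> 3 * t" for N
      using *[of "Suc N"] by (simp only: lessThan_Suc_atMost)
  qed (rule arcdist_nonneg)
qed

lemma spec_1: "spec U 1 = \<infinity>" by (simp add: spec_def)

lemma spec_enumeration_exists:
  assumes "U \<in> unitary1" obtains s where "enumeration_of (spec U) s"
  using enumeration_of_exists[OF spec_1 countable_spec[OF assms]] by blast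

lemma spec_in_S1T:
  assumes U: "U \<in> unitary1" shows "spec U \<in> S1T"
proof -
  have "\<not> z islimpt {w. spec U w \<noteq> 0}" if "z \<noteq> 1" for z
  proof
    assume lim: "z islimpt {w. spec U w \<noteq> 0}"
    \<comment> \<open>Points within half the distance from \<open>z\<close> to 1 stay that far from
      1, and only finitely many eigenvalues do.\<close>
    define r where "r = cmod (z - 1) / 2"
    have "0 < r" using that by (simp add: r_def)
    then have "infinite ({w. spec U w \<noteq> 0} \<inter> ball z r)"
      using lim by (simp add: islimpt_eq_infinite_ball)
    moreover have "{w. spec U w \<noteq> 0} \<inter> ball z r \<subseteq> {w. spec U w \<noteq> 0 \<and> r \<le> cmod (w - 1)}"
    proof
      fix w assume w: "w \<in> {w. spec U w \<noteq> 0} \<inter> ball z r"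
      have "2 * r \<le> cmod (z - w) + cmod (w - 1)"
        using norm_triangle_ineq[of "z - w" "w - 1"] by (simp add: r_def)
      then show "w \<in> {w. spec U w \<noteq> 0 \<and> r \<le> cmod (w - 1)}" using w by (simp add: dist_norm)
    qed
    ultimately show False using finite_spec_away[OF U \<open>0 < r\<close>] finite_subset by blast
  qed
  moreover have "rigged_dist (spec U) one_rigged < top"
  proof -
    obtain s where s: "enumeration_of (spec U) s" using spec_enumeration_exists[OF U] .
    have "enumeration_of one_rigged (\<lambda>_. 1)"
      by (auto simp: enumeration_of_def one_rigged_def zero_enat_def)
    then have "rigged_dist (spec U) one_rigged \<le> (\<Sum>j. ennreal (arcdist (s j) 1))"
      unfolding rigged_dist_eq_rdist by (rule rdist_le[OF s])
    also have "\<dots> < top"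
      using ennreal_suminf_neq_top[OF spec_enumeration_summable[OF U s] arcdist_nonneg] by (simp add: less_top)
    finally show ?thesis .
  qed
  ultimately show ?thesis
    using spec_nonzero_cmod[OF U] countable_spec[OF U] by (simp add: S1T_def spec_1)
qed

section \<open>Spectra along a path\<close>

lemma spec_rdist_triangle:
  assumes "U \<in> unitary1" "V \<in> unitary1" "W \<in> unitary1"
  shows "rigged_dist (spec U) (spec W) \<le> rigged_dist (spec U) (spec V) + rigged_dist (spec V) (spec W)"
    and "rdist (collapsed_dist \<eta>) (spec U) (spec W)
      \<le> rdist (collapsed_dist \<eta>) (spec U) (spec V) + rdist (collapsed_dist \<eta>) (spec V) (spec W)"
  unfolding rigged_dist_eq_rdist
  using spec_nonzero_cmod[OF assms(1)] spec_nonzero_cmod[OF assms(2)] spec_nonzero_cmod[OF assms(3)]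
  by (auto intro!: rdist_triangle arcdist_triangle collapsed_dist_triangle arcdist_nonneg collapsed_dist_nonneg)

text \<open>The bound is additive over adjacent intervals and holds on every sufficiently short
  interval around each point \<open>r\<close>, with shortness depending on \<open>r\<close>.
  Bolzano's bisection principle turns this into a bound on the whole piece.\<close>

lemma collapsed_spec_dist_on_piece:
  fixes U :: "real \<Rightarrow> 'a::chilbert_space \<Rightarrow> 'a"
  assumes an: "tn_analytic_on U {u..v}" and "u < v"
    and U: "\<And>r. r \<in> {u..v} \<Longrightarrow> U r \<in> unitary1"
    and M: "\<And>r D. r \<in> {u..v} \<Longrightarrow> trace_class D \<Longrightarrow> tn_deriv_within U D r {u..v} \<Longrightarrow> trace_norm D \<le> ennreal M"
    and "0 \<le> M" "M < K" and "0 < \<eta>"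
  shows "rdist (collapsed_dist \<eta>) (spec (U u)) (spec (U v)) \<le> ennreal (K * (v - u))"
proof -
  let ?d = "rdist (collapsed_dist \<eta>)"
  define P where "P = (\<lambda>x y. u \<le> x \<and> x \<le> y \<and> y \<le> v \<longrightarrow> ?d (spec (U x)) (spec (U y)) \<le> ennreal (K * (y - x)))"
  have trans: "?d (spec (U x)) (spec (U z)) \<le> ennreal (K * (z - x))"
    if "u \<le> x" "x \<le> y" "y \<le> z" "z \<le> v" "?d (spec (U x)) (spec (U y)) \<le> ennreal (K * (y - x))"
      "?d (spec (U y)) (spec (U z)) \<le> ennreal (K * (z - y))" for x y z
  proof -
    have "?d (spec (U x)) (spec (U z)) \<le> ?d (spec (U x)) (spec (U y)) + ?d (spec (U y)) (spec (U z))"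
      by (rule spec_rdist_triangle; rule U) (use that in auto)
    also have "\<dots> \<le> ennreal (K * (y - x)) + ennreal (K * (z - y))" by (intro add_mono that)
    also have "\<dots> = ennreal (K * (y - x) + K * (z - y))"
      using that \<open>0 \<le> M\<close> \<open>M < K\<close> by (intro ennreal_plus[symmetric]) auto
    also have "K * (y - x) + K * (z - y) = K * (z - x)" by (simp add: algebra_simps)
    finally show ?thesis .
  qed
  have "P u v"
  proof (rule Bolzano[where P = P])
    show "u \<le> v" using \<open>u < v\<close> by simp
  next
    fix x y z assume "P x y" "P y z" "x \<le> y" "y \<le> z"
    then show "P x z" unfolding P_def using trans[of x y z] by auto
  next
    fix r assume "u \<le> r" "r \<le> v"
    then have r: "r \<in> {u..v}" by simp
    \<comment> \<open>The slack is spent twice: from \<open>M\<close> to \<open>L\<close> on the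
      quadratic remainder of the path, and from \<open>L\<close> to \<open>K\<close> on the factor
      \<open>1 + \<epsilon>\<close> of the local estimate, with
      \<open>\<epsilon> = K / L - 1\<close>.\<close>
    define L where "L = (M + K) / 2"
    have L: "M < L" "L < K" "0 < L" using \<open>M < K\<close> \<open>0 \<le> M\<close> by (auto simp: L_def)
    have "0 < K / L - 1" using L by simp
    obtain \<delta>1 where \<delta>1: "0 < \<delta>1" and lip: "\<And>s. s \<in> {u..v} \<Longrightarrow> \<bar>s - r\<bar> < \<delta>1 \<Longrightarrow>
        trace_norm (\<lambda>x. U s x - U r x) \<le> ennreal (L * \<bar>s - r\<bar>)"
      using tn_analytic_derivative[OF an \<open>u < v\<close> r M[OF r] \<open>0 \<le> M\<close> L(1)] by blast
    obtain \<delta>0 where \<delta>0: "0 < \<delta>0" and est: "\<And>V \<delta>. V \<in> unitary1 \<Longrightarrow> 0 \<le> \<delta> \<Longrightarrow> \<delta> < \<delta>0 \<Longrightarrow>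
        trace_norm (\<lambda>x. V x - U r x) \<le> ennreal \<delta> \<Longrightarrow>
        ?d (spec (U r)) (spec V) \<le> ennreal ((1 + (K / L - 1)) * \<delta>)"
      using spec_local_estimate[OF U[OF r] \<open>0 < \<eta>\<close> \<open>0 < K / L - 1\<close>] by blast
    define d where "d = min \<delta>1 (\<delta>0 / L)"
    have "0 < d" using \<delta>1 \<delta>0 L by (simp add: d_def)
    have near: "?d (spec (U r)) (spec (U s)) \<le> ennreal (K * \<bar>s - r\<bar>)" if s: "s \<in> {u..v}" "\<bar>s - r\<bar> < d" for s
    proof -
      have "\<bar>s - r\<bar> < \<delta>0 / L" using s(2) by (simp add: d_def)
      then have "L * \<bar>s - r\<bar> < \<delta>0" using L by (simp add: pos_less_divide_eq mult.commute)
      then have "?d (spec (U r)) (spec (U s)) \<le> ennreal ((1 + (K / L - 1)) * (L * \<bar>s - r\<bar>))"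
        using s L by (intro est U lip) (auto simp: d_def)
      then show ?thesis using L by simp
    qed
    have "P x y" if "x \<le> r \<and> r \<le> y \<and> y - x < d" for x y
      unfolding P_def
    proof
      assume xy: "u \<le> x \<and> x \<le> y \<and> y \<le> v"
      \<comment> \<open>The local estimate has its base operator at \<open>r\<close>, so the left
        half of the interval is reached by symmetry of the cost.\<close>
      have "?d (spec (U x)) (spec (U r)) \<le> ?d (spec (U r)) (spec (U x))"
        using spec_nonzero_cmod[OF U, of x] spec_nonzero_cmod[OF U[OF r]] xy that
        by (intro rdist_commute_le collapsed_dist_commute) auto
      also have "\<dots> \<le> ennreal (K * (r - x))" using near[of x] xy that by auto
      finally have "?d (spec (U x)) (spec (U r)) \<le> ennreal (K * (r - x))" .
      moreover have "?d (spec (U r)) (spec (U y)) \<le> ennreal (K * (y - r))" using near[of y] xy that by auto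
      ultimately show "?d (spec (U x)) (spec (U y)) \<le> ennreal (K * (y - x))"
        using trans[of x r y] xy that by auto
    qed
    then show "\<exists>d>0. \<forall>x y. x \<le> r \<and> r \<le> y \<and> y - x < d \<longrightarrow> P x y" using \<open>0 < d\<close> by blast
  qed
  then show ?thesis using \<open>u < v\<close> by (simp add: P_def)
qed

text \<open>The order of limits matters: for fixed \<open>\<eta>\<close> the constant
  \<open>K\<close> is lowered to \<open>M\<close>, and the resulting bound, now independent of
  \<open>\<eta>\<close>, allows the arc to shrink.\<close>

lemma spec_dist_on_piece:
  fixes U :: "real \<Rightarrow> 'a::chilbert_space \<Rightarrow> 'a"
  assumes an: "tn_analytic_on U {u..v}" and "u < v"
    and U: "\<And>r. r \<in> {u..v} \<Longrightarrow> U r \<in> unitary1"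
    and M: "\<And>r D. r \<in> {u..v} \<Longrightarrow> trace_class D \<Longrightarrow> tn_deriv_within U D r {u..v} \<Longrightarrow> trace_norm D \<le> ennreal M"
    and "0 \<le> M"
  shows "rigged_dist (spec (U u)) (spec (U v)) \<le> ennreal (M * (v - u))"
proof -
  have uv: "U u \<in> unitary1" "U v \<in> unitary1" using U \<open>u < v\<close> by auto
  obtain s where s: "enumeration_of (spec (U u)) s" using spec_enumeration_exists[OF uv(1)] .
  obtain t where t: "enumeration_of (spec (U v)) t" using spec_enumeration_exists[OF uv(2)] .
  show ?thesis
  proof (rule rigged_dist_le_if_collapsed[OF spec_1 spec_nonzero_cmod[OF uv(1)] spec_1 spec_nonzero_cmod[OF uv(2)]
        s spec_enumeration_summable[OF uv(1) s] t spec_enumeration_summable[OF uv(2) t]])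
    fix \<eta> :: real assume "0 < \<eta>"
    show "rdist (collapsed_dist \<eta>) (spec (U u)) (spec (U v)) \<le> ennreal (M * (v - u))"
    proof (rule ennreal_le_epsilon)
      fix \<epsilon> :: real assume "0 < \<epsilon>"
      then have "M < M + \<epsilon> / (v - u)" using \<open>u < v\<close> by simp
      from collapsed_spec_dist_on_piece[OF an \<open>u < v\<close> U M \<open>0 \<le> M\<close> this \<open>0 < \<eta>\<close>]
      have "rdist (collapsed_dist \<eta>) (spec (U u)) (spec (U v)) \<le> ennreal ((M + \<epsilon> / (v - u)) * (v - u))" .
      also have "(M + \<epsilon> / (v - u)) * (v - u) = M * (v - u) + \<epsilon>" using \<open>u < v\<close> by (simp add: distrib_right)
      also have "ennreal \<dots> = ennreal (M * (v - u)) + ennreal \<epsilon>"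
        using \<open>0 \<le> M\<close> \<open>u < v\<close> \<open>0 < \<epsilon>\<close> by (intro ennreal_plus) auto
      finally show "rdist (collapsed_dist \<eta>) (spec (U u)) (spec (U v)) \<le> ennreal (M * (v - u)) + ennreal \<epsilon>" .
    qed
  qed
qed

lemma spec_dist_along_path:
  fixes U :: "real \<Rightarrow> 'a::chilbert_space \<Rightarrow> 'a" and t :: "nat \<Rightarrow> real"
  assumes t: "\<And>j. j < k \<Longrightarrow> t j < t (Suc j)"
    and an: "\<And>j. j < k \<Longrightarrow> tn_analytic_on U {t j..t (Suc j)}"
    and U: "\<And>r. r \<in> {t 0..t k} \<Longrightarrow> U r \<in> unitary1"
    and M: "\<And>j r D. j < k \<Longrightarrow> r \<in> {t j..t (Suc j)} \<Longrightarrow> trace_class D \<Longrightarrow>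
      tn_deriv_within U D r {t j..t (Suc j)} \<Longrightarrow> trace_norm D \<le> ennreal M"
    and "0 \<le> M"
  shows "rigged_dist (spec (U (t 0))) (spec (U (t k))) \<le> ennreal (M * (t k - t 0))"
proof -
  have mono: "t i \<le> t j" if "i \<le> j" "j \<le> k" for i j
    using that(1)
  proof (induction rule: inc_induct)
    case (step i)
    then show ?case using t[of i] that(2) by simp
  qed simp
  have "rigged_dist (spec (U (t 0))) (spec (U (t j))) \<le> ennreal (M * (t j - t 0))" if "j \<le> k" for j
    using that
  proof (induction j)
    case 0
    have U0: "U (t 0) \<in> unitary1" using U mono[of 0 k] by simp
    obtain s where s: "enumeration_of (spec (U (t 0))) s" using spec_enumeration_exists[OF U0] .
    have "arcdist (s j) (s j) = 0" for j
      using arcdist_le_chord(1)[of "s j" "s j"] spec_nonzero_cmod[OF U0 enumeration_ofD[OF s, of j]]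
        arcdist_nonneg[of "s j" "s j"] by simp
    then show ?case using rdist_le[OF s s, of arcdist] by (simp add: rigged_dist_eq_rdist)
  next
    case (Suc j)
    have Ur: "U r \<in> unitary1" if "r \<in> {t j..t (Suc j)}" for r
      using U[of r] that mono[of 0 j] mono[of "Suc j" k] Suc.prems by simp
    have tj: "t j < t (Suc j)" and t0: "t 0 \<le> t j" using t[of j] mono[of 0 j] Suc.prems by simp_all
    have U0: "U (t 0) \<in> unitary1" using U mono[of 0 k] by simp
    have "rigged_dist (spec (U (t 0))) (spec (U (t (Suc j))))
        \<le> rigged_dist (spec (U (t 0))) (spec (U (t j))) + rigged_dist (spec (U (t j))) (spec (U (t (Suc j))))"
      by (rule spec_rdist_triangle(1)) (use U0 Ur tj in auto)
    also have "\<dots> \<le> ennreal (M * (t j - t 0)) + ennreal (M * (t (Suc j) - t j))"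
    proof (intro add_mono)
      have "j < k" using Suc.prems by simp
      show "rigged_dist (spec (U (t j))) (spec (U (t (Suc j)))) \<le> ennreal (M * (t (Suc j) - t j))"
        by (rule spec_dist_on_piece[OF an[OF \<open>j < k\<close>] tj Ur M[OF \<open>j < k\<close>] \<open>0 \<le> M\<close>])
    qed (use Suc in simp)
    also have "\<dots> = ennreal (M * (t j - t 0) + M * (t (Suc j) - t j))"
      using \<open>0 \<le> M\<close> tj t0 by (intro ennreal_plus[symmetric]) auto
    also have "M * (t j - t 0) + M * (t (Suc j) - t j) = M * (t (Suc j) - t 0)" by (simp add: algebra_simps)
    finally show ?case .
  qed
  then show ?thesis by simp
qed

lemma rigged_dist_spec_le_d1:
  fixes U0 :: "'a::chilbert_space \<Rightarrow> 'a"
  shows "rigged_dist (spec U0) (spec U1) \<le> d1 U0 U1"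
  unfolding d1_def
proof (rule Inf_greatest, clarsimp)
  fix U :: "real \<Rightarrow> 'a \<Rightarrow> 'a" and k and t :: "nat \<Rightarrow> real"
  assume ab: "t 0 < t k" and t: "\<forall>j<k. t j < t (Suc j)" and an: "\<forall>j<k. tn_analytic_on U {t j..t (Suc j)}"
    and U: "\<forall>r\<in>{t 0..t k}. U r \<in> unitary1"
  define X where "X = {trace_norm D | r D. \<exists>j<k. t j \<le> r \<and> r \<le> t (Suc j) \<and> trace_class D \<and>
    tn_deriv_within U D r {t j..t (Suc j)}}"
  show "rigged_dist (spec (U (t 0))) (spec (U (t k))) \<le> ennreal (t k - t 0) * Sup X"
  proof (cases "Sup X")
    case (real M)
    have "trace_norm D \<le> ennreal M"
      if "j < k" "r \<in> {t j..t (Suc j)}" "trace_class D" "tn_deriv_within U D r {t j..t (Suc j)}" for j r D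
      unfolding real(2)[symmetric] by (rule Sup_upper) (use that in \<open>auto simp: X_def\<close>)
    then have "rigged_dist (spec (U (t 0))) (spec (U (t k))) \<le> ennreal (M * (t k - t 0))"
      using t an U real by (intro spec_dist_along_path) auto
    then show ?thesis using real ab by (simp add: ennreal_mult mult.commute)
  next
    case top
    \<comment> \<open>The factor \<open>t k - t 0\<close> is positive, so the product is not the
      degenerate value 0.\<close>
    then have "ennreal (t k - t 0) * Sup X = top" using ab by (simp only: ennreal_mult_top) simp
    then show ?thesis by (simp only: top_greatest)
  qed
qed

theorem mainTheorem16:
  shows "(\<forall>U \<in> (unitary1 :: ('a::chilbert_space \<Rightarrow> 'a) set). spec U \<in> S1T)
    \<and> (\<forall>U \<in> (unitary1 :: ('a \<Rightarrow> 'a) set). \<forall>\<epsilon>>0. \<exists>\<delta>>0. \<forall>V \<in> unitary1.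
          d1 U V < ennreal \<delta> \<longrightarrow> rigged_dist (spec U) (spec V) < ennreal \<epsilon>)
    \<and> (\<forall>U1 \<in> (unitary1 :: ('a \<Rightarrow> 'a) set). \<forall>U2 \<in> unitary1.
          rigged_dist (spec U1) (spec U2) \<le> d1 U1 U2)"
proof (intro conjI ballI allI impI)
  fix U :: "'a \<Rightarrow> 'a" and \<epsilon> :: real
  assume "0 < \<epsilon>"
  \<comment> \<open>The map is 1-Lipschitz by the inequality just proved, so
    \<open>\<epsilon>\<close> itself serves as \<open>\<delta>\<close>.\<close>
  then show "\<exists>\<delta>>0. \<forall>V \<in> unitary1. d1 U V < ennreal \<delta> \<longrightarrow> rigged_dist (spec U) (spec V) < ennreal \<epsilon>"
    using rigged_dist_spec_le_d1 by (intro exI[of _ \<epsilon>]) (auto intro: order_le_less_trans)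
qed (simp_all add: spec_in_S1T rigged_dist_spec_le_d1)

end
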